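(* Let $L\ge2$. Given a quadruple of indices $(i,j,k,l)\in\mathbb Z_{\ge1}^4$ and a pair of words $w,\widetilde w\in W_L$, there exists a finite collection of pairwise distinct normal monomials $\tau_1(s),\dots,\tau_m(s)$, which have degree at most $\ell(w)+\ell(\widetilde w)-1$ and are of the form $$t_{ij}(\cdot;s),\quad t_{kl}(\cdot;s),\quad t_{il}(\cdot;s),\quad t_{kj}(\cdot;s),\quad :\!t_{ij}(\cdot;s)t_{kl}(\cdot;s)\!:,\quad :\!t_{il}(\cdot;s)t_{kj}(\cdot;s)\!:$$ (where dots stand for words in $W_L$ not depending on $s$), with the property that for any $s\in\mathbb C$ the following commutation relation holds in $A_{\infty,L}$: $$[t_{ij}(w;s),t_{kl}(\widetilde w;s)]=c_1\tau_1(s)+\dots+c_m\tau_m(s);$$ here $c_1,\dots,c_m$ are some integral coefficients which do not depend on $s$.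
   Context: The ground field is $\mathbb C$; algebras are associative and unital. $\mathfrak{gl}(N,\mathbb C)$ has the basis of matrix units $E_{ij}$; $E_{ij\mid\alpha}$ is $E_{ij}$ in the $\alpha$-th copy in $\mathfrak{gl}(N,\mathbb C)^{\oplus L}$, $\alpha\in[L]=\{1,\dots,L\}$. $U(\cdot)$ is the universal enveloping algebra with its standard filtration. For $0\le d\le N$, $\mathfrak{gl}_d(N,\mathbb C)$ is the span of $E_{ij}$ with $d<i,j\le N$; $\operatorname{diag}$ is the diagonal embedding into $\mathfrak{gl}(N,\mathbb C)^{\oplus L}$. $A_{d,L}(N):=U(\mathfrak{gl}(N,\mathbb C)^{\oplus L})^{\operatorname{diag}\mathfrak{gl}_d(N,\mathbb C)}$ (centralizer). Let $I^+(N)$ be the left ideal of $U(\mathfrak{gl}(N,\mathbb C)^{\oplus L})$ generated by all $E_{iN\mid\alpha}$, $1\le i\le N$, $\alpha\in[L]$. Then $J(N):=A_{N-1,L}(N)\cap I^+(N)$ is a two-sided ideal of $A_{N-1,L}(N)$ and $A_{N-1,L}(N)=U(\mathfrak{gl}(N-1,\mathbb C)^{\oplus L})\oplus J(N)$. The projection $\pi_{N,N-1}$ onto the first summand is a filtration-preserving algebra morphism and maps $A_{d,L}(N)$ into $A_{d,L}(N-1)$ for $d\le N-1$. $A_{d,L}:=\varprojlim(A_{d,L}(N),\pi_{N,N-1})$ in the category of filtered algebras: elements are sequences $(x_N)_{N\ge\max(d,1)}$, $x_N\in A_{d,L}(N)$, with $\pi_{N,N-1}(x_N)=x_{N-1}$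 and uniformly bounded degrees. Restricting sequences to $N\ge d+1$ gives embeddings $A_{d,L}\hookrightarrow A_{d+1,L}$, and $A_{\infty,L}:=\varinjlim A_{d,L}$. $W_L$ is the set of nonempty words in the alphabet $[L]$; $\ell(w)$ is the length. Let $u_1,\dots,u_L$ be free noncommuting variables, commuting with coefficients, $\bar u(w)=u_{w_1}^{-1}\cdots u_{w_n}^{-1}$ for $w=w_1\dots w_n$, and $E(N)_\alpha=[E_{ij\mid\alpha}]_{i,j=1}^N$. For $s\in\mathbb C$ define $t_{ij}(w;N;s)\in U(\mathfrak{gl}(N,\mathbb C)^{\oplus L})$ by (with $(u_\alpha+c)^{-1}=\sum_{k\ge0}(-c)^ku_\alpha^{-k-1}$) $$\Bigl(\bigl(1-\sum_{\alpha=1}^L\tfrac{E(N)_\alpha}{u_\alpha+N+s}\bigr)^{-1}\Bigr)_{ij}=\delta_{ij}+\sum_{w\in W_L}t_{ij}(w;N;s)\,\bar u(w).$$ For $1\le i,j\le d\le N$ these lie in $A_{d,L}(N)$ and are consistent with the projections $\pi_{N,N-1}$, so they define $t_{ij}(w;s)\in A_{d,L}\subset A_{\infty,L}$. Fix an arbitrary total order on the set of triples $(i,j;w)\in\mathbb Z_{\ge1}\times\mathbb Z_{\ge1}\times W_L$. A product of elements $t_{ab}(z;s)$ (with the same $s$) is called a normal monomial if its factors are written in weakly increasing order of their triples $(a,b;z)$; $:\!xy\!:$ denotes the normal monomial obtained by rearranging the factors $x,y$ in the due order. The degree of a monomial is the sum of the lengths of the words involved. *)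

theory Defs
  imports Complex_Main "HOL-Library.FuncSet" "HOL-Library.Poly_Mapping" "HOL-Algebra.QuotRing"
    "HOL-Algebra.Module"
begin

section \<open>Free associative algebras over the complex numbers\<close>

text \<open>
  The free monoid on a type is written additively, so that the free algebra is the monoid algebra
  \<open>'a fmon \<Rightarrow>\<^sub>0 complex\<close>, whose multiplication is the convolution of
  \<open>HOL-Library.Poly_Mapping\<close>.
\<close>

datatype 'a fmon = FMon (letters: "'a list")

instantiation fmon :: (type) monoid_add
begin

definition zero_fmon :: "'a fmon"
  where "0 = FMon []"

definition plus_fmon :: "'a fmon \<Rightarrow> 'a fmon \<Rightarrow> 'a fmon"
  where "x + y = FMon (letters x @ letters y)"

instance
  by standard (simp_all add: zero_fmon_def plus_fmon_def)

end

type_synonym 'a free = "'a fmon \<Rightarrow>\<^sub>0 complex"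

definition fscal :: "complex \<Rightarrow> 'a free"
  where "fscal c = Poly_Mapping.single 0 c"

definition fgen :: "'a \<Rightarrow> 'a free"
  where "fgen b = Poly_Mapping.single (FMon [b]) 1"

definition flin :: "('a \<Rightarrow>\<^sub>0 complex) \<Rightarrow> 'a free"
  where "flin v = (\<Sum>b\<in>Poly_Mapping.keys v. fscal (Poly_Mapping.lookup v b) * fgen b)"

definition free_alg :: "'a set \<Rightarrow> 'a free ring"
  where "free_alg B =
    \<lparr>carrier = {x. \<forall>m\<in>Poly_Mapping.keys x. set (letters m) \<subseteq> B},
      monoid.mult = (*), one = 1, ring.zero = 0, add = (+)\<rparr>"


section \<open>Universal enveloping algebras\<close>

text \<open>
  A complex Lie algebra is given by a basis \<open>B\<close> and by the brackets \<open>br b c\<close> of basis elements,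
  expanded in that basis.  Its universal enveloping algebra is the tensor algebra (the free algebra
  on \<open>B\<close>) modulo the two-sided ideal generated by all \<open>b c - c b - [b, c]\<close>.
\<close>

type_synonym 'a bracket = "'a \<Rightarrow> 'a \<Rightarrow> 'a \<Rightarrow>\<^sub>0 complex"

definition uea_ideal :: "'a set \<Rightarrow> 'a bracket \<Rightarrow> 'a free set"
  where "uea_ideal B br =
    Idl\<^bsub>free_alg B\<^esub> {fgen b * fgen c - fgen c * fgen b - flin (br b c) | b c. b \<in> B \<and> c \<in> B}"

definition uea_cls :: "'a set \<Rightarrow> 'a bracket \<Rightarrow> 'a free \<Rightarrow> 'a free set"
  where "uea_cls B br x = uea_ideal B br +>\<^bsub>free_alg B\<^esub> x"

definition uea :: "'a set \<Rightarrow> 'a bracket \<Rightarrow> (complex, 'a free set) module"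
  where "uea B br = (let Q = free_alg B Quot uea_ideal B br in
    \<lparr>carrier = carrier Q, monoid.mult = monoid.mult Q, one = one Q,
      ring.zero = ring.zero Q, add = add Q,
      smult = (\<lambda>c x. uea_cls B br (fscal c) \<otimes>\<^bsub>Q\<^esub> x)\<rparr>)"

definition uea_filt :: "'a set \<Rightarrow> 'a bracket \<Rightarrow> nat \<Rightarrow> 'a free set set"
  where "uea_filt B br k = uea_cls B br `
    {x \<in> carrier (free_alg B). \<forall>m\<in>Poly_Mapping.keys x. length (letters m) \<le> k}"


section \<open>The algebras \<open>U(gl(N)\<^sup>\<oplus>\<^sup>L)\<close>, their centralizers and the limit algebra\<close>

text \<open>The triple \<open>(i, j, \<alpha>)\<close> stands for \<open>E\<^sub>i\<^sub>j\<close> in the \<open>\<alpha>\<close>-th copy.\<close>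

type_synonym gl_index = "nat \<times> nat \<times> nat"

definition gl_basis :: "nat \<Rightarrow> nat \<Rightarrow> gl_index set"
  where "gl_basis N L = {1..N} \<times> {1..N} \<times> {1..L}"

fun gl_bracket :: "gl_index bracket" where
  "gl_bracket (i, j, \<alpha>) (k, l, \<beta>) =
    (if \<alpha> = \<beta> then
       (if j = k then Poly_Mapping.single (i, l, \<alpha>) 1 else 0) -
       (if l = i then Poly_Mapping.single (k, j, \<alpha>) 1 else 0)
     else 0)"

type_synonym ugl_elt = "gl_index free set"

definition Ugl :: "nat \<Rightarrow> nat \<Rightarrow> (complex, ugl_elt) module"
  where "Ugl N L = uea (gl_basis N L) gl_bracket"

definition ugl_cls :: "nat \<Rightarrow> nat \<Rightarrow> gl_index free \<Rightarrow> ugl_elt"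
  where "ugl_cls N L = uea_cls (gl_basis N L) gl_bracket"

definition ugl_filt :: "nat \<Rightarrow> nat \<Rightarrow> nat \<Rightarrow> ugl_elt set"
  where "ugl_filt N L = uea_filt (gl_basis N L) gl_bracket"

definition Egl :: "nat \<Rightarrow> nat \<Rightarrow> nat \<Rightarrow> nat \<Rightarrow> nat \<Rightarrow> ugl_elt"
  where "Egl N L i j \<alpha> = ugl_cls N L (fgen (i, j, \<alpha>))"

text \<open>
  The canonical map from \<open>U(gl(N-1)\<^sup>\<oplus>\<^sup>L)\<close> to \<open>U(gl(N)\<^sup>\<oplus>\<^sup>L)\<close>: a coset of the smaller ideal is
  enlarged to the coset of the larger ideal that contains it.
\<close>

definition ugl_incl :: "nat \<Rightarrow> nat \<Rightarrow> ugl_elt \<Rightarrow> ugl_elt"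
  where "ugl_incl N L y =
    uea_ideal (gl_basis N L) gl_bracket <+>\<^bsub>free_alg (gl_basis N L)\<^esub> y"

text \<open>The element \<open>diag X\<close> for \<open>X\<close> in the span of the \<open>E\<^sub>i\<^sub>j\<close> with \<open>d < i, j \<le> N\<close>.\<close>

definition diag_elt :: "nat \<Rightarrow> nat \<Rightarrow> nat \<Rightarrow> (nat \<Rightarrow> nat \<Rightarrow> complex) \<Rightarrow> ugl_elt"
  where "diag_elt d N L X =
    ugl_cls N L (\<Sum>i\<in>{d<..N}. \<Sum>j\<in>{d<..N}. \<Sum>\<alpha>\<in>{1..L}. fscal (X i j) * fgen (i, j, \<alpha>))"

definition centralizer :: "nat \<Rightarrow> nat \<Rightarrow> nat \<Rightarrow> ugl_elt set"
  where "centralizer d L N = {x \<in> carrier (Ugl N L).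
    \<forall>X. diag_elt d N L X \<otimes>\<^bsub>Ugl N L\<^esub> x = x \<otimes>\<^bsub>Ugl N L\<^esub> diag_elt d N L X}"

definition left_ideal_gen :: "('a, 'b) ring_scheme \<Rightarrow> 'a set \<Rightarrow> 'a set"
  where "left_ideal_gen R S = \<Inter>{I. additive_subgroup I R \<and>
    (\<forall>a\<in>carrier R. \<forall>x\<in>I. a \<otimes>\<^bsub>R\<^esub> x \<in> I) \<and> S \<subseteq> I}"

definition Iplus :: "nat \<Rightarrow> nat \<Rightarrow> ugl_elt set"
  where "Iplus L N = left_ideal_gen (Ugl N L) {Egl N L i N \<alpha> | i \<alpha>. i \<in> {1..N} \<and> \<alpha> \<in> {1..L}}"

definition Jideal :: "nat \<Rightarrow> nat \<Rightarrow> ugl_elt set"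
  where "Jideal L N = centralizer (N - 1) L N \<inter> Iplus L N"

text \<open>
  The projection of \<open>A\<^bsub>N-1,L\<^esub>(N) = U(gl(N-1)\<^sup>\<oplus>\<^sup>L) \<oplus> J(N)\<close> onto the first summand.
\<close>

definition ugl_proj :: "nat \<Rightarrow> nat \<Rightarrow> ugl_elt \<Rightarrow> ugl_elt"
  where "ugl_proj L N x = (THE y. y \<in> carrier (Ugl (N - 1) L) \<and>
    (\<exists>z\<in>Jideal L N. x = ugl_incl N L y \<oplus>\<^bsub>Ugl N L\<^esub> z))"

text \<open>
  \<open>A_fin d L\<close> is the filtered projective limit \<open>A\<^bsub>d,L\<^esub>\<close>: sequences indexed by \<open>N \<ge> max d 1\<close>,
  compatible with the projections and of bounded degree.
\<close>

definition A_fin :: "nat \<Rightarrow> nat \<Rightarrow> (nat \<Rightarrow> ugl_elt) set"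
  where "A_fin d L = {x \<in> (\<Pi>\<^sub>E N\<in>{max d 1..}. centralizer d L N).
    (\<forall>N>max d 1. ugl_proj L N (x N) = x (N - 1)) \<and>
    (\<exists>k. \<forall>N\<ge>max d 1. x N \<in> ugl_filt N L k)}"

text \<open>
  The maps \<open>A\<^bsub>d,L\<^esub> \<rightarrow> A\<^bsub>d+1,L\<^esub>\<close> restrict sequences to \<open>N \<ge> d + 1\<close>.  Hence \<open>x \<in> A\<^bsub>d,L\<^esub>\<close> and
  \<open>y \<in> A\<^bsub>e,L\<^esub>\<close> become equal in the inductive limit iff \<open>x N = y N\<close> for all large \<open>N\<close>, that is, iff
  they have the same germ at infinity.  Operations on germs are induced from the pointwise ones.
\<close>

definition germ :: "(nat \<Rightarrow> 'u) \<Rightarrow> (nat \<Rightarrow> 'u) set"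
  where "germ x = {y. eventually (\<lambda>N. y N = x N) sequentially}"

definition germ_alg :: "nat \<Rightarrow> (complex, (nat \<Rightarrow> ugl_elt) set) module"
  where "germ_alg L =
    \<lparr>carrier = {germ x | x. \<forall>N. x N \<in> carrier (Ugl N L)},
      monoid.mult = (\<lambda>P Q. \<Union>x\<in>P. \<Union>y\<in>Q. germ (\<lambda>N. x N \<otimes>\<^bsub>Ugl N L\<^esub> y N)),
      one = germ (\<lambda>N. \<one>\<^bsub>Ugl N L\<^esub>),
      ring.zero = germ (\<lambda>N. \<zero>\<^bsub>Ugl N L\<^esub>),
      add = (\<lambda>P Q. \<Union>x\<in>P. \<Union>y\<in>Q. germ (\<lambda>N. x N \<oplus>\<^bsub>Ugl N L\<^esub> y N)),
      smult = (\<lambda>c P. \<Union>x\<in>P. germ (\<lambda>N. c \<odot>\<^bsub>Ugl N L\<^esub> x N))\<rparr>"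

definition A_inf :: "nat \<Rightarrow> (complex, (nat \<Rightarrow> ugl_elt) set) module"
  where "A_inf L = (germ_alg L)\<lparr>carrier := (\<Union>d. germ ` A_fin d L)\<rparr>"


section \<open>The generating series and the elements \<open>t\<^sub>i\<^sub>j(w; N; s)\<close>\<close>

text \<open>
  Formal series in the free noncommuting variables \<open>u\<^sub>1\<^sup>-\<^sup>1, \<dots>, u\<^sub>L\<^sup>-\<^sup>1\<close>, which commute with the
  coefficients, the latter being \<open>N \<times> N\<close> matrices over \<open>R\<close>: \<open>f w i j\<close> is the coefficient of the
  word \<open>w\<close> (possibly empty) in the entry \<open>(i, j)\<close>.
\<close>

definition mat_series :: "('u, 'm) ring_scheme \<Rightarrow> nat \<Rightarrow> nat \<Rightarrow> (nat list \<Rightarrow> nat \<Rightarrow> nat \<Rightarrow> 'u) ring"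
  where "mat_series R N L = (let mk = (\<lambda>f. \<lambda>w\<in>lists {1..L}. \<lambda>i\<in>{1..N}. \<lambda>j\<in>{1..N}. f w i j) in
    \<lparr>carrier = lists {1..L} \<rightarrow>\<^sub>E ({1..N} \<rightarrow>\<^sub>E ({1..N} \<rightarrow>\<^sub>E carrier R)),
      monoid.mult = (\<lambda>f g. mk (\<lambda>w i j.
        \<Oplus>\<^bsub>R\<^esub>n\<in>{0..length w}. \<Oplus>\<^bsub>R\<^esub>a\<in>{1..N}. f (take n w) i a \<otimes>\<^bsub>R\<^esub> g (drop n w) a j)),
      one = mk (\<lambda>w i j. if w = [] \<and> i = j then \<one>\<^bsub>R\<^esub> else \<zero>\<^bsub>R\<^esub>),
      ring.zero = mk (\<lambda>w i j. \<zero>\<^bsub>R\<^esub>),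
      add = (\<lambda>f g. mk (\<lambda>w i j. f w i j \<oplus>\<^bsub>R\<^esub> g w i j))\<rparr>)"

text \<open>The coefficient of the word \<open>w\<close> in \<open>(u\<^sub>\<alpha> + c)\<^sup>-\<^sup>1 = (\<Sum>k. (-c)\<^sup>k u\<^sub>\<alpha>\<^sup>-\<^sup>k\<^sup>-\<^sup>1)\<close>.\<close>

definition inv_shift_coeff :: "complex \<Rightarrow> nat \<Rightarrow> nat list \<Rightarrow> complex"
  where "inv_shift_coeff c \<alpha> w =
    (if w \<noteq> [] \<and> w = replicate (length w) \<alpha> then (- c) ^ (length w - 1) else 0)"

text \<open>The series \<open>(\<Sum>\<alpha>. E(N)\<^sub>\<alpha> (u\<^sub>\<alpha> + N + s)\<^sup>-\<^sup>1)\<close>.\<close>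

definition E_series :: "nat \<Rightarrow> nat \<Rightarrow> complex \<Rightarrow> nat list \<Rightarrow> nat \<Rightarrow> nat \<Rightarrow> ugl_elt"
  where "E_series N L s = (\<lambda>w\<in>lists {1..L}. \<lambda>i\<in>{1..N}. \<lambda>j\<in>{1..N}.
    \<Oplus>\<^bsub>Ugl N L\<^esub>\<alpha>\<in>{1..L}. inv_shift_coeff (of_nat N + s) \<alpha> w \<odot>\<^bsub>Ugl N L\<^esub> Egl N L i j \<alpha>)"

type_synonym t_index = "nat \<times> nat \<times> nat list"

fun t_fin :: "nat \<Rightarrow> nat \<Rightarrow> complex \<Rightarrow> t_index \<Rightarrow> ugl_elt" where
  "t_fin N L s (i, j, w) = (let M = mat_series (Ugl N L) N L in
    (inv\<^bsub>M\<^esub> (\<one>\<^bsub>M\<^esub> \<ominus>\<^bsub>M\<^esub> E_series N L s)) w i j)"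

text \<open>Finitely many terms of the sequence, those with \<open>N < max i j\<close>, do not affect the germ.\<close>

definition t_inf :: "nat \<Rightarrow> complex \<Rightarrow> t_index \<Rightarrow> (nat \<Rightarrow> ugl_elt) set"
  where "t_inf L s p = germ (\<lambda>N. t_fin N L s p)"


section \<open>Normal monomials\<close>

definition words :: "nat \<Rightarrow> nat list set"
  where "words L = lists {1..L} - {[]}"

definition t_indices :: "nat \<Rightarrow> t_index set"
  where "t_indices L = {1..} \<times> {1..} \<times> words L"

text \<open>
  Monomials are formal products, given by the list of the triples of their factors; the value
  of a monomial is a function of \<open>s\<close>.
\<close>

type_synonym t_monomial = "t_index list"

definition normal_monomial :: "nat \<Rightarrow> t_index rel \<Rightarrow> t_monomial \<Rightarrow> bool"
  where "normal_monomial L r ps \<longleftrightarrow> set ps \<subseteq> t_indices L \<and> sorted_wrt (\<lambda>p q. (p, q) \<in> r) ps"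

definition normal_pair :: "t_index rel \<Rightarrow> t_index \<Rightarrow> t_index \<Rightarrow> t_monomial"
  where "normal_pair r p q = (if (p, q) \<in> r then [p, q] else [q, p])"

definition monomial_degree :: "t_monomial \<Rightarrow> nat"
  where "monomial_degree ps = (\<Sum>(i, j, w)\<leftarrow>ps. length w)"

definition monomial_val :: "nat \<Rightarrow> complex \<Rightarrow> t_monomial \<Rightarrow> (nat \<Rightarrow> ugl_elt) set"
  where "monomial_val L s ps = foldr (\<otimes>\<^bsub>A_inf L\<^esub>) (map (t_inf L s) ps) \<one>\<^bsub>A_inf L\<^esub>"

definition admissible_monomial ::
    "nat \<Rightarrow> t_index rel \<Rightarrow> nat \<Rightarrow> nat \<Rightarrow> nat \<Rightarrow> nat \<Rightarrow> t_monomial \<Rightarrow> bool"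
  where "admissible_monomial L r i j k l ps \<longleftrightarrow>
    (\<exists>v\<in>words L. ps = [(i, j, v)] \<or> ps = [(k, l, v)] \<or> ps = [(i, l, v)] \<or> ps = [(k, j, v)]) \<or>
    (\<exists>v\<in>words L. \<exists>v'\<in>words L.
      ps = normal_pair r (i, j, v) (k, l, v') \<or> ps = normal_pair r (i, l, v) (k, j, v'))"

definition int_lincomb :: "(complex, 'b, 'm) module_scheme \<Rightarrow> (int \<times> 'b) list \<Rightarrow> 'b"
  where "int_lincomb A ts = foldr (\<oplus>\<^bsub>A\<^esub>) (map (\<lambda>(c, x). of_int c \<odot>\<^bsub>A\<^esub> x) ts) \<zero>\<^bsub>A\<^esub>"

definition alg_commutator :: "(complex, 'b, 'm) module_scheme \<Rightarrow> 'b \<Rightarrow> 'b \<Rightarrow> 'b"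
  where "alg_commutator A x y = (x \<otimes>\<^bsub>A\<^esub> y) \<oplus>\<^bsub>A\<^esub> ((-1) \<odot>\<^bsub>A\<^esub> (y \<otimes>\<^bsub>A\<^esub> x))"

end

theory Submission
  imports Defs "HOL-Library.Function_Algebras" "HOL-Computational_Algebra.Polynomial"
begin

text \<open>
  Addition, multiplication and scaling of germs are pointwise, so the relation has to be proved in
  \<open>U(gl(N)\<^sup>\<oplus>\<^sup>L)\<close> for \<open>N \<ge> max {i, j, k, l}\<close>, with one formal right-hand side for all \<open>N\<close> and \<open>s\<close>.
  Put \<open>c = N + s\<close>.  Expanding the inverse matrix series gives
  \<open>t(w; N; s) = E\<^sub>w\<^sub>1 (E\<^sub>w\<^sub>2 - c [w\<^sub>1 = w\<^sub>2]) (E\<^sub>w\<^sub>3 - c [w\<^sub>2 = w\<^sub>3]) \<dots>\<close> as a product of matrices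
  (\<open>t_fin_eq\<close>); the constant \<open>tw\<close> is this product for an arbitrary family of ring elements.

  For \<open>c = 0\<close> the product of two such matrices is the matrix of the concatenated word, and
  \<open>[t\<^sub>i\<^sub>j(w), E\<^sub>k\<^sub>l]\<close> is a sum of terms \<open>\<plusminus>t\<^sub>i\<^sub>l(p) t\<^sub>k\<^sub>j(q)\<close> over cuts \<open>w = pq\<close> (\<open>comm_tw_gen\<close>).  Peeling off the
  last letter of \<open>w'\<close> then expresses \<open>[t\<^sub>i\<^sub>j(w), t\<^sub>k\<^sub>l(w')]\<close> through products of lower total degree
  (\<open>expressible_commutator\<close>).  The number of matrix indices never enters, so the resulting formula
  is the same for every \<open>N\<close>.

  For general \<open>c\<close> the same induction leaves behind terms multiplied by \<open>c\<close>, whose cancellation is not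
  visible.  Instead, the formula for \<open>c = 0\<close> is transported.  Any representation of \<open>gl(N)\<^sup>\<oplus>\<^sup>L\<close>
  gives rise to an induced representation of \<open>gl(N + m)\<^sup>\<oplus>\<^sup>L\<close>, realised by Weyl algebra operators
  (\<open>gl_ext\<close>), whose vacuum vectors are killed by all \<open>E\<^sub>i\<^sub>a\<close> and \<open>E\<^sub>b\<^sub>a\<close> with \<open>a, b > N\<close>.  Each extra index
  \<open>a\<close> contributes \<open>E\<^sub>i\<^sub>a E\<^sub>a\<^sub>j = E\<^sub>i\<^sub>j - [i = j] E\<^sub>a\<^sub>a + E\<^sub>a\<^sub>j E\<^sub>i\<^sub>a\<close> to the product of two matrices of the
  same copy, and only \<open>E\<^sub>i\<^sub>j\<close> survives on the vacuum; hence there the unshifted product for \<open>gl(N + m)\<close> acts as the product for \<open>gl(N)\<close> with \<open>c = -m\<close> (\<open>tw_vac\<close>).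
  Taking the left regular representation of \<open>U(gl(N)\<^sup>\<oplus>\<^sup>L)\<close>, the formula holds there for
  \<open>c = 0, -1, -2, \<dots>\<close>; both sides are polynomials in \<open>c\<close>, so it holds for all \<open>c\<close>
  (\<open>commutator_mod_ideal\<close>).

  Finally, exchanging two factors that stand in the wrong order costs a commutator of lower degree,
  which lies in the same family of terms, so induction on the degree makes all monomials normal
  (\<open>normalizable_commutator\<close>).
\<close>

section \<open>Commutators of matrix products of generators\<close>


abbreviation comm :: "'a::ring_1 \<Rightarrow> 'a \<Rightarrow> 'a"
  where "comm x y \<equiv> x * y - y * x"

definition gl_rel :: "nat set \<Rightarrow> (nat \<Rightarrow> nat \<Rightarrow> nat \<Rightarrow> 'a::ring_1) \<Rightarrow> bool"
  where "gl_rel J E \<longleftrightarrow> finite J \<and> (\<forall>i\<in>J. \<forall>j\<in>J. \<forall>k\<in>J. \<forall>l\<in>J. \<forall>\<alpha> \<beta>.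
    comm (E i j \<alpha>) (E k l \<beta>) =
      (if \<alpha> = \<beta> then (if j = k then E i l \<alpha> else 0) - (if l = i then E k j \<alpha> else 0) else 0))"

fun tw :: "nat set \<Rightarrow> (nat \<Rightarrow> nat \<Rightarrow> nat \<Rightarrow> 'a::ring_1) \<Rightarrow> 'a \<Rightarrow> nat list \<Rightarrow> nat \<Rightarrow> nat \<Rightarrow> 'a"
  where
    "tw J E c [] i j = (if i = j then 1 else 0)"
  | "tw J E c (\<alpha> # w) i j = (\<Sum>a\<in>J. E i a \<alpha> * tw J E c w a j)
      - (if w \<noteq> [] \<and> hd w = \<alpha> then c * tw J E c w i j else 0)"

declare tw.simps(2) [simp del]

lemma tw_Cons_0 [simp]: "tw J E 0 (\<alpha> # w) i j = (\<Sum>a\<in>J. E i a \<alpha> * tw J E 0 w a j)"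
  by (simp add: tw.simps(2))

lemma gl_relD:
  assumes "gl_rel J E" "i \<in> J" "j \<in> J" "k \<in> J" "l \<in> J"
  shows "comm (E i j \<alpha>) (E k l \<beta>) =
      (if \<alpha> = \<beta> then (if j = k then E i l \<alpha> else 0) - (if l = i then E k j \<alpha> else 0) else 0)"
  using assms unfolding gl_rel_def by blast

lemma sum_delta_mult:
  fixes f :: "nat \<Rightarrow> 'a::ring_1"
  assumes "finite J" "i \<in> J"
  shows "(\<Sum>a\<in>J. (if i = a then 1 else 0) * f a) = f i"
    and "(\<Sum>a\<in>J. f a * (if a = i then 1 else 0)) = f i"
proof -
  have "(\<Sum>a\<in>J. (if i = a then 1 else 0) * f a) = (\<Sum>a\<in>J. if a = i then f a else 0)"
    by (rule sum.cong) auto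
  then show "(\<Sum>a\<in>J. (if i = a then 1 else 0) * f a) = f i" using assms by simp
  have "(\<Sum>a\<in>J. f a * (if a = i then 1 else 0)) = (\<Sum>a\<in>J. if a = i then f a else 0)"
    by (rule sum.cong) auto
  then show "(\<Sum>a\<in>J. f a * (if a = i then 1 else 0)) = f i" using assms by simp
qed

lemma tw_append:
  assumes "finite J" "i \<in> J"
  shows "tw J E 0 (u @ v) i j = (\<Sum>a\<in>J. tw J E 0 u i a * tw J E 0 v a j)"
  using assms(2)
proof (induction u arbitrary: i)
  case Nil
  then show ?case using assms sum_delta_mult(1)[of J i "\<lambda>a. tw J E 0 v a j"] by simp
next
  case (Cons \<alpha> u)
  have "(\<Sum>a\<in>J. tw J E 0 (\<alpha> # u) i a * tw J E 0 v a j)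
      = (\<Sum>a\<in>J. \<Sum>b\<in>J. E i b \<alpha> * (tw J E 0 u b a * tw J E 0 v a j))"
    by (simp add: sum_distrib_right mult.assoc)
  also have "\<dots> = (\<Sum>b\<in>J. \<Sum>a\<in>J. E i b \<alpha> * (tw J E 0 u b a * tw J E 0 v a j))"
    by (rule sum.swap)
  also have "\<dots> = tw J E 0 ((\<alpha> # u) @ v) i j"
    by (simp add: sum_distrib_left[symmetric] Cons.IH)
  finally show ?case by simp
qed

lemma tw_single:
  assumes "finite J" "j \<in> J"
  shows "tw J E c [\<beta>] i j = E i j \<beta>"
  using assms sum_delta_mult(2)[of J j "\<lambda>a. E i a \<beta>"] by (simp add: tw.simps(2))

lemma tw_snoc:
  assumes "finite J" "i \<in> J" "j \<in> J"
  shows "tw J E 0 (u @ [\<beta>]) i j = (\<Sum>a\<in>J. tw J E 0 u i a * E a j \<beta>)"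
  using assms by (simp add: tw_append tw_single del: tw.simps tw_Cons_0)

lemma comm_mult_right: "comm x (y * z) = comm x y * z + y * comm x (z::'a::ring_1)"
  by (simp add: algebra_simps)

lemma comm_mult_left: "comm (x * y) z = x * comm y z + comm x z * (y::'a::ring_1)"
  by (simp add: algebra_simps)

lemma comm_sum_right: "comm x (sum f A) = (\<Sum>a\<in>A. comm (x::'a::ring_1) (f a))"
  by (simp add: sum_distrib_left sum_distrib_right sum_subtractf)

lemma comm_sum_left: "comm (sum f A) (x::'a::ring_1) = (\<Sum>a\<in>A. comm (f a) x)"
  by (simp add: sum_distrib_left sum_distrib_right sum_subtractf)

text \<open>
  Moving \<open>E\<^sub>k\<^sub>l\<close> of the copy \<open>\<beta>\<close> through the product meets one nonzero bracket for each letter \<open>\<beta>\<close> of \<open>w\<close>; it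
  breaks the chain of matrix indices just after that letter (first term) or just before it
  (second term).
\<close>

lemma comm_tw_gen:
  assumes E: "gl_rel J E" and "i \<in> J" "j \<in> J" "k \<in> J" "l \<in> J"
  shows "comm (tw J E 0 w i j) (E k l \<beta>) = (\<Sum>r\<in>{r. r < length w \<and> w ! r = \<beta>}.
      tw J E 0 (take (Suc r) w) i l * tw J E 0 (drop (Suc r) w) k j
    - tw J E 0 (take r w) i l * tw J E 0 (drop r w) k j)"
  using assms(2)
proof (induction w arbitrary: i)
  case Nil
  then show ?case by simp
next
  case (Cons \<alpha> w)
  let ?T = "tw J E 0"
  let ?t = "\<lambda>w r i. ?T (take (Suc r) w) i l * ?T (drop (Suc r) w) k j - ?T (take r w) i l * ?T (drop r w) k j"
  have fin: "finite J" using E by (simp add: gl_rel_def)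
  define S where "S = {r. r < length w \<and> w ! r = \<beta>}"
  have S: "{r. r < length (\<alpha> # w) \<and> (\<alpha> # w) ! r = \<beta>} = (if \<alpha> = \<beta> then {0} else {}) \<union> Suc ` S"
  proof -
    have "r < length (\<alpha> # w) \<and> (\<alpha> # w) ! r = \<beta> \<longleftrightarrow> r \<in> (if \<alpha> = \<beta> then {0} else {}) \<union> Suc ` S" for r
      by (cases r) (auto simp: S_def)
    then show ?thesis by blast
  qed
  have [simp]: "finite S" by (simp add: S_def)
  have "(\<Sum>r\<in>{r. r < length (\<alpha> # w) \<and> (\<alpha> # w) ! r = \<beta>}. ?t (\<alpha> # w) r i)
      = (if \<alpha> = \<beta> then ?t (\<alpha> # w) 0 i else 0) + (\<Sum>r\<in>S. ?t (\<alpha> # w) (Suc r) i)"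
    unfolding S by (subst sum.union_disjoint) (auto simp: sum.reindex)
  also have "(\<Sum>r\<in>S. ?t (\<alpha> # w) (Suc r) i) = (\<Sum>r\<in>S. \<Sum>a\<in>J. E i a \<alpha> * ?t w r a)"
    by (simp add: sum_distrib_right sum_subtractf right_diff_distrib mult.assoc)
  also have "\<dots> = (\<Sum>a\<in>J. \<Sum>r\<in>S. E i a \<alpha> * ?t w r a)" by (rule sum.swap)
  also have "\<dots> = (\<Sum>a\<in>J. E i a \<alpha> * comm (?T w a j) (E k l \<beta>))"
    unfolding S_def by (simp add: Cons.IH sum_distrib_left)
  also have "(if \<alpha> = \<beta> then ?t (\<alpha> # w) 0 i else 0) = (\<Sum>a\<in>J. comm (E i a \<alpha>) (E k l \<beta>) * ?T w a j)"
  proof (cases "\<alpha> = \<beta>")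
    case True
    have "(\<Sum>a\<in>J. comm (E i a \<alpha>) (E k l \<beta>) * ?T w a j)
       = (\<Sum>a\<in>J. (if a = k then E i l \<alpha> * ?T w a j else 0) - (if l = i then E k a \<alpha> * ?T w a j else 0))"
      using True by (intro sum.cong) (auto simp: gl_relD[OF E] Cons.prems assms left_diff_distrib)
    also have "\<dots> = ?t (\<alpha> # w) 0 i"
      using assms fin sum_delta_mult(2)[of J l "\<lambda>a. E i a \<alpha>"] by (simp add: sum_subtractf)
    finally show ?thesis using True by simp
  next
    case False
    then have "comm (E i a \<alpha>) (E k l \<beta>) = 0" if "a \<in> J" for a
      using that by (simp only: gl_relD[OF E] Cons.prems assms if_False)
    then show ?thesis using False by simp
  qed
  finally show ?case
    by (simp add: comm_sum_left comm_mult_left sum.distrib)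
qed

text \<open>
  A formal right-hand side: \<open>(z, b, v, v')\<close> stands for \<open>z\<close> times a product of the entries of \<open>v\<close> and \<open>v'\<close>,
  where \<open>b\<close> tells whether the column indices \<open>j\<close> and \<open>l\<close> are exchanged.  It mentions neither matrix
  indices nor generators, which makes uniformity in \<open>N\<close> and \<open>s\<close> expressible.
\<close>

type_synonym bform = "(int \<times> bool \<times> nat list \<times> nat list) list"

fun term_val :: "(nat list \<Rightarrow> nat \<Rightarrow> nat \<Rightarrow> 'a::ring_1) \<Rightarrow> nat \<Rightarrow> nat \<Rightarrow> nat \<Rightarrow> nat \<Rightarrow>
    int \<times> bool \<times> nat list \<times> nat list \<Rightarrow> 'a"
  where "term_val T i j k l (z, b, v, v') =
    of_int z * (if b then T v k j * T v' i l else T v i j * T v' k l)"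

definition form_val :: "(nat list \<Rightarrow> nat \<Rightarrow> nat \<Rightarrow> 'a::ring_1) \<Rightarrow> nat \<Rightarrow> nat \<Rightarrow> nat \<Rightarrow> nat \<Rightarrow> bform \<Rightarrow> 'a"
  where "form_val T i j k l \<Phi> = sum_list (map (term_val T i j k l) \<Phi>)"

text \<open>
  One of the two words may be empty, giving a Kronecker delta times a single entry; both words
  empty would give a constant, for which no admissible monomial exists.
\<close>

definition form_ok :: "nat set \<Rightarrow> nat \<Rightarrow> bform \<Rightarrow> bool"
  where "form_ok A n \<Phi> \<longleftrightarrow> (\<forall>(z, b, v, v')\<in>set \<Phi>.
    v @ v' \<noteq> [] \<and> length v + length v' \<le> n \<and> set v \<union> set v' \<subseteq> A)"

text \<open>The quantifier order is the point: one formal expression serves all index sets and families.\<close>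

definition expressible :: "nat set \<Rightarrow> nat \<Rightarrow>
    (nat set \<Rightarrow> (nat \<Rightarrow> nat \<Rightarrow> nat \<Rightarrow> 'a::ring_1) \<Rightarrow> nat \<Rightarrow> nat \<Rightarrow> nat \<Rightarrow> nat \<Rightarrow> 'a) \<Rightarrow> bool"
  where "expressible A n F \<longleftrightarrow> (\<exists>\<Phi>. form_ok A n \<Phi> \<and> (\<forall>J E i j k l.
    gl_rel J E \<longrightarrow> i \<in> J \<longrightarrow> j \<in> J \<longrightarrow> k \<in> J \<longrightarrow> l \<in> J \<longrightarrow>
      F J E i j k l = form_val (tw J E 0) i j k l \<Phi>))"

lemma form_val_simps [simp]:
  "form_val T i j k l [] = 0"
  "form_val T i j k l (x # \<Phi>) = term_val T i j k l x + form_val T i j k l \<Phi>"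
  "form_val T i j k l (\<Phi> @ \<Psi>) = form_val T i j k l \<Phi> + form_val T i j k l \<Psi>"
  by (simp_all add: form_val_def)

lemma form_ok_simps [simp]:
  "form_ok A n []"
  "form_ok A n ((z, b, v, v') # \<Phi>) \<longleftrightarrow>
     (v @ v' \<noteq> [] \<and> length v + length v' \<le> n \<and> set v \<union> set v' \<subseteq> A) \<and> form_ok A n \<Phi>"
  "form_ok A n (\<Phi> @ \<Psi>) \<longleftrightarrow> form_ok A n \<Phi> \<and> form_ok A n \<Psi>"
  by (auto simp: form_ok_def ball_Un)

lemma expressible_cong:
  assumes "expressible A n G"
    and "\<And>J E i j k l. gl_rel J E \<Longrightarrow> i \<in> J \<Longrightarrow> j \<in> J \<Longrightarrow> k \<in> J \<Longrightarrow> l \<in> J \<Longrightarrow> F J E i j k l = G J E i j k l"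
  shows "expressible A n F"
  using assms unfolding expressible_def by metis

lemma expressible_mono: "expressible A n F \<Longrightarrow> n \<le> n' \<Longrightarrow> expressible A n' F"
  unfolding expressible_def form_ok_def by fastforce

lemma expressible_0: "expressible A n (\<lambda>J E i j k l. 0)"
  unfolding expressible_def by (rule exI[of _ "[]"]) simp

lemma expressible_add:
  assumes "expressible A n F" "expressible A n G"
  shows "expressible A n (\<lambda>J E i j k l. F J E i j k l + G J E i j k l)"
proof -
  obtain \<Phi> \<Psi> where "form_ok A n \<Phi>" "form_ok A n \<Psi>"
    and "\<forall>J E i j k l. gl_rel J E \<longrightarrow> i \<in> J \<longrightarrow> j \<in> J \<longrightarrow> k \<in> J \<longrightarrow> l \<in> J \<longrightarrow>
      F J E i j k l = form_val (tw J E 0) i j k l \<Phi>"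
    and "\<forall>J E i j k l. gl_rel J E \<longrightarrow> i \<in> J \<longrightarrow> j \<in> J \<longrightarrow> k \<in> J \<longrightarrow> l \<in> J \<longrightarrow>
      G J E i j k l = form_val (tw J E 0) i j k l \<Psi>"
    using assms unfolding expressible_def by metis
  then show ?thesis unfolding expressible_def by (intro exI[of _ "\<Phi> @ \<Psi>"]) simp
qed

lemma expressible_int_mult:
  assumes "expressible A n F"
  shows "expressible A n (\<lambda>J E i j k l. of_int z * F J E i j k l)"
proof -
  obtain \<Phi> where ok: "form_ok A n \<Phi>"
    and F: "\<forall>J E i j k l. gl_rel J E \<longrightarrow> i \<in> J \<longrightarrow> j \<in> J \<longrightarrow> k \<in> J \<longrightarrow> l \<in> J \<longrightarrow>
      F J E i j k l = form_val (tw J E 0) i j k l \<Phi>"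
    using assms unfolding expressible_def by metis
  let ?g = "map (\<lambda>(y, b, v, v'). (z * y, b, v, v'))"
  have "form_val T i j k l (?g \<Phi>) = of_int z * form_val T i j k l \<Phi>" for T :: "nat list \<Rightarrow> nat \<Rightarrow> nat \<Rightarrow> 'a" and i j k l
    by (induction \<Phi>) (auto simp: distrib_left mult.assoc)
  moreover have "form_ok A n (?g \<Phi>)" using ok by (auto simp: form_ok_def)
  ultimately show ?thesis unfolding expressible_def using F by (intro exI[of _ "?g \<Phi>"]) simp
qed

lemma expressible_diff:
  assumes "expressible A n F" "expressible A n G"
  shows "expressible A n (\<lambda>J E i j k l. F J E i j k l - G J E i j k l)"
  using expressible_add[OF assms(1) expressible_int_mult[OF assms(2), of "-1"]] by simp

lemma expressible_sum:
  assumes "finite S" "\<And>x. x \<in> S \<Longrightarrow> expressible A n (F x)"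
  shows "expressible A n (\<lambda>J E i j k l. \<Sum>x\<in>S. F x J E i j k l)"
  using assms
proof (induction S)
  case empty
  then show ?case by (simp add: expressible_0)
next
  case (insert x S)
  then show ?case using expressible_add[of A n "F x" "\<lambda>J E i j k l. \<Sum>x\<in>S. F x J E i j k l"] by simp
qed

lemma expressible_sum_list:
  assumes "\<And>x. x \<in> set xs \<Longrightarrow> expressible A n (F x)"
  shows "expressible A n (\<lambda>J E i j k l. \<Sum>x\<leftarrow>xs. F x J E i j k l)"
  using assms
proof (induction xs)
  case Nil
  then show ?case by (simp add: expressible_0)
next
  case (Cons x xs)
  then show ?case using expressible_add[of A n "F x" "\<lambda>J E i j k l. \<Sum>x\<leftarrow>xs. F x J E i j k l"] by simp
qed

text \<open>Exchanging \<open>i\<close> and \<open>k\<close> interchanges the two kinds of terms.\<close>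

lemma expressible_swap:
  assumes "expressible A n F"
  shows "expressible A n (\<lambda>J E i j k l. F J E k j i l)"
proof -
  obtain \<Phi> where ok: "form_ok A n \<Phi>"
    and F: "\<forall>J E i j k l. gl_rel J E \<longrightarrow> i \<in> J \<longrightarrow> j \<in> J \<longrightarrow> k \<in> J \<longrightarrow> l \<in> J \<longrightarrow>
      F J E i j k l = form_val (tw J E 0) i j k l \<Phi>"
    using assms unfolding expressible_def by metis
  let ?g = "map (\<lambda>(z, b, v, v'). (z, \<not> b, v, v'))"
  have "form_val T i j k l (?g \<Phi>) = form_val T k j i l \<Phi>" for T :: "nat list \<Rightarrow> nat \<Rightarrow> nat \<Rightarrow> 'a" and i j k l
    by (induction \<Phi>) auto
  moreover have "form_ok A n (?g \<Phi>)" using ok by (auto simp: form_ok_def)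
  ultimately show ?thesis unfolding expressible_def using F by (intro exI[of _ "?g \<Phi>"]) simp
qed

lemma expressible_prod:
  assumes "v @ v' \<noteq> []" "length v + length v' \<le> n" "set v \<union> set v' \<subseteq> A"
  shows "expressible A n (\<lambda>J E i j k l. tw J E 0 v i j * tw J E 0 v' k l)"
  unfolding expressible_def using assms
  by (intro exI[of _ "[(1, False, v, v')]"]) (auto simp del: tw.simps tw_Cons_0)

text \<open>
  Write \<open>w' = z\<beta>\<close>, so that \<open>t\<^sub>k\<^sub>l(w') = \<Sum>\<^sub>a t\<^sub>k\<^sub>a(z) E\<^sub>a\<^sub>l\<close>, and apply the Leibniz rule.  In \<open>[t\<^sub>i\<^sub>j(w), t\<^sub>k\<^sub>a(z)] E\<^sub>a\<^sub>l\<close>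
  the letter \<open>\<beta>\<close> is simply appended to the words produced by the induction hypothesis.  The other part
  is a sum of terms \<open>t\<^sub>k\<^sub>a(z) t\<^sub>i\<^sub>l(p) t\<^sub>a\<^sub>j(q)\<close>; once \<open>t\<^sub>i\<^sub>l(p)\<close> has been moved to the front, the sum over \<open>a\<close>
  glues \<open>z\<close> and \<open>q\<close> together, and the commutator spent on this move is again covered by induction.
  Each product that comes out with its factors in the opposite order is turned round by
  \<open>reversed\<close>, at the price of a commutator of smaller total length.
\<close>

lemma expressible_commutator:
  assumes "set w \<union> set w' \<subseteq> A"
  shows "expressible A (length w + length w' - 1)
    (\<lambda>J E i j k l. comm (tw J E 0 w i j) (tw J E (0::'a::ring_1) w' k l))"
  using assms
proof (induction "length w + length w'" arbitrary: w w' rule: less_induct)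
  case less
  (* A product in the order (k, l), (i, j) differs from an allowed one by a shorter commutator. *)
  have reversed: "expressible A n (\<lambda>J E i j k l. tw J E 0 v k l * tw J E (0::'a) v' i j)"
    if "v @ v' \<noteq> []" "length v + length v' \<le> n" "set v \<union> set v' \<subseteq> A"
      "length v + length v' < length w + length w'" for v v' n
  proof -
    have "expressible A n (\<lambda>J E i j k l. comm (tw J E 0 v' i j) (tw J E (0::'a) v k l))"
      by (rule expressible_mono[OF less.hyps]) (use that in auto)
    moreover have "expressible A n (\<lambda>J E i j k l. tw J E 0 v' i j * tw J E (0::'a) v k l)"
      by (rule expressible_prod) (use that in auto)
    ultimately show ?thesis
      using expressible_diff[of A n "\<lambda>J E i j k l. tw J E 0 v' i j * tw J E (0::'a) v k l"
        "\<lambda>J E i j k l. comm (tw J E 0 v' i j) (tw J E (0::'a) v k l)"]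
      by (simp add: algebra_simps)
  qed
  show ?case
  proof (cases "w = [] \<or> w' = []")
    case True
    then show ?thesis
      by (intro expressible_cong[OF expressible_0]) (auto simp: if_distrib)
  next
    case False
    then obtain z \<beta> where w': "w' = z @ [\<beta>]" by (metis rev_exhaust)
    define n where "n = length w + length z"
    have n: "length w + length w' = Suc n" "length w + length w' - 1 = n"
      using w' by (auto simp: n_def)
    have sets: "set w \<subseteq> A" "set z \<subseteq> A" "\<beta> \<in> A" using less.prems w' by auto
    let ?C = "\<lambda>w z J E i j k l. comm (tw J E 0 w i j) (tw J E (0::'a) z k l)"
    (* The last letter of w' is appended to the words of the induction hypothesis. *)
    have first: "expressible A n (\<lambda>J E i j k l. \<Sum>a\<in>J. ?C w z J E i j k a * E a l \<beta>)"
    proof -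
      have "expressible A (length w + length z - 1) (?C w z)"
        by (rule less.hyps) (use sets w' in auto)
      then obtain \<Phi> where ok: "form_ok A (length w + length z - 1) \<Phi>"
        and \<Phi>: "\<And>J E i j k l. gl_rel J E \<Longrightarrow> i \<in> J \<Longrightarrow> j \<in> J \<Longrightarrow> k \<in> J \<Longrightarrow> l \<in> J \<Longrightarrow>
          ?C w z J E i j k l = form_val (tw J E 0) i j k l \<Phi>"
        unfolding expressible_def by metis
      let ?g = "map (\<lambda>(y, b, v, v'). (y, b, v, v' @ [\<beta>]))"
      have "(\<Sum>a\<in>J. form_val (tw J E 0) i j k a \<Phi> * E a l \<beta>) = form_val (tw J E 0) i j k l (?g \<Phi>)"
        if "gl_rel J E" "i \<in> J" "j \<in> J" "k \<in> J" "l \<in> J" for J i j k l and E :: "nat \<Rightarrow> nat \<Rightarrow> nat \<Rightarrow> 'a"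
      proof -
        have fin: "finite J" using that by (simp add: gl_rel_def)
        have "(\<Sum>a\<in>J. term_val (tw J E 0) i j k a (y, b, v, v') * E a l \<beta>)
           = term_val (tw J E 0) i j k l (y, b, v, v' @ [\<beta>])" for y b v v'
          using that fin by (simp add: tw_snoc sum_distrib_left mult.assoc del: tw.simps tw_Cons_0)
        then show ?thesis
          by (induction \<Phi>) (auto simp: distrib_right sum.distrib simp del: term_val.simps)
      qed
      moreover have "form_ok A n (?g \<Phi>)"
        using ok sets False by (cases w) (fastforce simp: form_ok_def n_def)+
      ultimately show ?thesis
        unfolding expressible_def using \<Phi> by (intro exI[of _ "?g \<Phi>"]) simp
    qed
    (* The terms that come from the bracket of t_ij(w) with the last letter of w'. *)
    have second: "expressible A n (\<lambda>J E i j k l. \<Sum>a\<in>J. tw J E 0 z k a * (tw J E 0 p i l * tw J E (0::'a) q a j))"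
      if pq: "p @ q = w" for p q
    proof -
      have len: "length p + length q = length w" "set p \<subseteq> A" "set q \<subseteq> A"
        using pq sets by (auto simp flip: pq)
      have "expressible A (length p + length z - 1) (?C p z)"
        by (rule less.hyps) (use sets w' len in auto)
      then obtain \<Phi> where ok: "form_ok A (length p + length z - 1) \<Phi>"
        and \<Phi>: "\<And>J E i j k l. gl_rel J E \<Longrightarrow> i \<in> J \<Longrightarrow> j \<in> J \<Longrightarrow> k \<in> J \<Longrightarrow> l \<in> J \<Longrightarrow>
          ?C p z J E i j k l = form_val (tw J E 0) i j k l \<Phi>"
        unfolding expressible_def by metis
      have "expressible A n (\<lambda>J E i j k l. tw J E 0 p i l * tw J E (0::'a) (z @ q) k j)"
        by (rule expressible_swap[of A n "\<lambda>J E i j k l. tw J E 0 p k l * tw J E (0::'a) (z @ q) i j"], rule reversed)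
          (use len sets False pq n n_def in auto)
      moreover
      let ?g = "\<lambda>(y, b, v, v') J E i j k l. of_int y *
          (if b then tw J E 0 v k l * tw J E 0 (v' @ q) i j else tw J E (0::'a) v i l * tw J E 0 (v' @ q) k j)"
      have "expressible A n (\<lambda>J E i j k l. \<Sum>x\<leftarrow>\<Phi>. ?g x J E i j k l)"
      proof (rule expressible_sum_list)
        fix x assume "x \<in> set \<Phi>"
        obtain y b v v' where x: "x = (y, b, v, v')" by (metis surj_pair)
        have v: "v @ v' \<noteq> []" "length v + length v' \<le> length p + length z - 1" "set v \<union> set v' \<subseteq> A"
          using ok \<open>x \<in> set \<Phi>\<close> x by (auto simp: form_ok_def)
        have r: "expressible A n (\<lambda>J E i j k l. tw J E 0 v k l * tw J E (0::'a) (v' @ q) i j)"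
          by (rule reversed) (use v len n n_def in auto)
        have "expressible A n (\<lambda>J E i j k l. if b then tw J E 0 v k l * tw J E 0 (v' @ q) i j
            else tw J E (0::'a) v i l * tw J E 0 (v' @ q) k j)"
          using r expressible_swap[OF r] by (cases b) simp_all
        then show "expressible A n (?g x)"
          unfolding x by (simp add: expressible_int_mult)
      qed
      ultimately have "expressible A n (\<lambda>J E i j k l. tw J E 0 p i l * tw J E (0::'a) (z @ q) k j
          - (\<Sum>x\<leftarrow>\<Phi>. ?g x J E i j k l))"
        by (rule expressible_diff)
      then show ?thesis
      proof (rule expressible_cong)
        fix J i j k l and E :: "nat \<Rightarrow> nat \<Rightarrow> nat \<Rightarrow> 'a"
        assume E: "gl_rel J E" and ix: "i \<in> J" "j \<in> J" "k \<in> J" "l \<in> J"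
        let ?T = "tw J E 0"
        have fin: "finite J" using E by (simp add: gl_rel_def)
        have g: "(\<Sum>a\<in>J. term_val ?T i l k a x * ?T q a j) = ?g x J E i j k l" for x
        proof -
          obtain y b v v' where "x = (y, b, v, v')" by (metis surj_pair)
          then show ?thesis using ix fin
            by (simp add: tw_append[OF fin] sum_distrib_left mult.assoc del: tw.simps tw_Cons_0)
        qed
        have "(\<Sum>a\<in>J. ?T z k a * (?T p i l * ?T q a j))
            = (\<Sum>a\<in>J. ?T p i l * (?T z k a * ?T q a j) - ?C p z J E i l k a * ?T q a j)"
          by (intro sum.cong) (simp_all add: algebra_simps)
        also have "\<dots> = ?T p i l * ?T (z @ q) k j - (\<Sum>a\<in>J. form_val ?T i l k a \<Phi> * ?T q a j)"
          using ix by (simp add: sum_subtractf \<Phi>[OF E] tw_append[OF fin] sum_distrib_left)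
        also have "(\<Sum>a\<in>J. form_val ?T i l k a \<Phi> * ?T q a j) = (\<Sum>x\<leftarrow>\<Phi>. ?g x J E i j k l)"
          by (induction \<Phi>) (simp_all add: distrib_right sum.distrib g del: term_val.simps)
        finally show "(\<Sum>a\<in>J. ?T z k a * (?T p i l * ?T q a j))
            = ?T p i l * ?T (z @ q) k j - (\<Sum>x\<leftarrow>\<Phi>. ?g x J E i j k l)" .
      qed
    qed
    let ?S = "{r. r < length w \<and> w ! r = \<beta>}"
    let ?D = "\<lambda>p q J E i j k l. \<Sum>a\<in>J. tw J E 0 z k a * (tw J E 0 p i l * tw J E (0::'a) q a j)"
    have "expressible A n (\<lambda>J E i j k l. (\<Sum>a\<in>J. ?C w z J E i j k a * E a l \<beta>) +
        (\<Sum>r\<in>?S. ?D (take (Suc r) w) (drop (Suc r) w) J E i j k l - ?D (take r w) (drop r w) J E i j k l))"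
      by (intro expressible_add first expressible_sum expressible_diff second) auto
    then show ?thesis unfolding n(2)
    proof (rule expressible_cong)
      fix J i j k l and E :: "nat \<Rightarrow> nat \<Rightarrow> nat \<Rightarrow> 'a"
      assume E: "gl_rel J E" and ix: "i \<in> J" "j \<in> J" "k \<in> J" "l \<in> J"
      let ?T = "tw J E 0"
      have fin: "finite J" using E by (simp add: gl_rel_def)
      have "comm (?T w i j) (?T w' k l)
          = (\<Sum>a\<in>J. ?C w z J E i j k a * E a l \<beta>) + (\<Sum>a\<in>J. ?T z k a * comm (?T w i j) (E a l \<beta>))"
        unfolding w' tw_snoc[OF fin ix(3,4)]
        by (simp only: comm_sum_right comm_mult_right sum.distrib)
      also have "(\<Sum>a\<in>J. ?T z k a * comm (?T w i j) (E a l \<beta>))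
         = (\<Sum>a\<in>J. \<Sum>r\<in>?S. ?T z k a * (?T (take (Suc r) w) i l * ?T (drop (Suc r) w) a j)
             - ?T z k a * (?T (take r w) i l * ?T (drop r w) a j))"
        by (intro sum.cong refl) (simp only: comm_tw_gen[OF E ix(1,2) _ ix(4)] sum_distrib_left right_diff_distrib)
      also have "\<dots> = (\<Sum>r\<in>?S. \<Sum>a\<in>J. ?T z k a * (?T (take (Suc r) w) i l * ?T (drop (Suc r) w) a j)
             - ?T z k a * (?T (take r w) i l * ?T (drop r w) a j))"
        by (rule sum.swap)
      finally show "?C w w' J E i j k l = (\<Sum>a\<in>J. ?C w z J E i j k a * E a l \<beta>) +
        (\<Sum>r\<in>?S. ?D (take (Suc r) w) (drop (Suc r) w) J E i j k l - ?D (take r w) (drop r w) J E i j k l)"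
        by (simp only: sum_subtractf)
    qed
  qed
qed


section \<open>Adjoining indices to a representation of gl(N)\<close>

text \<open>
  Creation operators \<open>y a i \<alpha>\<close> and annihilation operators \<open>d a i \<alpha>\<close>, for new indices \<open>a\<close> and old indices
  \<open>i\<close>, that commute with a given action \<open>X\<close> of the old generators.
\<close>

locale weyl_extension =
  fixes N m :: nat and X y d :: "nat \<Rightarrow> nat \<Rightarrow> nat \<Rightarrow> 'a::ring_1"
  assumes gl_X: "gl_rel {1..N} X"
    and d_y: "comm (d a i \<alpha>) (y b j \<beta>) = (if a = b \<and> i = j \<and> \<alpha> = \<beta> then 1 else 0)"
    and y_y: "comm (y a i \<alpha>) (y b j \<beta>) = 0"
    and d_d: "comm (d a i \<alpha>) (d b j \<beta>) = 0"
    and X_y: "comm (X i j \<alpha>) (y b k \<beta>) = 0"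
    and X_d: "comm (X i j \<alpha>) (d b k \<beta>) = 0"
begin

abbreviation M :: "nat set"
  where "M \<equiv> {N<..N + m}"

text \<open>
  The module induced from the parabolic subalgebra spanned by the \<open>E\<^sub>i\<^sub>j\<close>, \<open>E\<^sub>a\<^sub>b\<close> and \<open>E\<^sub>i\<^sub>a\<close>, with the
  last two kinds acting by zero on the inducing module, consists of polynomials in the commuting variables \<open>E\<^sub>a\<^sub>i\<close>, which therefore act as \<open>y\<close>.  The action of the other
  generators is forced by their brackets with these variables: \<open>G\<close> for a pair of old indices, \<open>D\<close> for a
  pair of new ones, and \<open>Z\<close> for an old row and a new column.
\<close>

definition G :: "nat \<Rightarrow> nat \<Rightarrow> nat \<Rightarrow> 'a"
  where "G i j \<alpha> = X i j \<alpha> - (\<Sum>a\<in>M. y a j \<alpha> * d a i \<alpha>)"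

definition D :: "nat \<Rightarrow> nat \<Rightarrow> nat \<Rightarrow> 'a"
  where "D a b \<alpha> = (\<Sum>k\<in>{1..N}. y a k \<alpha> * d b k \<alpha>)"

definition Z :: "nat \<Rightarrow> nat \<Rightarrow> nat \<Rightarrow> 'a"
  where "Z i a \<alpha> = (\<Sum>k\<in>{1..N}. G i k \<alpha> * d a k \<alpha>)"

definition ext :: "nat \<Rightarrow> nat \<Rightarrow> nat \<Rightarrow> 'a"
  where "ext i j \<alpha> =
    (if i \<le> N then if j \<le> N then G i j \<alpha> else Z i j \<alpha>
     else if j \<le> N then y i j \<alpha> else D i j \<alpha>)"

lemma comm_swap: "comm u v = - comm v (u::'a)"
  by simp

lemma comm_diff_left: "comm (u - v) z = comm u z - comm v (z::'a)"
  by (simp add: algebra_simps)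

lemma comm_diff_right: "comm z (u - v) = comm z u - comm z (v::'a)"
  by (simp add: algebra_simps)

lemma G_y:
  assumes "a \<in> M"
  shows "comm (G i j \<alpha>) (y a k \<beta>) = (if \<alpha> = \<beta> \<and> i = k then - y a j \<alpha> else 0)"
proof -
  have "comm (G i j \<alpha>) (y a k \<beta>) = - (\<Sum>b\<in>M. if b = a then (if \<alpha> = \<beta> \<and> i = k then y a j \<alpha> else 0) else 0)"
    unfolding G_def comm_diff_left comm_sum_left comm_mult_left X_y d_y y_y
    by (simp add: if_distrib cong: if_cong) (intro sum.cong; auto)
  then show ?thesis using assms by simp
qed

lemma G_d:
  assumes "a \<in> M"
  shows "comm (G i j \<alpha>) (d a k \<beta>) = (if \<alpha> = \<beta> \<and> j = k then d a i \<alpha> else 0)"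
proof -
  have yd: "comm (y b j \<alpha>) (d a k \<beta>) = (if a = b \<and> j = k \<and> \<alpha> = \<beta> then - 1 else 0)" for b
    by (subst comm_swap, subst d_y) auto
  have "comm (G i j \<alpha>) (d a k \<beta>) = (\<Sum>b\<in>M. if b = a then (if \<alpha> = \<beta> \<and> j = k then d a i \<alpha> else 0) else 0)"
    unfolding G_def comm_diff_left comm_sum_left comm_mult_left X_d yd d_d
    by (simp add: if_distrib sum_negf[symmetric] cong: if_cong) (intro sum.cong; auto)
  then show ?thesis using assms by simp
qed

lemma G_G:
  assumes "i \<in> {1..N}" "j \<in> {1..N}" "k \<in> {1..N}" "l \<in> {1..N}"
  shows "comm (G i j \<alpha>) (G k l \<beta>) =
    (if \<alpha> = \<beta> then (if j = k then G i l \<alpha> else 0) - (if l = i then G k j \<alpha> else 0) else 0)"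
proof -
  have Xyd: "comm (y b j \<alpha> * d b i \<alpha>) (X k l \<beta>) = 0" for b
    unfolding comm_mult_left using X_y[of k l \<beta> b j \<alpha>] X_d[of k l \<beta> b i \<alpha>] by simp
  have GX: "comm (G i j \<alpha>) (X k l \<beta>) = comm (X i j \<alpha>) (X k l \<beta>)"
    by (simp only: G_def comm_diff_left comm_sum_left Xyd sum.neutral_const diff_zero)
  have "comm (G i j \<alpha>) (G k l \<beta>) = comm (X i j \<alpha>) (X k l \<beta>)
      - (\<Sum>a\<in>M. y a l \<beta> * comm (G i j \<alpha>) (d a k \<beta>)) - (\<Sum>a\<in>M. comm (G i j \<alpha>) (y a l \<beta>) * d a k \<beta>)"
    unfolding G_def[of k l \<beta>] comm_diff_right GX comm_sum_right comm_mult_right sum.distrib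
    by simp
  also have "(\<Sum>a\<in>M. y a l \<beta> * comm (G i j \<alpha>) (d a k \<beta>))
      = (if \<alpha> = \<beta> \<and> j = k then \<Sum>a\<in>M. y a l \<alpha> * d a i \<alpha> else 0)"
    by (simp only: G_d cong: sum.cong) auto
  also have "(\<Sum>a\<in>M. comm (G i j \<alpha>) (y a l \<beta>) * d a k \<beta>)
      = (if \<alpha> = \<beta> \<and> i = l then - (\<Sum>a\<in>M. y a j \<alpha> * d a k \<alpha>) else 0)"
    by (simp only: G_y cong: sum.cong) (auto simp: sum_negf)
  finally show ?thesis
    by (simp only: gl_relD[OF gl_X assms]) (auto simp: G_def)
qed

lemma D_y:
  assumes "k \<in> {1..N}"
  shows "comm (D a b \<alpha>) (y c k \<beta>) = (if \<alpha> = \<beta> \<and> b = c then y a k \<alpha> else 0)"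
proof -
  have "comm (D a b \<alpha>) (y c k \<beta>) = (\<Sum>l\<in>{1..N}. if l = k then (if \<alpha> = \<beta> \<and> b = c then y a k \<alpha> else 0) else 0)"
    unfolding D_def comm_sum_left comm_mult_left d_y y_y
    by (simp add: if_distrib cong: if_cong) (intro sum.cong; auto)
  then show ?thesis using assms by simp
qed

lemma D_d:
  assumes "k \<in> {1..N}"
  shows "comm (D a b \<alpha>) (d c k \<beta>) = (if \<alpha> = \<beta> \<and> a = c then - d b k \<alpha> else 0)"
proof -
  have yd: "comm (y a l \<alpha>) (d c k \<beta>) = (if c = a \<and> k = l \<and> \<alpha> = \<beta> then - 1 else 0)" for l
    by (subst comm_swap, subst d_y) auto
  have "comm (D a b \<alpha>) (d c k \<beta>) = (\<Sum>l\<in>{1..N}. if l = k then (if \<alpha> = \<beta> \<and> a = c then - d b k \<alpha> else 0) else 0)"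
    unfolding D_def comm_sum_left comm_mult_left yd d_d
    by (simp add: if_distrib cong: if_cong) (intro sum.cong; auto)
  then show ?thesis using assms by simp
qed

lemma D_D: "comm (D a b \<alpha>) (D c e \<beta>) =
    (if \<alpha> = \<beta> then (if b = c then D a e \<alpha> else 0) - (if e = a then D c b \<alpha> else 0) else 0)"
  unfolding D_def[of c e \<beta>] comm_sum_right comm_mult_right
  by (simp only: D_y D_d cong: sum.cong)
    (auto simp: D_def if_distrib sum.distrib sum_negf sum_subtractf cong: if_cong)

lemma G_D:
  assumes "i \<in> {1..N}" "j \<in> {1..N}" "a \<in> M" "b \<in> M"
  shows "comm (G i j \<alpha>) (D a b \<beta>) = 0"
proof -
  have "comm (G i j \<alpha>) (D a b \<beta>) =
      (\<Sum>k\<in>{1..N}. (if k = i then (if \<alpha> = \<beta> then - y a j \<alpha> * d b i \<alpha> else 0) else 0)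
        + (if k = j then (if \<alpha> = \<beta> then y a j \<alpha> * d b i \<alpha> else 0) else 0))"
    unfolding D_def comm_sum_right comm_mult_right G_y[OF assms(3)] G_d[OF assms(4)]
    by (intro sum.cong) auto
  then show ?thesis using assms by (simp add: sum.distrib)
qed

text \<open>
  The second part of the Leibniz rule, where \<open>G i j\<close> is commuted with \<open>d\<close>, cancels the unwanted term
  \<open>- [l = i] G k j\<close> of the bracket of \<open>G i j\<close> and \<open>G k l\<close>.
\<close>

lemma G_Z:
  assumes "i \<in> {1..N}" "j \<in> {1..N}" "k \<in> {1..N}" "a \<in> M"
  shows "comm (G i j \<alpha>) (Z k a \<beta>) = (if \<alpha> = \<beta> \<and> j = k then Z i a \<alpha> else 0)"
proof -
  have "comm (G i j \<alpha>) (Z k a \<beta>) = (\<Sum>l\<in>{1..N}.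
      (if \<alpha> = \<beta> \<and> j = k then G i l \<alpha> * d a l \<alpha> else 0)
      + ((if l = j then (if \<alpha> = \<beta> then G k j \<alpha> * d a i \<alpha> else 0) else 0)
      - (if l = i then (if \<alpha> = \<beta> then G k j \<alpha> * d a i \<alpha> else 0) else 0)))"
    unfolding Z_def comm_sum_right comm_mult_right G_d[OF assms(4)]
    by (intro sum.cong refl) (auto simp: G_G[OF assms(1-3)] algebra_simps)
  then show ?thesis using assms
    by (cases "\<alpha> = \<beta> \<and> j = k") (auto simp: sum.distrib sum_subtractf Z_def)
qed

lemma D_Z:
  assumes "a \<in> M" "b \<in> M" "c \<in> M" "i \<in> {1..N}"
  shows "comm (D a b \<alpha>) (Z i c \<beta>) = (if \<alpha> = \<beta> \<and> a = c then - Z i b \<alpha> else 0)"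
proof -
  have DG: "comm (D a b \<alpha>) (G i k \<beta>) = 0" if "k \<in> {1..N}" for k
    using G_D[OF assms(4) that assms(1,2), of \<beta> \<alpha>] by simp
  have "comm (D a b \<alpha>) (Z i c \<beta>) = (\<Sum>k\<in>{1..N}. if \<alpha> = \<beta> \<and> a = c then - (G i k \<alpha> * d b k \<alpha>) else 0)"
    unfolding Z_def comm_sum_right comm_mult_right
    by (intro sum.cong refl) (simp only: D_d DG, auto)
  then show ?thesis
    by (cases "\<alpha> = \<beta> \<and> a = c") (auto simp: Z_def sum_negf)
qed

lemma Z_y:
  assumes "a \<in> M" "b \<in> M" "i \<in> {1..N}" "k \<in> {1..N}"
  shows "comm (Z i a \<alpha>) (y b k \<beta>) =
    (if \<alpha> = \<beta> then (if a = b then G i k \<alpha> else 0) - (if k = i then D b a \<alpha> else 0) else 0)"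
proof -
  have "comm (Z i a \<alpha>) (y b k \<beta>) = (\<Sum>l\<in>{1..N}.
     (if l = k then (if \<alpha> = \<beta> \<and> a = b then G i k \<alpha> else 0) else 0)
     - (if \<alpha> = \<beta> \<and> k = i then y b l \<alpha> * d a l \<alpha> else 0))"
    unfolding Z_def comm_sum_left comm_mult_left d_y G_y[OF assms(2)]
    by (intro sum.cong refl) auto
  then show ?thesis using assms by (auto simp: sum_subtractf D_def)
qed

lemma Z_d:
  assumes "a \<in> M" "b \<in> M" "i \<in> {1..N}" "k \<in> {1..N}"
  shows "comm (Z i a \<alpha>) (d b k \<beta>) = (if \<alpha> = \<beta> then d b i \<alpha> * d a k \<alpha> else 0)"
proof -
  have "comm (Z i a \<alpha>) (d b k \<beta>) = (\<Sum>l\<in>{1..N}. if l = k then (if \<alpha> = \<beta> then d b i \<alpha> * d a k \<alpha> else 0) else 0)"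
    unfolding Z_def comm_sum_left comm_mult_left d_d G_d[OF assms(2)]
    by (intro sum.cong refl) auto
  then show ?thesis using assms by simp
qed

text \<open>
  Both parts of the Leibniz rule produce \<open>Z j a\<close> times \<open>d b i\<close>, with opposite signs, because
  annihilation operators commute.
\<close>

lemma Z_Z:
  assumes "a \<in> M" "b \<in> M" "i \<in> {1..N}" "j \<in> {1..N}"
  shows "comm (Z i a \<alpha>) (Z j b \<beta>) = 0"
proof -
  have ZG: "comm (Z i a \<alpha>) (G j k \<beta>) = (if \<alpha> = \<beta> \<and> k = i then - Z j a \<alpha> else 0)" if "k \<in> {1..N}" for k
    by (subst comm_swap, subst G_Z[OF assms(4) that assms(3,1)]) auto
  have dd: "d b i \<gamma> * d a k \<gamma> = d a k \<gamma> * d b i \<gamma>" for k \<gamma>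
    using d_d[of b i \<gamma> a k \<gamma>] by simp
  have "comm (Z i a \<alpha>) (Z j b \<beta>) = (\<Sum>k\<in>{1..N}. G j k \<beta> * comm (Z i a \<alpha>) (d b k \<beta>))
      + (\<Sum>k\<in>{1..N}. comm (Z i a \<alpha>) (G j k \<beta>) * d b k \<beta>)"
    unfolding Z_def[of j] comm_sum_right comm_mult_right sum.distrib by (rule add.commute)
  also have "(\<Sum>k\<in>{1..N}. G j k \<beta> * comm (Z i a \<alpha>) (d b k \<beta>)) =
     (\<Sum>k\<in>{1..N}. if \<alpha> = \<beta> then G j k \<alpha> * d a k \<alpha> * d b i \<alpha> else 0)"
    by (intro sum.cong refl) (simp only: Z_d[OF assms(1,2,3)], auto simp: mult.assoc dd)
  also have "\<dots> = (if \<alpha> = \<beta> then Z j a \<alpha> * d b i \<alpha> else 0)"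
    by (simp add: Z_def sum_distrib_right)
  also have "(\<Sum>k\<in>{1..N}. comm (Z i a \<alpha>) (G j k \<beta>) * d b k \<beta>) =
     (\<Sum>k\<in>{1..N}. if k = i then (if \<alpha> = \<beta> then - Z j a \<alpha> * d b i \<alpha> else 0) else 0)"
    by (intro sum.cong refl) (simp only: ZG, auto)
  also have "\<dots> = (if \<alpha> = \<beta> then - Z j a \<alpha> * d b i \<alpha> else 0)"
    using assms by simp
  finally show ?thesis by simp
qed

text \<open>
  The brackets are antisymmetric, so of the sixteen combinations of old and new indices only
  ten have to be inspected.
\<close>

lemma gl_ext: "gl_rel {1..N + m} ext"
proof -
  let ?R = "\<lambda>i j k l \<alpha> \<beta>. comm (ext i j \<alpha>) (ext k l \<beta>) =
    (if \<alpha> = \<beta> then (if j = k then ext i l \<alpha> else 0) - (if l = i then ext k j \<alpha> else 0) else 0)"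
  have sym: "?R i j k l \<alpha> \<beta>" if "?R k l i j \<beta> \<alpha>" for i j k l \<alpha> \<beta>
    by (subst comm_swap, subst that) auto
  let ?I = "{1..N}"
  have IM: "{1..N + m} = ?I \<union> M" by auto
  have ext: "ext i j = G i j" "ext i a = Z i a" "ext a i = y a i" "ext a b = D a b"
    if "i \<in> ?I" "j \<in> ?I" "a \<in> M" "b \<in> M" for i j a b
    using that by (auto simp: ext_def fun_eq_iff)
  have ne: "i \<noteq> a" "a \<noteq> i" if "i \<in> ?I" "a \<in> M" for i a using that by auto
  have GG: "?R i j k l \<alpha> \<beta>" if "i \<in> ?I" "j \<in> ?I" "k \<in> ?I" "l \<in> ?I" for i j k l \<alpha> \<beta>
    using that by (simp add: ext_def G_G)
  have GZ: "?R i j k a \<alpha> \<beta>" if "i \<in> ?I" "j \<in> ?I" "k \<in> ?I" "a \<in> M" for i j k a \<alpha> \<beta>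
    using that by (simp add: ext_def G_Z)
  have GY: "?R i j a k \<alpha> \<beta>" if "i \<in> ?I" "j \<in> ?I" "k \<in> ?I" "a \<in> M" for i j k a \<alpha> \<beta>
    using that by (simp add: ext_def G_y)
  have GD: "?R i j a b \<alpha> \<beta>" if "i \<in> ?I" "j \<in> ?I" "a \<in> M" "b \<in> M" for i j a b \<alpha> \<beta>
    using that by (simp add: ext_def G_D)
  have ZZ: "?R i a j b \<alpha> \<beta>" if "i \<in> ?I" "j \<in> ?I" "a \<in> M" "b \<in> M" for i j a b \<alpha> \<beta>
    using that by (simp add: ext_def Z_Z)
  have ZY: "?R i a b k \<alpha> \<beta>" if "i \<in> ?I" "k \<in> ?I" "a \<in> M" "b \<in> M" for i k a b \<alpha> \<beta>
    using that by (simp add: ext_def Z_y)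
  have YY: "?R a i b j \<alpha> \<beta>" if "i \<in> ?I" "j \<in> ?I" "a \<in> M" "b \<in> M" for i j a b \<alpha> \<beta>
    using that by (simp add: ext_def y_y)
  have DY: "?R a b c k \<alpha> \<beta>" if "k \<in> ?I" "a \<in> M" "b \<in> M" "c \<in> M" for k a b c \<alpha> \<beta>
    using that by (simp add: ext_def D_y)
  have DZ: "?R a b k c \<alpha> \<beta>" if "k \<in> ?I" "a \<in> M" "b \<in> M" "c \<in> M" for k a b c \<alpha> \<beta>
    using that by (simp add: ext_def D_Z)
  have DD: "?R a b c e \<alpha> \<beta>" if "a \<in> M" "b \<in> M" "c \<in> M" "e \<in> M" for a b c e \<alpha> \<beta>
    using that by (simp add: ext_def D_D)
  show ?thesis
    unfolding gl_rel_def IM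
  proof (intro conjI ballI allI)
    fix i j k l \<alpha> \<beta>
    assume "i \<in> ?I \<union> M" "j \<in> ?I \<union> M" "k \<in> ?I \<union> M" "l \<in> ?I \<union> M"
    then show "?R i j k l \<alpha> \<beta>"
      by (elim UnE) (blast intro: GG GZ GY GD ZZ ZY YY DY DZ DD
        sym[OF GZ] sym[OF GY] sym[OF GD] sym[OF ZY] sym[OF DY] sym[OF DZ])+
  qed simp
qed

end

section \<open>The vacuum module\<close>

text \<open>
  Additive endomorphisms are bundled into a type so that the identities above, which hold in any
  unital ring, apply to operators.
\<close>

typedef (overloaded) 'v endo = "{f :: 'v::ab_group_add \<Rightarrow> 'v. \<forall>x y. f (x + y) = f x + f y}"
  morphisms ap Endo
  by (rule exI[of _ "\<lambda>x. x"]) simp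

setup_lifting type_definition_endo

instantiation endo :: ("{ab_group_add, zero_neq_one}") ring_1
begin

lift_definition zero_endo :: "'a endo" is "\<lambda>_. 0" by simp
lift_definition one_endo :: "'a endo" is "\<lambda>x. x" by simp
lift_definition plus_endo :: "'a endo \<Rightarrow> 'a endo \<Rightarrow> 'a endo" is "\<lambda>f g x. f x + g x" by (simp add: ac_simps)
lift_definition uminus_endo :: "'a endo \<Rightarrow> 'a endo" is "\<lambda>f x. - f x" by simp
lift_definition minus_endo :: "'a endo \<Rightarrow> 'a endo \<Rightarrow> 'a endo" is "\<lambda>f g x. f x - g x" by simp
lift_definition times_endo :: "'a endo \<Rightarrow> 'a endo \<Rightarrow> 'a endo" is "\<lambda>f g x. f (g x)" by simp

instance
proof
  show "(0 :: 'a endo) \<noteq> 1"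
    by transfer (auto simp: fun_eq_iff intro!: exI[of _ 1])
qed (transfer; simp add: fun_eq_iff algebra_simps)+

end

lemma ap_simps [simp]:
  "ap 0 x = 0" "ap 1 x = x" "ap (f + g) x = ap f x + ap g x" "ap (- f) x = - ap f x"
  "ap (f - g) x = ap f x - ap g x" "ap (f * g) x = ap f (ap g x)"
  by (transfer, simp)+

lemma ap_add: "ap f (x + y) = ap f x + ap f y"
  by transfer simp

interpretation ap: additive "ap f" for f
  by standard (rule ap_add)

lemma ap_sum: "ap (sum f A) x = (\<Sum>a\<in>A. ap (f a) x)"
  by (induction A rule: infinite_finite_induct) auto

lemma ap_of_nat: "ap (of_nat n) u = of_nat n * (u :: 'a::ring_1)"
  by (induction n) (simp_all add: distrib_right)

lemma ap_of_int: "ap (of_int z) u = of_int z * (u :: 'a::ring_1)"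
  by (cases z rule: int_diff_cases) (simp add: ap_of_nat left_diff_distrib)

lemma endo_eqI: "(\<And>x. ap f x = ap g x) \<Longrightarrow> f = g"
  by (metis ap_inject ext)

declare One_nat_def [simp del]

text \<open>
  A function of exponent vectors is read as the coefficient family of a power series in commuting
  variables; \<open>y_op p\<close> multiplies by the variable \<open>p\<close> and \<open>d_op p\<close> differentiates by it.
\<close>

lift_definition y_op :: "'k \<Rightarrow> (('k \<Rightarrow> nat) \<Rightarrow> 'r::ring_1) endo"
  is "\<lambda>p f n. if n p = 0 then 0 else f (n(p := n p - 1))"
  by (auto simp: fun_eq_iff)

lift_definition d_op :: "'k \<Rightarrow> (('k \<Rightarrow> nat) \<Rightarrow> 'r::ring_1) endo"
  is "\<lambda>p f n. of_nat (Suc (n p)) * f (n(p := Suc (n p)))"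
  by (auto simp: fun_eq_iff algebra_simps)

lift_definition pointwise :: "'r::ring_1 endo \<Rightarrow> (('k \<Rightarrow> nat) \<Rightarrow> 'r) endo"
  is "\<lambda>g f n. g (f n)"
  by (auto simp: fun_eq_iff)

lemma of_nat_left_commute: "of_nat a * (of_nat b * u) = of_nat b * (of_nat a * (u::'a::ring_1))"
  by (metis mult.assoc mult_of_nat_commute)

lemma pointwise_simps:
  "pointwise (f * g) = pointwise f * pointwise g" "pointwise (f - g) = pointwise f - pointwise g"
  "pointwise 0 = 0" "pointwise (- f) = - pointwise f"
  by (rule endo_eqI, simp add: pointwise.rep_eq fun_eq_iff)+

lemma comm_d_y: "comm (d_op p) (y_op q) = (if p = q then 1 else 0)"
proof (rule endo_eqI, rule ext)
  fix f :: "('a \<Rightarrow> nat) \<Rightarrow> 'b" and n :: "'a \<Rightarrow> nat"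
  show "ap (comm (d_op p) (y_op q)) f n = ap (if p = q then 1 else 0) f n"
  proof (cases "p = q")
    case True
    then show ?thesis
      by (cases "n q") (auto simp: d_op.rep_eq y_op.rep_eq fun_upd_idem distrib_right)
  next
    case False
    then show ?thesis
      by (auto simp: d_op.rep_eq y_op.rep_eq fun_upd_twist)
  qed
qed

lemma comm_y_y: "comm (y_op p) (y_op q) = 0"
  by (rule endo_eqI) (auto simp: y_op.rep_eq fun_eq_iff fun_upd_twist)

lemma comm_d_d: "comm (d_op p) (d_op q) = 0"
  by (rule endo_eqI) (auto simp: d_op.rep_eq fun_eq_iff fun_upd_twist of_nat_left_commute simp del: of_nat_Suc)

lemma comm_pointwise_y: "comm (pointwise g) (y_op q) = 0"
proof (rule endo_eqI)
  fix x
  have "ap g 0 = 0" by (rule ap.zero)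
  then show "ap (comm (pointwise g) (y_op q)) x = ap 0 x"
    by (auto simp: pointwise.rep_eq y_op.rep_eq fun_eq_iff)
qed

lemma ap_of_nat_times: "ap g (of_nat n * x) = of_nat n * ap g (x::'r::ring_1)"
  by (induction n) (simp_all add: ap.add ap.zero distrib_right)

lemma comm_pointwise_d: "comm (pointwise g) (d_op q) = 0"
proof (rule endo_eqI)
  fix x
  show "ap (comm (pointwise g) (d_op q)) x = ap 0 x"
    by (auto simp: pointwise.rep_eq d_op.rep_eq fun_eq_iff ap_of_nat_times simp del: of_nat_Suc)
qed

text \<open>Constant power series, which all annihilation operators kill.\<close>

definition vac :: "'r::ring_1 \<Rightarrow> ('k \<Rightarrow> nat) \<Rightarrow> 'r"
  where "vac x n = (if \<forall>p. n p = 0 then x else 0)"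

lemma vac_add: "vac (x + y) = vac x + vac y"
  by (auto simp: vac_def fun_eq_iff)

interpretation vac: additive vac
  by standard (rule vac_add)

lemma vac_inject: "vac x = vac y \<longleftrightarrow> x = y"
  by (auto simp: vac_def fun_eq_iff intro: exI[of _ "\<lambda>_. 0"])

lemma d_vac [simp]: "ap (d_op p) (vac x) = 0"
  by (auto simp: d_op.rep_eq vac_def fun_eq_iff)

lemma pointwise_vac [simp]: "ap (pointwise g) (vac x) = vac (ap g x)"
  by (auto simp: pointwise.rep_eq vac_def fun_eq_iff ap.zero)

locale vacuum_module =
  fixes N m :: nat and X :: "nat \<Rightarrow> nat \<Rightarrow> nat \<Rightarrow> 'r::ring_1 endo"
  assumes gl_X0: "gl_rel {1..N} X"
begin

sublocale weyl_extension N m "\<lambda>i j \<alpha>. pointwise (X i j \<alpha>)"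
  "\<lambda>a i \<alpha>. y_op (a, i, \<alpha>)" "\<lambda>a i \<alpha>. d_op (a, i, \<alpha>)"
proof
  show "gl_rel {1..N} (\<lambda>i j \<alpha>. pointwise (X i j \<alpha>))"
    unfolding gl_rel_def
  proof (intro conjI ballI allI)
    fix i j k l \<alpha> \<beta>
    assume ix: "i \<in> {1..N}" "j \<in> {1..N}" "k \<in> {1..N}" "l \<in> {1..N}"
    have "comm (pointwise (X i j \<alpha>)) (pointwise (X k l \<beta>)) = pointwise (comm (X i j \<alpha>) (X k l \<beta>))"
      by (simp only: pointwise_simps)
    then show "comm (pointwise (X i j \<alpha>)) (pointwise (X k l \<beta>)) =
      (if \<alpha> = \<beta> then (if j = k then pointwise (X i l \<alpha>) else 0) -
        (if l = i then pointwise (X k j \<alpha>) else 0) else 0)"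
      unfolding gl_relD[OF gl_X0 ix]
      by (cases "\<alpha> = \<beta>"; cases "j = k"; cases "l = i") (simp_all add: pointwise_simps)
  qed simp
qed (rule comm_y_y comm_d_d comm_pointwise_y comm_pointwise_d | subst comm_d_y, simp)+

lemma ext_vac_orig: "i \<in> {1..N} \<Longrightarrow> j \<in> {1..N} \<Longrightarrow> ap (ext i j \<alpha>) (vac x) = vac (ap (X i j \<alpha>) x)"
  by (simp add: ext_def G_def ap_sum ap.zero)

lemma ext_vac_new: "i \<in> {1..N + m} \<Longrightarrow> a \<in> M \<Longrightarrow> ap (ext i a \<alpha>) (vac x) = 0"
  by (simp add: ext_def Z_def D_def ap_sum ap.zero)

lemma tw_vac_new:
  assumes "a \<in> M"
  shows "ap (tw {1..N + m} ext 0 w a a) (vac x) = (if w = [] then vac x else 0)"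
proof (cases w rule: rev_exhaust)
  case (snoc z \<beta>)
  have "a \<in> {1..N + m}" using assms by auto
  then show ?thesis using assms
    by (simp add: snoc tw_snoc ap_sum ext_vac_new ap.zero)
qed simp

text \<open>
  This is where the shift comes from.  In \<open>\<Sum>\<^sub>a E\<^sub>i\<^sub>a t\<^sub>a\<^sub>j(z)\<close> a new index \<open>a\<close> contributes, since \<open>E\<^sub>i\<^sub>a\<close> kills the
  vacuum, minus the commutator of \<open>t\<^sub>a\<^sub>j(z)\<close> with \<open>E\<^sub>i\<^sub>a\<close>.  Its terms contain \<open>t\<^sub>a\<^sub>a(p)\<close>, which kills the
  vacuum unless \<open>p\<close> is empty, so all that remains is \<open>t\<^sub>i\<^sub>j(z)\<close>, and only if \<open>z\<close> begins with the letter that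
  was split off.  Summing over the \<open>m\<close> new indices gives exactly the correction term of the
  recursion for \<open>c = -m\<close>.
\<close>

lemma tw_vac:
  assumes "i \<in> {1..N}" "j \<in> {1..N}"
  shows "ap (tw {1..N + m} ext 0 w i j) (vac x) = vac (ap (tw {1..N} X (- of_nat m) w i j) x)"
  using assms(1)
proof (induction w arbitrary: i rule: length_induct)
  case (1 w)
  let ?J = "{1..N + m}"
  let ?T = "tw {1..N + m} ext 0"
  let ?S = "tw {1..N} X (- of_nat m)"
  show ?case
  proof (cases w)
    case Nil
    then show ?thesis by (simp add: vac.zero)
  next
    case (Cons \<alpha> z)
    have IH: "ap (?T v a j) (vac x) = vac (ap (?S v a j) x)" if "length v \<le> length z" "a \<in> {1..N}" for v a
      using 1 that Cons by auto
    have i: "i \<in> {1..N}" by fact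
    have new: "ap (ext i a \<alpha> * ?T z a j) (vac x) = (if z \<noteq> [] \<and> hd z = \<alpha> then vac (ap (?S z i j) x) else 0)"
      if a: "a \<in> M" for a
    proof -
      (* Only the second term for r = 0 survives: all others have a nonempty word at (a, a). *)
      define R where "R = {r. r < length z \<and> z ! r = \<alpha>}"
      have R0: "{r \<in> R. r = 0} = (if z \<noteq> [] \<and> hd z = \<alpha> then {0} else {})"
        by (auto simp: R_def hd_conv_nth)
      have fin: "finite R" by (simp add: R_def)
      have J: "a \<in> ?J" "i \<in> ?J" "j \<in> ?J" using a i assms(2) by auto
      have "ext i a \<alpha> * ?T z a j = ?T z a j * ext i a \<alpha> - comm (?T z a j) (ext i a \<alpha>)" by simp
      then have "ap (ext i a \<alpha> * ?T z a j) (vac x)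
          = ap (?T z a j) (ap (ext i a \<alpha>) (vac x)) - ap (comm (?T z a j) (ext i a \<alpha>)) (vac x)"
        by (simp add: algebra_simps)
      also have "\<dots> = - ap (comm (?T z a j) (ext i a \<alpha>)) (vac x)"
        using ext_vac_new[OF J(2) a] by (simp add: ap.zero)
      also have "\<dots> = - (\<Sum>r\<in>R. ap (?T (take (Suc r) z) a a) (vac (ap (?S (drop (Suc r) z) i j) x))
           - ap (?T (take r z) a a) (vac (ap (?S (drop r z) i j) x)))"
        unfolding comm_tw_gen[OF gl_ext J(1,3,2,1)] R_def ap_sum ap_simps
        by (simp only: IH[OF _ i] length_drop diff_le_self)
      also have "\<dots> = (\<Sum>r\<in>R. if r = 0 then vac (ap (?S z i j) x) else 0)"
        unfolding sum_negf[symmetric] by (intro sum.cong refl) (auto simp: tw_vac_new[OF a] R_def)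
      also have "\<dots> = (\<Sum>r\<in>{r \<in> R. r = 0}. vac (ap (?S z i j) x))"
        using fin by (subst sum.inter_filter[symmetric]) auto
      finally show ?thesis unfolding R0 by (simp split: if_splits)
    qed
    have old: "ap (ext i a \<alpha> * ?T z a j) (vac x) = vac (ap (X i a \<alpha> * ?S z a j) x)" if "a \<in> {1..N}" for a
      using that i by (simp add: IH ext_vac_orig del: atLeastAtMost_iff)
    have J: "sum f ?J = sum f {1..N} + sum f M" for f :: "nat \<Rightarrow> (nat \<times> nat \<times> nat \<Rightarrow> nat) \<Rightarrow> 'r"
      by (subst sum.union_disjoint[symmetric]) (auto intro!: sum.cong)
    have scal: "of_nat m * (vac v :: (nat \<times> nat \<times> nat \<Rightarrow> nat) \<Rightarrow> 'r) = vac (of_nat m * v)" for v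
      by (auto simp: fun_eq_iff vac_def)
    have "ap (?T w i j) (vac x) = (\<Sum>a\<in>{1..N}. vac (ap (X i a \<alpha> * ?S z a j) x))
        + (\<Sum>a\<in>M. if z \<noteq> [] \<and> hd z = \<alpha> then vac (ap (?S z i j) x) else 0)"
      unfolding Cons tw_Cons_0 ap_sum J
      by (intro arg_cong2[where f = "(+)"] sum.cong refl old new)
    also have "\<dots> = vac (ap (?S w i j) x)"
    proof -
      have "ap (of_nat m * ?S z i j) x = of_nat m * ap (?S z i j) x"
        by (simp add: ap_of_nat)
      then show ?thesis
        unfolding Cons tw.simps(2) by (simp add: ap_sum vac.sum scal vac.add del: ap_simps(6))
    qed
    finally show ?thesis .
  qed
qed

text \<open>The unshifted formula for \<open>gl(N + m)\<close>, applied to the vacuum vectors.\<close>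

lemma commutator_negative_shift:
  assumes \<Phi>: "\<And>J (E :: nat \<Rightarrow> nat \<Rightarrow> nat \<Rightarrow> ((nat \<times> nat \<times> nat \<Rightarrow> nat) \<Rightarrow> 'r) endo) i j k l. gl_rel J E \<Longrightarrow>
      i \<in> J \<Longrightarrow> j \<in> J \<Longrightarrow> k \<in> J \<Longrightarrow> l \<in> J \<Longrightarrow>
      comm (tw J E 0 w i j) (tw J E 0 w' k l) = form_val (tw J E 0) i j k l \<Phi>"
    and ix: "i \<in> {1..N}" "j \<in> {1..N}" "k \<in> {1..N}" "l \<in> {1..N}"
  shows "comm (tw {1..N} X (- of_nat m) w i j) (tw {1..N} X (- of_nat m) w' k l)
    = form_val (tw {1..N} X (- of_nat m)) i j k l \<Phi>"
proof (rule endo_eqI)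
  fix x :: 'r
  let ?T = "tw {1..N + m} ext 0"
  let ?S = "tw {1..N} X (- of_nat m)"
  have "ap (of_int z) (vac u :: (nat \<times> nat \<times> nat \<Rightarrow> nat) \<Rightarrow> 'r) = vac (ap (of_int z) u)" for z u
  proof -
    have "ap (of_nat n) (vac u :: (nat \<times> nat \<times> nat \<Rightarrow> nat) \<Rightarrow> 'r) = vac (ap (of_nat n) u)" for n
      by (induction n) (simp_all add: vac.add vac.zero)
    then show ?thesis by (cases z rule: int_diff_cases) (simp add: vac.diff)
  qed
  then have tv: "ap (term_val ?T i j k l t) (vac x) = vac (ap (term_val ?S i j k l t) x)" for t
    using ix by (cases t) (simp add: tw_vac del: atLeastAtMost_iff)
  have "vac (ap (comm (?S w i j) (?S w' k l)) x) = ap (comm (?T w i j) (?T w' k l)) (vac x)"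
    using ix by (simp add: tw_vac vac.diff del: atLeastAtMost_iff)
  also have "\<dots> = ap (form_val ?T i j k l \<Phi>) (vac x)"
    using ix by (intro arg_cong2[where f = ap] \<Phi> gl_ext refl) simp_all
  also have "\<dots> = vac (ap (form_val ?S i j k l \<Phi>) x)"
    by (induction \<Phi>) (simp_all add: tv vac.zero vac.add fun_eq_iff del: term_val.simps)
  finally show "ap (comm (?S w i j) (?S w' k l)) x = ap (form_val ?S i j k l \<Phi>) x"
    by (simp add: vac_inject)
qed

end


section \<open>Presented algebras and normal form maps\<close>

lemma lookup_fscal_mult: "Poly_Mapping.lookup (fscal c * x) m = c * Poly_Mapping.lookup x m"
proof -
  have "fscal c * x = Poly_Mapping.map ((*) c) x"
    by (simp add: fscal_def mult_map_scale_conv_mult)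
  then show ?thesis by (simp add: map.rep_eq when_def)
qed

lemma fscal_simps:
  "fscal (a + b) = fscal a + fscal b" "fscal (a * b) = fscal a * fscal b" "fscal 1 = 1"
  "fscal 0 = 0" "fscal (- a) = - fscal a" "fscal (of_nat n) = of_nat n"
  by (simp_all add: fscal_def single_add mult_single single_uminus single_of_nat)

lemma fscal_diff: "fscal (a - b) = fscal a - fscal b"
  by (simp add: fscal_def single_diff)

lemma fscal_commute: "x * fscal c = fscal c * (x :: 'a free)"
proof (induction x rule: update_induct)
  case const
  then show ?case by simp
next
  case (update f a b)
  have "Poly_Mapping.update a b f = f + Poly_Mapping.single a b"
    using update by (intro poly_mapping_eqI) (auto simp: lookup_update lookup_add lookup_single when_def in_keys_iff)
  then show ?case
    using update by (simp add: distrib_left distrib_right fscal_def mult_single mult.commute)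
qed

lemma fscal_left_commute: "x * (fscal c * y) = fscal c * (x * (y :: 'a free))"
  by (metis fscal_commute mult.assoc)

interpretation free: vector_space "\<lambda>c x. fscal c * (x :: 'a free)"
  by standard (simp_all add: fscal_simps algebra_simps)

locale presented_algebra =
  fixes B :: "'a set" and br :: "'a bracket"
  assumes br_closed: "b \<in> B \<Longrightarrow> c \<in> B \<Longrightarrow> Poly_Mapping.keys (br b c) \<subseteq> B"
begin

abbreviation "C \<equiv> carrier (free_alg B)"
abbreviation "I \<equiv> uea_ideal B br"

lemma C_iff: "x \<in> C \<longleftrightarrow> (\<forall>m\<in>Poly_Mapping.keys x. set (letters m) \<subseteq> B)"
  by (simp add: free_alg_def)

lemma free_alg_ops [simp]:
  "x \<otimes>\<^bsub>free_alg B\<^esub> y = x * y" "x \<oplus>\<^bsub>free_alg B\<^esub> y = x + y" "\<one>\<^bsub>free_alg B\<^esub> = 1" "\<zero>\<^bsub>free_alg B\<^esub> = 0"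
  by (simp_all add: free_alg_def)

lemma C_add [intro]: "x \<in> C \<Longrightarrow> y \<in> C \<Longrightarrow> x + y \<in> C"
  using keys_add[of x y] by (auto simp: C_iff)

lemma C_uminus [intro]: "x \<in> C \<Longrightarrow> - x \<in> C"
  by (simp add: C_iff)

lemma C_diff [intro]: "x \<in> C \<Longrightarrow> y \<in> C \<Longrightarrow> x - y \<in> C"
  using C_add[of x "- y"] C_uminus[of y] by simp

lemma C_mult [intro]:
  assumes "x \<in> C" "y \<in> C"
  shows "x * y \<in> C"
  unfolding C_iff
proof
  fix m assume "m \<in> Poly_Mapping.keys (x * y)"
  then obtain u v where "m = u + v" "u \<in> Poly_Mapping.keys x" "v \<in> Poly_Mapping.keys y"
    using keys_mult[of x y] by blast
  then show "set (letters m) \<subseteq> B" using assms by (auto simp: C_iff plus_fmon_def)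
qed

lemma C_fscal [intro, simp]: "fscal c \<in> C"
  by (auto simp: C_iff fscal_def zero_fmon_def)

lemma C_fgen [intro]: "b \<in> B \<Longrightarrow> fgen b \<in> C"
  by (auto simp: C_iff fgen_def)

lemma C_01 [intro, simp]: "0 \<in> C" "1 \<in> C"
  using C_fscal[of 0] C_fscal[of 1] by (simp_all only: fscal_simps)

lemma C_of_nat [simp]: "of_nat n \<in> C"
  using C_fscal[of "of_nat n"] by (simp only: fscal_simps)

lemma C_of_int [simp]: "of_int z \<in> C"
  by (cases z rule: int_diff_cases) (auto intro: C_diff)

lemma C_sum [intro]: "(\<And>a. a \<in> A \<Longrightarrow> f a \<in> C) \<Longrightarrow> sum f A \<in> C"
  by (induction A rule: infinite_finite_induct) auto

lemma C_flin: "Poly_Mapping.keys v \<subseteq> B \<Longrightarrow> flin v \<in> C"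
  unfolding flin_def by (auto intro!: C_sum C_mult)

lemma ring_free_alg: "ring (free_alg B)"
proof (rule ringI)
  show "abelian_group (free_alg B)"
  proof (rule abelian_groupI)
    fix x assume "x \<in> C"
    then show "\<exists>y\<in>C. y \<oplus>\<^bsub>free_alg B\<^esub> x = \<zero>\<^bsub>free_alg B\<^esub>"
      by (intro bexI[of _ "- x"]) auto
  qed (auto simp: algebra_simps)
  show "Group.monoid (free_alg B)"
    by (rule monoidI) (auto simp: mult.assoc)
qed (simp_all add: algebra_simps)

abbreviation "relators \<equiv> {fgen b * fgen c - fgen c * fgen b - flin (br b c) | b c. b \<in> B \<and> c \<in> B}"

lemma relators_C: "relators \<subseteq> C"
  using br_closed by (auto intro!: C_diff C_mult C_flin)

lemma ideal_I: "ideal I (free_alg B)"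
  unfolding uea_ideal_def by (rule ring.genideal_ideal[OF ring_free_alg relators_C])

lemma I_C: "x \<in> I \<Longrightarrow> x \<in> C"
  using ideal.Icarr[OF ideal_I] .

lemma I_mult_left: "x \<in> I \<Longrightarrow> a \<in> C \<Longrightarrow> a * x \<in> I"
  using ideal.I_l_closed[OF ideal_I] by simp

lemma I_mult_right: "x \<in> I \<Longrightarrow> a \<in> C \<Longrightarrow> x * a \<in> I"
  using ideal.I_r_closed[OF ideal_I] by simp

lemma I_add: "x \<in> I \<Longrightarrow> y \<in> I \<Longrightarrow> x + y \<in> I"
  using additive_subgroup.a_closed[OF ideal.axioms(1)[OF ideal_I]] by simp

lemma I_0: "0 \<in> I"
  using additive_subgroup.zero_closed[OF ideal.axioms(1)[OF ideal_I]] by simp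

lemma I_uminus: "x \<in> I \<Longrightarrow> - x \<in> I"
  using I_mult_left[of x "- 1"] by auto

lemma relator_I: "b \<in> B \<Longrightarrow> c \<in> B \<Longrightarrow> fgen b * fgen c - fgen c * fgen b - flin (br b c) \<in> I"
  unfolding uea_ideal_def using ring.genideal_self[OF ring_free_alg relators_C] by blast

text \<open>
  The free algebra is a vector space, so it has linear projections \<open>\<rho>\<close> onto the subalgebra \<open>C\<close> and \<open>g\<close> onto
  the ideal \<open>I\<close>; the map \<open>\<rho> - g \<circ> \<rho>\<close> picks a representative of each coset linearly.
\<close>

lemma exists_normal_form_map:
  obtains \<theta> :: "'a free \<Rightarrow> 'a free" where
    "\<And>x y. \<theta> (x + y) = \<theta> x + \<theta> y" "\<And>c x. \<theta> (fscal c * x) = fscal c * \<theta> x"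
    "\<And>x. \<theta> x \<in> C" "\<And>x. x \<in> C \<Longrightarrow> x - \<theta> x \<in> I" "\<And>x. x \<in> I \<Longrightarrow> \<theta> x = 0"
proof -
  interpret vv: vector_space_pair "\<lambda>c x. fscal c * (x :: 'a free)" "\<lambda>c x. fscal c * (x :: 'a free)"
    by standard
  let ?lin = "Vector_Spaces.linear (\<lambda>c x. fscal c * (x :: 'a free)) (\<lambda>c x. fscal c * (x :: 'a free))"
  have id: "?lin (\<lambda>x. x)"
    by (simp add: free.linear_ident)
  have C: "free.subspace C" and I: "free.subspace I"
    using I_0 I_add I_mult_left by (auto simp: free.subspace_def)
  obtain \<rho> where \<rho>: "range \<rho> \<subseteq> C" "?lin \<rho>" "\<forall>v\<in>C. \<rho> v = v"
    using vv.linear_exists_left_inverse_on[OF id C] by auto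
  obtain g where g: "range g \<subseteq> I" "?lin g" "\<forall>v\<in>I. g v = v"
    using vv.linear_exists_left_inverse_on[OF id I] by auto
  show ?thesis
  proof (rule that[of "\<lambda>x. \<rho> x - g (\<rho> x)"])
    fix x y c
    show "\<rho> (x + y) - g (\<rho> (x + y)) = \<rho> x - g (\<rho> x) + (\<rho> y - g (\<rho> y))"
      using \<rho>(2) g(2) by (simp add: vv.linear_add)
    show "\<rho> (fscal c * x) - g (\<rho> (fscal c * x)) = fscal c * (\<rho> x - g (\<rho> x))"
      using \<rho>(2) g(2) by (simp add: vv.linear_scale right_diff_distrib)
    show "\<rho> x - g (\<rho> x) \<in> C"
      using \<rho>(1) g(1) I_C[of "g (\<rho> x)"] by (intro C_diff) auto
    show "x - (\<rho> x - g (\<rho> x)) \<in> I" if "x \<in> C"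
      using that \<rho>(3) g(1) by auto
    show "\<rho> x - g (\<rho> x) = 0" if "x \<in> I"
      using that \<rho>(3) g(3) I_C by auto
  qed
qed

end

locale normal_form_map = presented_algebra B br
  for B :: "'a set" and br :: "'a bracket" +
  fixes \<theta> :: "'a free \<Rightarrow> 'a free"
  assumes \<theta>_add: "\<theta> (x + y) = \<theta> x + \<theta> y"
    and \<theta>_fscal: "\<theta> (fscal c * x) = fscal c * \<theta> x"
    and \<theta>_C: "\<theta> x \<in> C"
    and \<theta>_cong: "x \<in> C \<Longrightarrow> x - \<theta> x \<in> I"
    and \<theta>_I: "x \<in> I \<Longrightarrow> \<theta> x = 0"
begin

sublocale \<theta>: additive \<theta>
  by standard (rule \<theta>_add)

lemma \<theta>_absorb: "\<theta> x = 0 \<Longrightarrow> x \<in> C \<Longrightarrow> x \<in> I"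
  using \<theta>_cong[of x] by simp

lemma \<theta>_mult: "a \<in> C \<Longrightarrow> x \<in> C \<Longrightarrow> \<theta> (a * \<theta> x) = \<theta> (a * x)"
  using \<theta>_I[OF I_mult_left[OF \<theta>_cong]] by (simp add: right_diff_distrib \<theta>.diff)

text \<open>
  The left regular representation of the quotient algebra, transported to the free algebra by
  means of the representatives chosen by \<open>\<theta>\<close>.  It is faithful on the quotient: \<open>act a\<close>
  maps \<open>\<theta> 1\<close> to \<open>\<theta> a\<close>, which vanishes only for \<open>a \<in> I\<close>.
\<close>

definition act :: "'a free \<Rightarrow> 'a free endo"
  where "act a = Endo (\<lambda>x. \<theta> (a * \<theta> x))"

lemma ap_act: "ap (act a) x = \<theta> (a * \<theta> x)"
  unfolding act_def by (subst Endo_inverse) (auto simp: \<theta>_add distrib_left)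

lemma act_simps:
  "act (x + y) = act x + act y" "act (x - y) = act x - act y" "act 0 = 0" "act (- x) = - act x"
  "x \<in> C \<Longrightarrow> y \<in> C \<Longrightarrow> act (x * y) = act x * act y"
  by (rule endo_eqI;
    simp add: ap_act distrib_right left_diff_distrib \<theta>_add \<theta>.diff \<theta>.zero \<theta>.minus \<theta>_mult \<theta>_C C_mult mult.assoc)+

lemma act_I: "x \<in> I \<Longrightarrow> act x = 0"
  by (rule endo_eqI) (simp add: ap_act \<theta>_I I_mult_right \<theta>_C)

lemma ap_act_\<theta>: "a \<in> C \<Longrightarrow> x \<in> C \<Longrightarrow> ap (act a) (\<theta> x) = \<theta> (a * x)"
  by (simp add: ap_act \<theta>_mult \<theta>_C)

lemma comm_act:
  assumes "b \<in> B" "c \<in> B"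
  shows "comm (act (fgen b)) (act (fgen c)) = act (flin (br b c))"
proof -
  have "act (fgen b * fgen c - fgen c * fgen b - flin (br b c)) = 0"
    by (rule act_I[OF relator_I[OF assms]])
  then show ?thesis
    using assms by (simp add: act_simps C_fgen)
qed

end

section \<open>Polynomial dependence on the shift\<close>

text \<open>
  Polynomial functions of a complex parameter with coefficients in the free algebra, built by
  Horner steps, so that closure under products and the polynomial dependence of linear functionals
  can be shown by induction.
\<close>

inductive poly_family :: "(complex \<Rightarrow> 'a free) \<Rightarrow> bool"
  where
    const: "poly_family (\<lambda>_. a)"
  | scale: "poly_family f \<Longrightarrow> poly_family (\<lambda>c. fscal c * f c)"
  | add: "poly_family f \<Longrightarrow> poly_family g \<Longrightarrow> poly_family (\<lambda>c. f c + g c)"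

lemma poly_family_mult:
  assumes "poly_family f" "poly_family g"
  shows "poly_family (\<lambda>c. f c * g c)"
  using assms(1)
proof induction
  case (const a)
  show ?case using assms(2)
  proof induction
    case (scale g)
    then show ?case using poly_family.scale[OF scale.IH] by (simp add: fscal_left_commute)
  qed (auto simp: distrib_left intro: poly_family.intros)
next
  case (scale f)
  then show ?case using poly_family.scale[OF scale.IH] by (simp add: mult.assoc)
qed (auto simp: distrib_right intro: poly_family.intros)

lemma poly_family_diff:
  assumes "poly_family f" "poly_family g"
  shows "poly_family (\<lambda>c. f c - g c)"
  using poly_family.add[OF assms(1) poly_family_mult[OF poly_family.const[of "- 1"] assms(2)]] by simp

lemma poly_family_sum: "(\<And>a. a \<in> A \<Longrightarrow> poly_family (f a)) \<Longrightarrow> poly_family (\<lambda>c. \<Sum>a\<in>A. f a c)"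
  by (induction A rule: infinite_finite_induct) (auto intro: poly_family.intros)

lemma poly_family_tw: "poly_family (\<lambda>c. tw J E (fscal c) w i j)"
proof (induction w arbitrary: i)
  case Nil
  then show ?case by (simp add: poly_family.const)
next
  case (Cons \<alpha> w)
  have "poly_family (\<lambda>c. if w \<noteq> [] \<and> hd w = \<alpha> then fscal c * tw J E (fscal c) w i j else 0)"
    by (cases "w \<noteq> [] \<and> hd w = \<alpha>") (auto intro: poly_family.intros Cons)
  then show ?case
    unfolding tw.simps by (intro poly_family_diff poly_family_sum poly_family_mult poly_family.const Cons)
qed

lemma poly_family_form_val: "poly_family (\<lambda>c. form_val (tw J E (fscal c)) i j k l \<Phi>)"
proof (induction \<Phi>)
  case Nil
  then show ?case by (simp add: poly_family.const)
next
  case (Cons t \<Phi>)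
  obtain z b v v' where t: "t = (z, b, v, v')" by (metis surj_pair)
  have "poly_family (\<lambda>c. term_val (tw J E (fscal c)) i j k l t)"
    by (cases b) (auto simp: t intro!: poly_family_mult poly_family.const poly_family_tw)
  then show ?case using Cons by (simp add: poly_family.add)
qed

context normal_form_map
begin

text \<open>
  Every coefficient of \<open>\<theta> (f c)\<close> is a complex polynomial in \<open>c\<close> with infinitely many zeros.
\<close>

lemma poly_family_I:
  assumes f: "poly_family f" and C: "\<And>c. f c \<in> C" and zero: "\<And>m. f (- of_nat m) \<in> I"
  shows "f c \<in> I"
proof (rule \<theta>_absorb[OF _ C], rule poly_mapping_eqI)
  fix \<kappa>
  have "\<exists>p. \<forall>c. Poly_Mapping.lookup (\<theta> (f c)) \<kappa> = poly p c"
    using f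
  proof induction
    case (const a)
    then show ?case by (intro exI[of _ "[:Poly_Mapping.lookup (\<theta> a) \<kappa>:]"]) simp
  next
    case (scale f)
    then obtain p where "\<forall>c. Poly_Mapping.lookup (\<theta> (f c)) \<kappa> = poly p c" by blast
    then show ?case by (intro exI[of _ "pCons 0 p"]) (simp add: \<theta>_fscal lookup_fscal_mult)
  next
    case (add f g)
    then obtain p q where "\<forall>c. Poly_Mapping.lookup (\<theta> (f c)) \<kappa> = poly p c"
      "\<forall>c. Poly_Mapping.lookup (\<theta> (g c)) \<kappa> = poly q c" by blast
    then show ?case by (intro exI[of _ "p + q"]) (simp add: \<theta>_add lookup_add)
  qed
  then obtain p where p: "\<And>c. Poly_Mapping.lookup (\<theta> (f c)) \<kappa> = poly p c" by blast
  have "p = 0"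
  proof (rule ccontr)
    assume "p \<noteq> 0"
    then have "finite {x. poly p x = 0}" by (rule poly_roots_finite)
    moreover have "range (\<lambda>m. - of_nat m :: complex) \<subseteq> {x. poly p x = 0}"
      using \<theta>_I[OF zero] by (auto simp flip: p)
    ultimately have "finite (range (\<lambda>m. - of_nat m :: complex))" by (rule finite_subset[rotated])
    moreover have "inj (\<lambda>m. - of_nat m :: complex)" by (auto intro!: injI)
    ultimately show False using finite_imageD by blast
  qed
  then show "Poly_Mapping.lookup (\<theta> (f c)) \<kappa> = Poly_Mapping.lookup 0 \<kappa>" by (simp add: p)
qed

end


section \<open>Commutators in the enveloping algebra\<close>

lemma flin_superset:
  assumes "finite S" "Poly_Mapping.keys v \<subseteq> S"
  shows "flin v = (\<Sum>b\<in>S. fscal (Poly_Mapping.lookup v b) * fgen b)"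
  unfolding flin_def using assms
  by (intro sum.mono_neutral_left) (auto simp: in_keys_iff fscal_simps)

lemma flin_diff: "flin (u - v) = flin u - flin v"
proof -
  let ?S = "Poly_Mapping.keys u \<union> Poly_Mapping.keys v"
  have "Poly_Mapping.keys (u - v) \<subseteq> ?S" by (rule keys_diff)
  then show ?thesis
    by (simp add: flin_superset[of ?S] lookup_minus fscal_diff left_diff_distrib sum_subtractf)
qed

lemma flin_simps [simp]: "flin 0 = 0" "flin (Poly_Mapping.single b 1) = fgen b"
  by (simp_all add: flin_def fscal_simps)

interpretation gl: presented_algebra "gl_basis N L" gl_bracket for N L
proof
  fix b c assume "b \<in> gl_basis N L" "c \<in> gl_basis N L"
  then show "Poly_Mapping.keys (gl_bracket b c) \<subseteq> gl_basis N L"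
    by (cases b; cases c) (auto simp: gl_basis_def in_keys_iff lookup_minus lookup_single when_def split: if_splits)
qed

abbreviation E_gen :: "nat \<Rightarrow> nat \<Rightarrow> nat \<Rightarrow> gl_index free"
  where "E_gen i j \<alpha> \<equiv> fgen (i, j, \<alpha>)"

definition tfree :: "nat \<Rightarrow> complex \<Rightarrow> nat list \<Rightarrow> nat \<Rightarrow> nat \<Rightarrow> gl_index free"
  where "tfree N c = tw {1..N} E_gen (fscal c)"

lemma tfree_C:
  assumes "i \<in> {1..N}" "j \<in> {1..N}" "set w \<subseteq> {1..L}"
  shows "tfree N c w i j \<in> carrier (free_alg (gl_basis N L))"
  using assms(1,3) unfolding tfree_def
proof (induction w arbitrary: i)
  case (Cons \<alpha> w)
  have "E_gen i a \<alpha> \<in> carrier (free_alg (gl_basis N L))" if "a \<in> {1..N}" for a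
    using Cons.prems that by (intro gl.C_fgen) (auto simp: gl_basis_def)
  then show ?case
    unfolding tw.simps using Cons
    by (intro gl.C_diff gl.C_sum gl.C_mult) auto
qed auto

locale gl_normal_form_map = normal_form_map "gl_basis N L" gl_bracket \<theta>
  for N L :: nat and \<theta> :: "gl_index free \<Rightarrow> gl_index free"
begin

definition X :: "nat \<Rightarrow> nat \<Rightarrow> nat \<Rightarrow> gl_index free endo"
  where "X i j \<alpha> = (if \<alpha> \<in> {1..L} then act (E_gen i j \<alpha>) else 0)"

lemma gl_X: "gl_rel {1..N} X"
  unfolding gl_rel_def
proof (intro conjI ballI allI)
  fix i j k l \<alpha> \<beta>
  assume ix: "i \<in> {1..N}" "j \<in> {1..N}" "k \<in> {1..N}" "l \<in> {1..N}"
  show "comm (X i j \<alpha>) (X k l \<beta>) =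
    (if \<alpha> = \<beta> then (if j = k then X i l \<alpha> else 0) - (if l = i then X k j \<alpha> else 0) else 0)"
  proof (cases "\<alpha> \<in> {1..L} \<and> \<beta> \<in> {1..L}")
    case True
    then have "comm (X i j \<alpha>) (X k l \<beta>) = act (flin (gl_bracket (i, j, \<alpha>) (k, l, \<beta>)))"
      using ix by (simp only: X_def if_True) (rule comm_act; simp add: gl_basis_def)
    then show ?thesis
      using True by (auto simp: flin_diff act_simps X_def)
  qed (auto simp: X_def)
qed simp

lemma ap_tw_X:
  assumes "i \<in> {1..N}" "j \<in> {1..N}" "set w \<subseteq> {1..L}" "x \<in> C"
  shows "ap (tw {1..N} X (- of_nat m) w i j) (\<theta> x) = \<theta> (tfree N (- of_nat m) w i j * x)"
  using assms(1,3) unfolding tfree_def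
proof (induction w arbitrary: i)
  case (Cons \<alpha> w)
  let ?T = "tw {1..N} E_gen (fscal (- of_nat m))"
  let ?S = "tw {1..N} X (- of_nat m)"
  have T: "?T w a j \<in> C" if "a \<in> {1..N}" for a
    using tfree_C[OF that assms(2)] Cons.prems by (simp add: tfree_def)
  have "ap (X i a \<alpha> * ?S w a j) (\<theta> x) = \<theta> (E_gen i a \<alpha> * ?T w a j * x)" if a: "a \<in> {1..N}" for a
  proof -
    have "ap (X i a \<alpha> * ?S w a j) (\<theta> x) = ap (X i a \<alpha>) (\<theta> (?T w a j * x))"
      using Cons a by simp
    also have "\<dots> = \<theta> (E_gen i a \<alpha> * (?T w a j * x))"
      using Cons.prems a T[OF a] assms(4)
      unfolding X_def
      by (subst if_P) (auto intro!: ap_act_\<theta> C_fgen C_mult simp: gl_basis_def)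
    finally show ?thesis by (simp add: mult.assoc)
  qed
  moreover have "ap (of_nat m * ?S w i j) (\<theta> x) = \<theta> (of_nat m * ?T w i j * x)"
  proof -
    have "\<theta> (of_nat n * u) = of_nat n * \<theta> u" for n u
      by (induction n) (simp_all add: distrib_right \<theta>_add \<theta>.zero)
    then show ?thesis using Cons by (simp add: mult.assoc ap_of_nat)
  qed
  moreover have "tw {1..N} X (- of_nat m) (\<alpha> # w) i j = (\<Sum>a\<in>{1..N}. X i a \<alpha> * ?S w a j)
      + (if w \<noteq> [] \<and> hd w = \<alpha> then of_nat m * ?S w i j else 0)"
    unfolding tw.simps by simp
  moreover have "?T (\<alpha> # w) i j * x = (\<Sum>a\<in>{1..N}. E_gen i a \<alpha> * ?T w a j * x)
      + (if w \<noteq> [] \<and> hd w = \<alpha> then of_nat m * ?T w i j * x else 0)"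
    unfolding tw.simps by (simp add: fscal_simps sum_distrib_right distrib_right)
  ultimately show ?case
    by (simp only: ap_sum ap_simps(3) \<theta>_add \<theta>.sum cong: sum.cong if_cong) (simp add: \<theta>.zero)
qed (auto simp: \<theta>.zero ap.zero)

text \<open>
  The difference of the two sides is a polynomial in \<open>c\<close>, and at \<open>c = -m\<close> the regular representation
  sends it to zero.
\<close>

lemma commutator_I:
  assumes \<Phi>: "\<And>J (E :: nat \<Rightarrow> nat \<Rightarrow> nat \<Rightarrow> ((nat \<times> nat \<times> nat \<Rightarrow> nat) \<Rightarrow> gl_index free) endo) i j k l.
      gl_rel J E \<Longrightarrow> i \<in> J \<Longrightarrow> j \<in> J \<Longrightarrow> k \<in> J \<Longrightarrow> l \<in> J \<Longrightarrow>
      comm (tw J E 0 w i j) (tw J E 0 w' k l) = form_val (tw J E 0) i j k l \<Phi>"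
    and ok: "form_ok {1..L} n \<Phi>" and w: "set w \<subseteq> {1..L}" "set w' \<subseteq> {1..L}"
    and ix: "i \<in> {1..N}" "j \<in> {1..N}" "k \<in> {1..N}" "l \<in> {1..N}"
  shows "comm (tfree N c w i j) (tfree N c w' k l) - form_val (tfree N c) i j k l \<Phi> \<in> I"
proof -
  let ?f = "\<lambda>c. comm (tfree N c w i j) (tfree N c w' k l) - form_val (tfree N c) i j k l \<Phi>"
  have pf: "poly_family ?f"
    unfolding tfree_def
    by (intro poly_family_diff poly_family_mult poly_family_tw poly_family_form_val)
  have form_C: "form_val (tfree N c) i j k l \<Phi> \<in> C" for c
    using ok
  proof (induction \<Phi>)
    case (Cons t \<Phi>)
    obtain z b v v' where t: "t = (z, b, v, v')" by (metis surj_pair)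
    have "term_val (tfree N c) i j k l t \<in> C"
      using Cons.prems ix unfolding t term_val.simps by (auto intro!: C_mult tfree_C simp del: atLeastAtMost_iff)
    then show ?case using Cons by (auto simp: t simp del: term_val.simps)
  qed auto
  have fC: "?f c \<in> C" for c
    using ix w by (intro C_diff C_mult tfree_C form_C)
  have "?f (- of_nat m) \<in> I" for m
  proof (rule \<theta>_absorb[OF _ fC])
    interpret vacuum_module N m X
      by standard (rule gl_X)
    let ?T = "tfree N (- of_nat m)"
    let ?S = "tw {1..N} X (- of_nat m)"
    have \<theta>_int: "\<theta> (of_int z * u) = of_int z * \<theta> u" for z u
    proof -
      have "\<theta> (of_nat n * u) = of_nat n * \<theta> u" for n
        by (induction n) (simp_all add: distrib_right \<theta>_add \<theta>.zero)
      then show ?thesis by (cases z rule: int_diff_cases) (simp add: left_diff_distrib \<theta>.diff)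
    qed
    have mult: "ap (?S v a b * ?S v' a' b') (\<theta> 1) = \<theta> (?T v a b * ?T v' a' b')"
      if "set v \<subseteq> {1..L}" "set v' \<subseteq> {1..L}" "a \<in> {1..N}" "b \<in> {1..N}" "a' \<in> {1..N}" "b' \<in> {1..N}" for v v' a b a' b'
      using that by (simp add: ap_tw_X tfree_C del: atLeastAtMost_iff)
    have "ap (form_val ?S i j k l \<Phi>) (\<theta> 1) = \<theta> (form_val ?T i j k l \<Phi>)"
      using ok
    proof (induction \<Phi>)
      case (Cons t \<Phi>)
      obtain z b v v' where t: "t = (z, b, v, v')" by (metis surj_pair)
      have "ap (term_val ?S i j k l t) (\<theta> 1) = \<theta> (term_val ?T i j k l t)"
        using Cons.prems ix unfolding t term_val.simps
        by (cases b) (simp_all only: ap_simps(6)[of "of_int z"] ap_of_int \<theta>_int mult form_ok_simps Un_subset_iff if_True if_False)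
      then show ?case using Cons by (auto simp: t \<theta>_add simp del: term_val.simps)
    qed (simp add: \<theta>.zero)
    note form = this
    have prod: "ap (comm (?S w i j) (?S w' k l)) (\<theta> 1) = \<theta> (comm (?T w i j) (?T w' k l))"
      using w ix by (simp only: ap_simps(5) mult \<theta>.diff)
    have eq: "comm (?S w i j) (?S w' k l) = form_val ?S i j k l \<Phi>"
      by (rule commutator_negative_shift[OF \<Phi> ix])
    have "\<theta> (comm (?T w i j) (?T w' k l)) = ap (form_val ?S i j k l \<Phi>) (\<theta> 1)"
      by (simp only: prod[symmetric] eq)
    also have "\<dots> = \<theta> (form_val ?T i j k l \<Phi>)"
      by (rule form)
    finally have "\<theta> (comm (?T w i j) (?T w' k l)) = \<theta> (form_val ?T i j k l \<Phi>)" .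
    then show "\<theta> (?f (- of_nat m)) = 0"
      by (simp only: \<theta>.diff right_minus_eq)
  qed
  then show ?thesis by (rule poly_family_I[OF pf fC])
qed

end

theorem commutator_mod_ideal:
  assumes "set w \<union> set w' \<subseteq> {1..L}"
  obtains \<Phi> where "form_ok {1..L} (length w + length w' - 1) \<Phi>"
    and "\<And>N c i j k l. \<lbrakk>i \<in> {1..N}; j \<in> {1..N}; k \<in> {1..N}; l \<in> {1..N}\<rbrakk> \<Longrightarrow>
      comm (tfree N c w i j) (tfree N c w' k l) - form_val (tfree N c) i j k l \<Phi>
        \<in> uea_ideal (gl_basis N L) gl_bracket"
proof -
  obtain \<Phi> where ok: "form_ok {1..L} (length w + length w' - 1) \<Phi>"
    and \<Phi>: "\<And>J (E :: nat \<Rightarrow> nat \<Rightarrow> nat \<Rightarrow> ((nat \<times> nat \<times> nat \<Rightarrow> nat) \<Rightarrow> gl_index free) endo) i j k l.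
      gl_rel J E \<Longrightarrow> i \<in> J \<Longrightarrow> j \<in> J \<Longrightarrow> k \<in> J \<Longrightarrow> l \<in> J \<Longrightarrow>
      comm (tw J E 0 w i j) (tw J E 0 w' k l) = form_val (tw J E 0) i j k l \<Phi>"
    using expressible_commutator[OF assms] unfolding expressible_def by metis
  show ?thesis
  proof (rule that[OF ok])
    fix N i j k l :: nat and c
    assume ix: "i \<in> {1..N}" "j \<in> {1..N}" "k \<in> {1..N}" "l \<in> {1..N}"
    obtain \<theta> where "normal_form_map (gl_basis N L) gl_bracket \<theta>"
      using gl.exists_normal_form_map[of N L] 
      by (metis (no_types, lifting) gl.presented_algebra_axioms normal_form_map.intro normal_form_map_axioms.intro)
    then interpret gl_normal_form_map N L \<theta>
      by (rule gl_normal_form_map.intro)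
    show "comm (tfree N c w i j) (tfree N c w' k l) - form_val (tfree N c) i j k l \<Phi>
        \<in> uea_ideal (gl_basis N L) gl_bracket"
      by (rule commutator_I[OF \<Phi> ok]) (use assms ix in auto)
  qed
qed


section \<open>The quotient algebra and its matrix series\<close>

context presented_algebra
begin

lemma a_minus_free: "y \<in> C \<Longrightarrow> x \<ominus>\<^bsub>free_alg B\<^esub> y = x - y"
proof -
  interpret R: ring "free_alg B" by (rule ring_free_alg)
  assume "y \<in> C"
  then have "\<ominus>\<^bsub>free_alg B\<^esub> y = - y"
    by (intro R.minus_equality) auto
  then show ?thesis by (simp add: a_minus_def)
qed

lemma cls_eqI: "x \<in> C \<Longrightarrow> y \<in> C \<Longrightarrow> x - y \<in> I \<Longrightarrow> uea_cls B br x = uea_cls B br y"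
  using ring.quotient_eq_iff_same_a_r_cos[OF ring_free_alg ideal_I, of x y]
  by (simp add: uea_cls_def a_minus_free)

lemma cls_eqD: "x \<in> C \<Longrightarrow> y \<in> C \<Longrightarrow> uea_cls B br x = uea_cls B br y \<Longrightarrow> x - y \<in> I"
  using ring.quotient_eq_iff_same_a_r_cos[OF ring_free_alg ideal_I, of x y]
  by (simp add: uea_cls_def a_minus_free)

lemma cls_mult: "x \<in> C \<Longrightarrow> y \<in> C \<Longrightarrow> uea_cls B br x \<otimes>\<^bsub>uea B br\<^esub> uea_cls B br y = uea_cls B br (x * y)"
  using ideal.rcoset_mult_add[OF ideal_I, of x y]
  by (simp add: uea_cls_def uea_def FactRing_def)

lemma cls_add: "x \<in> C \<Longrightarrow> y \<in> C \<Longrightarrow> uea_cls B br x \<oplus>\<^bsub>uea B br\<^esub> uea_cls B br y = uea_cls B br (x + y)"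
  using abelian_subgroup.a_rcos_sum[OF abelian_subgroupI3[OF ideal.axioms(1)[OF ideal_I] ring.is_abelian_group[OF ring_free_alg]], of x y]
  by (simp add: uea_cls_def uea_def FactRing_def)

lemma cls_smult: "x \<in> C \<Longrightarrow> c \<odot>\<^bsub>uea B br\<^esub> uea_cls B br x = uea_cls B br (fscal c * x)"
  using cls_mult[OF C_fscal, of x c] by (simp add: uea_def Let_def)

lemma cls_one: "\<one>\<^bsub>uea B br\<^esub> = uea_cls B br 1"
  by (simp add: uea_cls_def uea_def FactRing_def)

lemma cls_zero: "\<zero>\<^bsub>uea B br\<^esub> = uea_cls B br 0"
proof -
  have "uea_cls B br 0 = I"
    using abelian_subgroup.a_rcos_const[OF abelian_subgroupI3[OF ideal.axioms(1)[OF ideal_I] ring.is_abelian_group[OF ring_free_alg]] I_0]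
    by (simp add: uea_cls_def)
  then show ?thesis by (simp add: uea_def FactRing_def)
qed

lemma carrier_uea: "carrier (uea B br) = uea_cls B br ` C"
  by (auto simp: uea_def FactRing_def A_RCOSETS_def' uea_cls_def)

lemma cls_carrier: "x \<in> C \<Longrightarrow> uea_cls B br x \<in> carrier (uea B br)"
  by (simp add: carrier_uea)

lemma abelian_monoid_uea: "abelian_monoid (uea B br)"
proof (rule abelian_monoidI)
  fix x y z assume "x \<in> carrier (uea B br)" "y \<in> carrier (uea B br)" "z \<in> carrier (uea B br)"
  then obtain a b c where "x = uea_cls B br a" "y = uea_cls B br b" "z = uea_cls B br c" "a \<in> C" "b \<in> C" "c \<in> C"
    by (auto simp: carrier_uea)
  then show "x \<oplus>\<^bsub>uea B br\<^esub> y \<oplus>\<^bsub>uea B br\<^esub> z = x \<oplus>\<^bsub>uea B br\<^esub> (y \<oplus>\<^bsub>uea B br\<^esub> z)"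
    by (simp add: cls_add C_add add.assoc)
next
  fix x y assume "x \<in> carrier (uea B br)" "y \<in> carrier (uea B br)"
  then obtain a b where xy: "x = uea_cls B br a" "y = uea_cls B br b" "a \<in> C" "b \<in> C"
    by (auto simp: carrier_uea)
  then show "x \<oplus>\<^bsub>uea B br\<^esub> y = y \<oplus>\<^bsub>uea B br\<^esub> x"
    by (simp add: cls_add add.commute)
  show "x \<oplus>\<^bsub>uea B br\<^esub> y \<in> carrier (uea B br)"
    using xy by (simp add: cls_add cls_carrier C_add)
next
  fix x assume "x \<in> carrier (uea B br)"
  then obtain a where "x = uea_cls B br a" "a \<in> C" by (auto simp: carrier_uea)
  then show "\<zero>\<^bsub>uea B br\<^esub> \<oplus>\<^bsub>uea B br\<^esub> x = x"
    by (simp add: cls_add cls_zero)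
qed (simp add: cls_zero cls_carrier)

lemma finsum_cls:
  assumes "finite A" "\<And>a. a \<in> A \<Longrightarrow> f a \<in> C"
  shows "(\<Oplus>\<^bsub>uea B br\<^esub>a\<in>A. uea_cls B br (f a)) = uea_cls B br (sum f A)"
proof -
  interpret U: abelian_monoid "uea B br" by (rule abelian_monoid_uea)
  show ?thesis using assms
    by (induction A rule: finite_induct) (auto simp: cls_zero cls_add C_sum cls_carrier Pi_def)
qed

end

text \<open>Representatives of the coefficients of \<open>\<Sum>\<^sub>\<alpha> E\<^sub>\<alpha> (u\<^sub>\<alpha> + c)\<^sup>-\<^sup>1\<close>.\<close>

definition Sser :: "nat \<Rightarrow> complex \<Rightarrow> nat list \<Rightarrow> nat \<Rightarrow> nat \<Rightarrow> gl_index free"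
  where "Sser L c w i j = (\<Sum>\<alpha>\<in>{1..L}. fscal (inv_shift_coeff c \<alpha> w) * E_gen i j \<alpha>)"

lemma Sser_Nil [simp]: "Sser L c [] i j = 0"
  by (simp add: Sser_def inv_shift_coeff_def fscal_simps)

lemma Sser_single: "\<alpha> \<in> {1..L} \<Longrightarrow> Sser L c [\<alpha>] i j = E_gen i j \<alpha>"
proof -
  assume "\<alpha> \<in> {1..L}"
  moreover have "Sser L c [\<alpha>] i j = (\<Sum>\<beta>\<in>{1..L}. if \<beta> = \<alpha> then E_gen i j \<alpha> else 0)"
    unfolding Sser_def by (intro sum.cong) (auto simp: inv_shift_coeff_def fscal_simps)
  ultimately show ?thesis by simp
qed

lemma Sser_Cons:
  assumes "w \<noteq> []"
  shows "Sser L c (\<alpha> # w) i j = (if hd w = \<alpha> then - (fscal c * Sser L c w i j) else 0)"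
proof -
  obtain \<beta> v where w: "w = \<beta> # v" using assms by (cases w) auto
  have "inv_shift_coeff c \<gamma> (\<alpha> # w) = (if hd w = \<alpha> then - c * inv_shift_coeff c \<gamma> w else 0)" for \<gamma>
  proof -
    obtain P where P: "P \<longleftrightarrow> v = replicate (length v) \<gamma>" by blast
    show ?thesis
      unfolding w inv_shift_coeff_def length_Cons replicate_Suc list.inject P[symmetric] by auto
  qed
  note coeff = this
  show ?thesis
  proof (cases "hd w = \<alpha>")
    case True
    have "fscal (inv_shift_coeff c \<gamma> (\<alpha> # w)) * E_gen i j \<gamma>
        = - fscal c * (fscal (inv_shift_coeff c \<gamma> w) * E_gen i j \<gamma>)" for \<gamma>
      unfolding coeff if_P[OF True] fscal_simps(2) fscal_simps(5) by (rule mult.assoc)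
    then show ?thesis
      unfolding Sser_def using True by (simp only: sum_distrib_left[symmetric]) simp
  next
    case False
    then show ?thesis
      unfolding Sser_def coeff by (simp add: fscal_simps(4))
  qed
qed

lemma tfree_Nil [simp]: "tfree N c [] i j = (if i = j then 1 else 0)"
  by (simp add: tfree_def)

lemma tfree_Cons: "tfree N c (\<alpha> # w) i j = (\<Sum>a\<in>{1..N}. E_gen i a \<alpha> * tfree N c w a j)
    - (if w \<noteq> [] \<and> hd w = \<alpha> then fscal c * tfree N c w i j else 0)"
  by (simp add: tfree_def tw.simps)

text \<open>
  With \<open>T\<close> the series of the \<open>tfree N c\<close>, this is the equation \<open>T = 1 + S T\<close>.  Each word of \<open>S\<close> is a power
  of one letter; prolonging it by one letter multiplies it by \<open>- c\<close>, which accounts for the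
  correction term in the recursion of \<open>tw\<close>.
\<close>

lemma tfree_left_recursion:
  assumes "w \<noteq> []" "set w \<subseteq> {1..L}"
  shows "tfree N c w i j = (\<Sum>n<length w. \<Sum>a\<in>{1..N}. Sser L c (take (Suc n) w) i a * tfree N c (drop (Suc n) w) a j)"
  using assms
proof (induction w)
  case (Cons \<alpha> v)
  let ?A = "\<lambda>w. \<Sum>n<length w. \<Sum>a\<in>{1..N}. Sser L c (take (Suc n) w) i a * tfree N c (drop (Suc n) w) a j"
  have "(\<Sum>n<length v. \<Sum>a\<in>{1..N}. Sser L c (\<alpha> # take (Suc n) v) i a * tfree N c (drop (Suc n) v) a j)
      = (if v \<noteq> [] \<and> hd v = \<alpha> then - (fscal c * ?A v) else 0)"
  proof (cases "v \<noteq> [] \<and> hd v = \<alpha>")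
    case True
    then have "Sser L c (\<alpha> # take (Suc n) v) i a = - fscal c * Sser L c (take (Suc n) v) i a" for n a
      by (simp add: Sser_Cons)
    then show ?thesis
      using True by (simp only: mult.assoc sum_distrib_left[symmetric]) simp
  next
    case False
    then have "Sser L c (\<alpha> # take (Suc n) v) i a = 0" if "n < length v" for n a
      using that by (cases v) (simp_all add: Sser_Cons)
    then show ?thesis using False by auto
  qed
  also have "\<dots> = (if v \<noteq> [] \<and> hd v = \<alpha> then - (fscal c * tfree N c v i j) else 0)"
    using Cons.IH Cons.prems by simp
  finally show ?case
    using Cons.prems unfolding tfree_Cons length_Cons sum.lessThan_Suc_shift
    by (simp add: Sser_single)
qed simp

text \<open>
  The equation \<open>T = 1 + T S\<close>.  Since \<open>tw\<close> is recursive in the first letter, the proof splits off that letter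
  once more; the correction terms for the cuts after the first
  letter add up to \<open>c\<close> times the induction hypothesis without its first summand, and that summand is
  supplied by the cut at the very beginning.
\<close>

lemma tfree_right_recursion:
  assumes "w \<noteq> []" "set w \<subseteq> {1..L}" "i \<in> {1..N}" "j \<in> {1..N}"
  shows "tfree N c w i j = (\<Sum>n<length w. \<Sum>a\<in>{1..N}. tfree N c (take n w) i a * Sser L c (drop n w) a j)"
  using assms(1-3)
proof (induction w arbitrary: i)
  case (Cons \<alpha> v)
  let ?T = "\<lambda>v n i. \<Sum>a\<in>{1..N}. tfree N c (take n v) i a * Sser L c (drop n v) a j"
  have T0: "?T v 0 i = Sser L c v i j" if "i \<in> {1..N}" for v i
    using sum_delta_mult(1)[of "{1..N}" i "\<lambda>a. Sser L c v a j"] that by simp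
  show ?case
  proof (cases v)
    case Nil
    then show ?thesis
      using Cons.prems assms(4) T0[OF Cons.prems(3), of "[\<alpha>]"]
      by (simp add: Sser_single tfree_def tw_single del: tw.simps)
  next
    case (Cons \<beta> z)
    have v: "v \<noteq> []" "set v \<subseteq> {1..L}" using Cons Cons.prems \<open>set (\<alpha> # v) \<subseteq> _\<close> by auto
    have IH: "tfree N c v b j = (\<Sum>n<length v. ?T v n b)" if "b \<in> {1..N}" for b
      using Cons.IH[OF v that] .
    let ?X = "\<lambda>n. if n \<noteq> 0 \<and> hd v = \<alpha> then fscal c * ?T v n i else 0"
    have step: "?T (\<alpha> # v) (Suc n) i = (\<Sum>b\<in>{1..N}. E_gen i b \<alpha> * ?T v n b) - ?X n" for n
    proof -
      have "?T (\<alpha> # v) (Suc n) i = (\<Sum>a\<in>{1..N}. \<Sum>b\<in>{1..N}. E_gen i b \<alpha> * (tfree N c (take n v) b a * Sser L c (drop n v) a j)) - ?X n"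
      proof -
        have "tfree N c (\<alpha> # take n v) i a = (\<Sum>b\<in>{1..N}. E_gen i b \<alpha> * tfree N c (take n v) b a)
            - (if n \<noteq> 0 \<and> hd v = \<alpha> then fscal c * tfree N c (take n v) i a else 0)" for a
          using v(1) by (auto simp: tfree_Cons)
        then show ?thesis
          by (cases "n \<noteq> 0 \<and> hd v = \<alpha>")
            (auto simp: sum_distrib_right sum_distrib_left left_diff_distrib sum_subtractf mult.assoc)
      qed
      also have "(\<Sum>a\<in>{1..N}. \<Sum>b\<in>{1..N}. E_gen i b \<alpha> * (tfree N c (take n v) b a * Sser L c (drop n v) a j))
        = (\<Sum>b\<in>{1..N}. E_gen i b \<alpha> * ?T v n b)"
        by (subst sum.swap) (simp add: sum_distrib_left)
      finally show ?thesis .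
    qed
    have "(\<Sum>n<length (\<alpha> # v). ?T (\<alpha> # v) n i) = ?T (\<alpha> # v) 0 i + (\<Sum>n<length v. ?T (\<alpha> # v) (Suc n) i)"
      by (simp only: length_Cons sum.lessThan_Suc_shift)
    also have "?T (\<alpha> # v) 0 i = (if hd v = \<alpha> then - (fscal c * Sser L c v i j) else 0)"
      using T0[OF \<open>i \<in> _\<close>] by (simp only: Sser_Cons[OF v(1)])
    also have "(\<Sum>n<length v. ?T (\<alpha> # v) (Suc n) i)
        = (\<Sum>b\<in>{1..N}. E_gen i b \<alpha> * tfree N c v b j) - (\<Sum>n<length v. ?X n)"
    proof -
      have "(\<Sum>n<length v. \<Sum>b\<in>{1..N}. E_gen i b \<alpha> * ?T v n b) = (\<Sum>b\<in>{1..N}. \<Sum>n<length v. E_gen i b \<alpha> * ?T v n b)"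
        by (rule sum.swap)
      also have "\<dots> = (\<Sum>b\<in>{1..N}. E_gen i b \<alpha> * tfree N c v b j)"
        by (intro sum.cong refl) (simp only: IH sum_distrib_left)
      finally show ?thesis by (simp only: step sum_subtractf)
    qed
    also have "(\<Sum>n<length v. ?X n) = (if hd v = \<alpha> then fscal c * tfree N c v i j - fscal c * Sser L c v i j else 0)"
    proof (cases "hd v = \<alpha>")
      case True
      have len: "length v = Suc (length z)" using Cons by simp
      have "fscal c * tfree N c v i j = fscal c * ?T v 0 i + (\<Sum>n<length z. fscal c * ?T v (Suc n) i)"
        unfolding IH[OF \<open>i \<in> _\<close>] len sum.lessThan_Suc_shift by (simp only: distrib_left sum_distrib_left)
      then have "fscal c * tfree N c v i j - fscal c * Sser L c v i j = (\<Sum>n<length z. fscal c * ?T v (Suc n) i)"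
        unfolding T0[OF \<open>i \<in> _\<close>] by simp
      moreover have "(\<Sum>n<length v. ?X n) = (\<Sum>n<length z. fscal c * ?T v (Suc n) i)"
        unfolding len sum.lessThan_Suc_shift using True by simp
      ultimately show ?thesis using True by simp
    qed simp
    finally show ?thesis using v(1) by (simp add: tfree_Cons)
  qed
qed simp


declare atLeastAtMost_iff [simp del] in_lists_conv_set [simp del]

abbreviation "gl_C N L \<equiv> carrier (free_alg (gl_basis N L))"
abbreviation "gl_I N L \<equiv> uea_ideal (gl_basis N L) gl_bracket"

lemmas Ugl_mult = gl.cls_mult[where N = N and L = L for N L, folded Ugl_def ugl_cls_def]
lemmas Ugl_add = gl.cls_add[where N = N and L = L for N L, folded Ugl_def ugl_cls_def]
lemmas Ugl_smult = gl.cls_smult[where N = N and L = L for N L, folded Ugl_def ugl_cls_def]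
lemmas Ugl_one = gl.cls_one[where N = N and L = L for N L, folded Ugl_def ugl_cls_def]
lemmas Ugl_zero = gl.cls_zero[where N = N and L = L for N L, folded Ugl_def ugl_cls_def]
lemmas Ugl_carrier = gl.carrier_uea[where N = N and L = L for N L, folded Ugl_def ugl_cls_def]
lemmas Ugl_abelian_monoid = gl.abelian_monoid_uea[where N = N and L = L for N L, folded Ugl_def]
lemmas Ugl_finsum = gl.finsum_cls[where N = N and L = L for N L, folded Ugl_def ugl_cls_def]
lemmas ugl_cls_eqI = gl.cls_eqI[where N = N and L = L for N L, folded ugl_cls_def]
lemmas ugl_cls_eqD = gl.cls_eqD[where N = N and L = L for N L, folded ugl_cls_def]

type_synonym free_series = "nat list \<Rightarrow> nat \<Rightarrow> nat \<Rightarrow> gl_index free"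

text \<open>
  Matrix series over the quotient algebra are handled through series of representatives; every
  element of the carrier arises in this way (\<open>carrier_lift\<close>).
\<close>

definition lift_series :: "nat \<Rightarrow> nat \<Rightarrow> free_series \<Rightarrow> nat list \<Rightarrow> nat \<Rightarrow> nat \<Rightarrow> ugl_elt"
  where "lift_series N L F = (\<lambda>w\<in>lists {1..L}. \<lambda>i\<in>{1..N}. \<lambda>j\<in>{1..N}. ugl_cls N L (F w i j))"

definition series_in_C :: "nat \<Rightarrow> nat \<Rightarrow> free_series \<Rightarrow> bool"
  where "series_in_C N L F \<longleftrightarrow> (\<forall>w\<in>lists {1..L}. \<forall>i\<in>{1..N}. \<forall>j\<in>{1..N}. F w i j \<in> gl_C N L)"

definition conv :: "nat \<Rightarrow> free_series \<Rightarrow> free_series \<Rightarrow> free_series"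
  where "conv N F G w i j = (\<Sum>n\<in>{0..length w}. \<Sum>a\<in>{1..N}. F (take n w) i a * G (drop n w) a j)"

definition one_series :: free_series
  where "one_series w i j = (if w = [] \<and> i = j then 1 else 0)"

lemma series_in_CD:
  "series_in_C N L F \<Longrightarrow> w \<in> lists {1..L} \<Longrightarrow> i \<in> {1..N} \<Longrightarrow> j \<in> {1..N} \<Longrightarrow> F w i j \<in> gl_C N L"
  by (simp add: series_in_C_def)

lemma series_in_C_simps:
  "series_in_C N L F \<Longrightarrow> series_in_C N L G \<Longrightarrow> series_in_C N L (\<lambda>w i j. F w i j + G w i j)"
  "series_in_C N L F \<Longrightarrow> series_in_C N L G \<Longrightarrow> series_in_C N L (\<lambda>w i j. F w i j - G w i j)"
  "series_in_C N L F \<Longrightarrow> series_in_C N L (\<lambda>w i j. - F w i j)"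
  "series_in_C N L (\<lambda>w i j. 0)"
  by (simp_all add: series_in_C_def gl.C_add gl.C_diff gl.C_uminus)

lemma lift_apply:
  "w \<in> lists {1..L} \<Longrightarrow> i \<in> {1..N} \<Longrightarrow> j \<in> {1..N} \<Longrightarrow> lift_series N L F w i j = ugl_cls N L (F w i j)"
  by (simp add: lift_series_def)

lemma lift_eqI:
  assumes "\<And>w i j. w \<in> lists {1..L} \<Longrightarrow> i \<in> {1..N} \<Longrightarrow> j \<in> {1..N} \<Longrightarrow> ugl_cls N L (F w i j) = ugl_cls N L (G w i j)"
  shows "lift_series N L F = lift_series N L G"
  unfolding lift_series_def using assms by (intro restrict_ext) auto

lemma lift_carrier: "series_in_C N L F \<Longrightarrow> lift_series N L F \<in> carrier (mat_series (Ugl N L) N L)"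
  by (auto simp: mat_series_def Let_def lift_series_def series_in_C_def Ugl_carrier)

lemma carrier_lift:
  assumes "f \<in> carrier (mat_series (Ugl N L) N L)"
  obtains F where "series_in_C N L F" "f = lift_series N L F"
proof -
  have f: "f \<in> lists {1..L} \<rightarrow>\<^sub>E ({1..N} \<rightarrow>\<^sub>E ({1..N} \<rightarrow>\<^sub>E carrier (Ugl N L)))"
    using assms by (simp add: mat_series_def Let_def)
  have "\<exists>x. x \<in> gl_C N L \<and> f w i j = ugl_cls N L x" if "w \<in> lists {1..L}" "i \<in> {1..N}" "j \<in> {1..N}" for w i j
  proof -
    have "f w i j \<in> carrier (Ugl N L)"
      using PiE_mem[OF PiE_mem[OF PiE_mem[OF f that(1)] that(2)] that(3)] .
    then show ?thesis by (auto simp: Ugl_carrier)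
  qed
  then obtain F where F: "\<And>w i j. w \<in> lists {1..L} \<Longrightarrow> i \<in> {1..N} \<Longrightarrow> j \<in> {1..N} \<Longrightarrow>
      F w i j \<in> gl_C N L \<and> f w i j = ugl_cls N L (F w i j)"
    by metis
  have "f = lift_series N L F"
  proof (rule PiE_ext[OF f])
    show "lift_series N L F \<in> lists {1..L} \<rightarrow>\<^sub>E ({1..N} \<rightarrow>\<^sub>E ({1..N} \<rightarrow>\<^sub>E carrier (Ugl N L)))"
      using F by (auto simp: lift_series_def Ugl_carrier)
    fix w assume w: "w \<in> lists {1..L}"
    show "f w = lift_series N L F w"
    proof (rule PiE_ext[OF PiE_mem[OF f w]])
      show "lift_series N L F w \<in> {1..N} \<rightarrow>\<^sub>E ({1..N} \<rightarrow>\<^sub>E carrier (Ugl N L))"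
        using F w by (auto simp: lift_series_def Ugl_carrier)
      fix i assume i: "i \<in> {1..N}"
      show "f w i = lift_series N L F w i"
      proof (rule PiE_ext[OF PiE_mem[OF PiE_mem[OF f w] i]])
        show "lift_series N L F w i \<in> {1..N} \<rightarrow>\<^sub>E carrier (Ugl N L)"
          using F w i by (auto simp: lift_series_def Ugl_carrier)
      qed (use F w i in \<open>simp add: lift_apply\<close>)
    qed
  qed
  moreover have "series_in_C N L F" using F by (simp add: series_in_C_def)
  ultimately show ?thesis by (rule that[rotated])
qed

lemma lift_one: "\<one>\<^bsub>mat_series (Ugl N L) N L\<^esub> = lift_series N L one_series"
  by (auto simp: mat_series_def Let_def lift_series_def one_series_def Ugl_one Ugl_zero intro!: restrict_ext)

lemma lift_zero: "\<zero>\<^bsub>mat_series (Ugl N L) N L\<^esub> = lift_series N L (\<lambda>w i j. 0)"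
  by (simp add: mat_series_def Let_def lift_series_def Ugl_zero)

lemma lift_add:
  assumes "series_in_C N L F" "series_in_C N L G"
  shows "lift_series N L F \<oplus>\<^bsub>mat_series (Ugl N L) N L\<^esub> lift_series N L G = lift_series N L (\<lambda>w i j. F w i j + G w i j)"
proof -
  have "lift_series N L F w i j \<oplus>\<^bsub>Ugl N L\<^esub> lift_series N L G w i j = ugl_cls N L (F w i j + G w i j)"
    if "w \<in> lists {1..L}" "i \<in> {1..N}" "j \<in> {1..N}" for w i j
    unfolding lift_apply[OF that] using assms[THEN series_in_CD, OF that] by (rule Ugl_add)
  then show ?thesis
    unfolding lift_series_def[of N L "\<lambda>w i j. F w i j + G w i j"]
    by (subst mat_series_def) (auto simp: Let_def intro!: restrict_ext)
qed

lemma series_in_C_conv: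
  assumes "series_in_C N L F" "series_in_C N L G"
  shows "series_in_C N L (conv N F G)"
  unfolding series_in_C_def conv_def
proof (intro ballI gl.C_sum gl.C_mult)
  fix w i j n a assume "w \<in> lists {1..L}" and ix: "i \<in> {1..N}" "j \<in> {1..N}" "a \<in> {1..N}"
  then have "take n w \<in> lists {1..L}" "drop n w \<in> lists {1..L}"
    by (auto simp: in_lists_conv_set dest: in_set_takeD in_set_dropD)
  then show "F (take n w) i a \<in> gl_C N L" "G (drop n w) a j \<in> gl_C N L"
    using assms ix by (auto simp: series_in_C_def)
qed

lemma lift_mult:
  assumes F: "series_in_C N L F" and G: "series_in_C N L G"
  shows "lift_series N L F \<otimes>\<^bsub>mat_series (Ugl N L) N L\<^esub> lift_series N L G = lift_series N L (conv N F G)"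
proof -
  interpret U: abelian_monoid "Ugl N L" by (rule Ugl_abelian_monoid)
  have "(\<Oplus>\<^bsub>Ugl N L\<^esub>n\<in>{0..length w}. \<Oplus>\<^bsub>Ugl N L\<^esub>a\<in>{1..N}.
        lift_series N L F (take n w) i a \<otimes>\<^bsub>Ugl N L\<^esub> lift_series N L G (drop n w) a j)
      = ugl_cls N L (conv N F G w i j)"
    if w: "w \<in> lists {1..L}" and ij: "i \<in> {1..N}" "j \<in> {1..N}" for w i j
  proof -
    let ?g = "\<lambda>n a. F (take n w) i a * G (drop n w) a j"
    have td: "take n w \<in> lists {1..L}" "drop n w \<in> lists {1..L}" for n
      using w by (auto simp: in_lists_conv_set dest: in_set_takeD in_set_dropD)
    have gC: "?g n a \<in> gl_C N L" if "a \<in> {1..N}" for n a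
      using series_in_CD[OF F td(1) ij(1) that] series_in_CD[OF G td(2) that ij(2)] by (rule gl.C_mult)
    have "(\<Oplus>\<^bsub>Ugl N L\<^esub>a\<in>{1..N}. lift_series N L F (take n w) i a \<otimes>\<^bsub>Ugl N L\<^esub> lift_series N L G (drop n w) a j)
        = ugl_cls N L (\<Sum>a\<in>{1..N}. ?g n a)" for n
    proof -
      have "(\<Oplus>\<^bsub>Ugl N L\<^esub>a\<in>{1..N}. lift_series N L F (take n w) i a \<otimes>\<^bsub>Ugl N L\<^esub> lift_series N L G (drop n w) a j)
          = (\<Oplus>\<^bsub>Ugl N L\<^esub>a\<in>{1..N}. ugl_cls N L (?g n a))"
      proof (rule U.finsum_cong'[OF refl])
        show "(\<lambda>a. ugl_cls N L (?g n a)) \<in> {1..N} \<rightarrow> carrier (Ugl N L)"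
          using gC by (auto simp: Ugl_carrier)
        fix a assume a: "a \<in> {1..N}"
        show "lift_series N L F (take n w) i a \<otimes>\<^bsub>Ugl N L\<^esub> lift_series N L G (drop n w) a j = ugl_cls N L (?g n a)"
          unfolding lift_apply[OF td(1) ij(1) a] lift_apply[OF td(2) a ij(2)]
          using series_in_CD[OF F td(1) ij(1) a] series_in_CD[OF G td(2) a ij(2)] by (rule Ugl_mult)
      qed
      also have "\<dots> = ugl_cls N L (\<Sum>a\<in>{1..N}. ?g n a)"
        by (rule Ugl_finsum) (use gC in auto)
      finally show ?thesis .
    qed
    then have "(\<Oplus>\<^bsub>Ugl N L\<^esub>n\<in>{0..length w}. \<Oplus>\<^bsub>Ugl N L\<^esub>a\<in>{1..N}.
        lift_series N L F (take n w) i a \<otimes>\<^bsub>Ugl N L\<^esub> lift_series N L G (drop n w) a j)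
      = (\<Oplus>\<^bsub>Ugl N L\<^esub>n\<in>{0..length w}. ugl_cls N L (\<Sum>a\<in>{1..N}. ?g n a))" by simp
    also have "\<dots> = ugl_cls N L (conv N F G w i j)"
      unfolding conv_def by (rule Ugl_finsum) (use gC in \<open>auto intro!: gl.C_sum\<close>)
    finally show ?thesis .
  qed
  then show ?thesis
    unfolding lift_series_def[of N L "conv N F G"]
    by (subst mat_series_def) (auto simp: Let_def intro!: restrict_ext)
qed

lemma abelian_group_mat_series: "abelian_group (mat_series (Ugl N L) N L)"
proof (rule abelian_groupI)
  let ?M = "mat_series (Ugl N L) N L"
  fix x y z assume "x \<in> carrier ?M" "y \<in> carrier ?M" "z \<in> carrier ?M"
  then obtain F G H where "series_in_C N L F" "series_in_C N L G" "series_in_C N L H"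
    and "x = lift_series N L F" "y = lift_series N L G" "z = lift_series N L H"
    by (metis carrier_lift)
  then show "x \<oplus>\<^bsub>?M\<^esub> y \<oplus>\<^bsub>?M\<^esub> z = x \<oplus>\<^bsub>?M\<^esub> (y \<oplus>\<^bsub>?M\<^esub> z)"
    by (simp add: lift_add series_in_C_simps add.assoc)
next
  let ?M = "mat_series (Ugl N L) N L"
  fix x y assume "x \<in> carrier ?M" "y \<in> carrier ?M"
  then obtain F G where FG: "series_in_C N L F" "series_in_C N L G" "x = lift_series N L F" "y = lift_series N L G"
    by (metis carrier_lift)
  then show "x \<oplus>\<^bsub>?M\<^esub> y = y \<oplus>\<^bsub>?M\<^esub> x"
    by (simp add: lift_add add.commute)
  show "x \<oplus>\<^bsub>?M\<^esub> y \<in> carrier ?M"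
    using FG by (simp add: lift_add series_in_C_simps lift_carrier)
next
  let ?M = "mat_series (Ugl N L) N L"
  note zero = series_in_C_simps(4)[of N L]
  show "\<zero>\<^bsub>?M\<^esub> \<in> carrier ?M"
    unfolding lift_zero by (rule lift_carrier[OF zero])
  fix x assume "x \<in> carrier ?M"
  then obtain F where F: "series_in_C N L F" "x = lift_series N L F"
    by (metis carrier_lift)
  then show "\<zero>\<^bsub>?M\<^esub> \<oplus>\<^bsub>?M\<^esub> x = x"
    by (simp add: lift_zero lift_add zero)
  have neg: "series_in_C N L (\<lambda>w i j. - F w i j)" using F by (simp add: series_in_C_simps)
  show "\<exists>y\<in>carrier ?M. y \<oplus>\<^bsub>?M\<^esub> x = \<zero>\<^bsub>?M\<^esub>"
    by (rule bexI[OF _ lift_carrier[OF neg]]) (simp add: F lift_add neg lift_zero)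
qed

lemma series_in_C_Sser: "series_in_C N L (Sser L c)"
  unfolding series_in_C_def Sser_def
  by (intro ballI gl.C_sum gl.C_mult gl.C_fgen gl.C_fscal) (simp add: gl_basis_def)

lemma series_in_C_tfree: "series_in_C N L (tfree N c)"
  unfolding series_in_C_def by (auto intro!: tfree_C)

lemma series_in_C_one: "series_in_C N L one_series"
  by (auto simp: series_in_C_def one_series_def)

lemma E_series_lift: "E_series N L s = lift_series N L (Sser L (of_nat N + s))"
  unfolding E_series_def lift_series_def
proof (intro restrict_ext)
  fix w i j assume ij: "i \<in> {1..N}" "j \<in> {1..N}"
  let ?c = "\<lambda>\<alpha>. inv_shift_coeff (of_nat N + s) \<alpha> w"
  interpret U: abelian_monoid "Ugl N L" by (rule Ugl_abelian_monoid)
  have E: "E_gen i j \<alpha> \<in> gl_C N L" if "\<alpha> \<in> {1..L}" for \<alpha>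
    using ij that by (intro gl.C_fgen) (simp add: gl_basis_def)
  have "(\<Oplus>\<^bsub>Ugl N L\<^esub>\<alpha>\<in>{1..L}. ?c \<alpha> \<odot>\<^bsub>Ugl N L\<^esub> Egl N L i j \<alpha>)
      = (\<Oplus>\<^bsub>Ugl N L\<^esub>\<alpha>\<in>{1..L}. ugl_cls N L (fscal (?c \<alpha>) * E_gen i j \<alpha>))"
  proof (rule U.finsum_cong'[OF refl])
    show "(\<lambda>\<alpha>. ugl_cls N L (fscal (?c \<alpha>) * E_gen i j \<alpha>)) \<in> {1..L} \<rightarrow> carrier (Ugl N L)"
      using E by (auto simp: Ugl_carrier)
  qed (use E in \<open>auto simp: Egl_def Ugl_smult\<close>)
  also have "\<dots> = ugl_cls N L (Sser L (of_nat N + s) w i j)"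
    unfolding Sser_def by (rule Ugl_finsum) (use E in auto)
  finally show "(\<Oplus>\<^bsub>Ugl N L\<^esub>\<alpha>\<in>{1..L}. ?c \<alpha> \<odot>\<^bsub>Ugl N L\<^esub> Egl N L i j \<alpha>) = \<dots>" .
qed

abbreviation one_minus_S :: "nat \<Rightarrow> complex \<Rightarrow> free_series"
  where "one_minus_S L c \<equiv> (\<lambda>w i j. one_series w i j - Sser L c w i j)"

lemma series_in_C_one_minus_S: "series_in_C N L (one_minus_S L c)"
  by (intro series_in_C_simps series_in_C_Sser series_in_C_one)

lemma denominator_lift:
  "\<one>\<^bsub>mat_series (Ugl N L) N L\<^esub> \<ominus>\<^bsub>mat_series (Ugl N L) N L\<^esub> E_series N L s
    = lift_series N L (one_minus_S L (of_nat N + s))"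
proof -
  let ?M = "mat_series (Ugl N L) N L"
  let ?S = "Sser L (of_nat N + s)"
  interpret M: abelian_group ?M by (rule abelian_group_mat_series)
  have neg: "series_in_C N L (\<lambda>w i j. - ?S w i j)"
    by (intro series_in_C_simps series_in_C_Sser)
  have "\<ominus>\<^bsub>?M\<^esub> lift_series N L ?S = lift_series N L (\<lambda>w i j. - ?S w i j)"
    by (rule M.minus_equality) (simp_all add: lift_add lift_zero neg series_in_C_Sser lift_carrier)
  then show ?thesis
    by (simp add: a_minus_def lift_one E_series_lift lift_add series_in_C_one neg)
qed

lemma conv_one_minus_S:
  assumes "i \<in> {1..N}"
  shows "conv N (one_minus_S L c) G w i j
    = G w i j - (\<Sum>n<length w. \<Sum>a\<in>{1..N}. Sser L c (take (Suc n) w) i a * G (drop (Suc n) w) a j)"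
proof -
  have "{0..length w} = {..<Suc (length w)}" by (auto simp: atLeastAtMost_iff)
  then have "conv N (one_minus_S L c) G w i j = (\<Sum>a\<in>{1..N}. one_minus_S L c [] i a * G w a j)
      + (\<Sum>n<length w. \<Sum>a\<in>{1..N}. one_minus_S L c (take (Suc n) w) i a * G (drop (Suc n) w) a j)"
    unfolding conv_def by (simp only: sum.lessThan_Suc_shift take_0 drop_0)
  also have "(\<Sum>a\<in>{1..N}. one_minus_S L c [] i a * G w a j) = G w i j"
    using sum_delta_mult(1)[of "{1..N}" i "\<lambda>a. G w a j"] assms by (simp add: one_series_def)
  also have "(\<Sum>n<length w. \<Sum>a\<in>{1..N}. one_minus_S L c (take (Suc n) w) i a * G (drop (Suc n) w) a j)
      = - (\<Sum>n<length w. \<Sum>a\<in>{1..N}. Sser L c (take (Suc n) w) i a * G (drop (Suc n) w) a j)"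
    unfolding sum_negf[symmetric] by (intro sum.cong refl) (auto simp: one_series_def)
  finally show ?thesis by simp
qed

lemma tfree_right_inverse:
  assumes "w \<in> lists {1..L}" "i \<in> {1..N}"
  shows "conv N (one_minus_S L c) (tfree N c) w i j = one_series w i j"
proof (cases "w = []")
  case False
  then show ?thesis
    using tfree_left_recursion[of w L N c i j] assms conv_one_minus_S[OF assms(2), of L c "tfree N c" w j]
    by (auto simp: one_series_def in_lists_conv_set)
next
  case True
  then show ?thesis
    using conv_one_minus_S[OF assms(2), of L c "tfree N c" w j] by (simp add: one_series_def)
qed

lemma tfree_left_inverse:
  assumes "w \<in> lists {1..L}" "i \<in> {1..N}" "j \<in> {1..N}"
  shows "conv N (tfree N c) (one_minus_S L c) w i j = one_series w i j"
proof -
  have "{0..length w} = {..<Suc (length w)}" by (auto simp: atLeastAtMost_iff)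
  then have "conv N (tfree N c) (one_minus_S L c) w i j
      = (\<Sum>n<length w. \<Sum>a\<in>{1..N}. tfree N c (take n w) i a * one_minus_S L c (drop n w) a j)
      + (\<Sum>a\<in>{1..N}. tfree N c w i a * one_minus_S L c [] a j)"
    unfolding conv_def by simp
  also have "(\<Sum>a\<in>{1..N}. tfree N c w i a * one_minus_S L c [] a j) = tfree N c w i j"
    using sum_delta_mult(2)[of "{1..N}" j "\<lambda>a. tfree N c w i a"] assms by (simp add: one_series_def)
  also have "(\<Sum>n<length w. \<Sum>a\<in>{1..N}. tfree N c (take n w) i a * one_minus_S L c (drop n w) a j)
      = - (\<Sum>n<length w. \<Sum>a\<in>{1..N}. tfree N c (take n w) i a * Sser L c (drop n w) a j)"
    unfolding sum_negf[symmetric] by (intro sum.cong refl) (auto simp: one_series_def)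
  finally show ?thesis
    using tfree_right_recursion[of w L i N j c] assms
    by (cases "w = []") (auto simp: one_series_def in_lists_conv_set)
qed

text \<open>
  \<open>1 - S\<close> has constant coefficient \<open>1\<close>, so the equation \<open>(1 - S) F = 1\<close> determines the coefficient of a
  word by those of its proper suffixes.  This is the uniqueness that a definite description of the
  inverse asks for.
\<close>

lemma right_inverse_unique:
  assumes F: "series_in_C N L F"
    and inv: "lift_series N L (conv N (one_minus_S L c) F) = lift_series N L one_series"
    and "w \<in> lists {1..L}" "i \<in> {1..N}" "j \<in> {1..N}"
  shows "F w i j - tfree N c w i j \<in> gl_I N L"
  using assms(3-5)
proof (induction w arbitrary: i rule: length_induct)
  case (1 w)
  note w = 1(2)
  let ?D = "\<lambda>w i j. F w i j - tfree N c w i j"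
  have "ugl_cls N L (conv N (one_minus_S L c) F w i j) = ugl_cls N L (one_series w i j)"
    using fun_cong[OF fun_cong[OF fun_cong[OF inv, of w], of i], of j] 1 by (simp add: lift_apply)
  then have "conv N (one_minus_S L c) F w i j - one_series w i j \<in> gl_I N L"
    by (rule ugl_cls_eqD[rotated 2])
      (use 1 series_in_CD[OF series_in_C_conv[OF series_in_C_one_minus_S F]] series_in_CD[OF series_in_C_one] in blast)+
  then have "?D w i j - (\<Sum>n<length w. \<Sum>a\<in>{1..N}. Sser L c (take (Suc n) w) i a * ?D (drop (Suc n) w) a j) \<in> gl_I N L"
    unfolding tfree_right_inverse[OF 1(2,3), of c j, symmetric] conv_one_minus_S[OF 1(3)]
    by (simp add: right_diff_distrib sum_subtractf algebra_simps)
  moreover have "(\<Sum>n<length w. \<Sum>a\<in>{1..N}. Sser L c (take (Suc n) w) i a * ?D (drop (Suc n) w) a j) \<in> gl_I N L"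
  proof -
    have sumI: "(\<And>a. a \<in> A \<Longrightarrow> f a \<in> gl_I N L) \<Longrightarrow> sum f A \<in> gl_I N L" for A :: "nat set" and f
      by (induction A rule: infinite_finite_induct) (auto intro: gl.I_add gl.I_0)
    show ?thesis
    proof (intro sumI gl.I_mult_left)
      fix n a assume n: "n \<in> {..<length w}" and a: "a \<in> {1..N}"
      have td: "take (Suc n) w \<in> lists {1..L}" "drop (Suc n) w \<in> lists {1..L}"
        using w by (auto simp: in_lists_conv_set dest: in_set_takeD in_set_dropD)
      show "Sser L c (take (Suc n) w) i a \<in> gl_C N L"
        by (rule series_in_CD[OF series_in_C_Sser td(1) 1(3) a])
      show "?D (drop (Suc n) w) a j \<in> gl_I N L"
        using 1(1) td(2) a 1(4) n by auto
    qed
  qed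
  ultimately show ?case
    using gl.I_add by fastforce
qed

lemma t_fin_eq:
  assumes "w \<in> lists {1..L}" "i \<in> {1..N}" "j \<in> {1..N}"
  shows "t_fin N L s (i, j, w) = ugl_cls N L (tfree N (of_nat N + s) w i j)"
proof -
  let ?M = "mat_series (Ugl N L) N L"
  let ?c = "of_nat N + s"
  let ?u = "lift_series N L (one_minus_S L ?c)"
  let ?T = "lift_series N L (tfree N ?c)"
  note C = series_in_C_one_minus_S[of N L ?c] series_in_C_tfree[of N L ?c]
  have uT: "?u \<otimes>\<^bsub>?M\<^esub> ?T = \<one>\<^bsub>?M\<^esub>"
    unfolding lift_mult[OF C] lift_one by (rule lift_eqI) (simp only: tfree_right_inverse)
  have Tu: "?T \<otimes>\<^bsub>?M\<^esub> ?u = \<one>\<^bsub>?M\<^esub>"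
    unfolding lift_mult[OF C(2,1)] lift_one by (rule lift_eqI) (simp only: tfree_left_inverse)
  have "inv\<^bsub>?M\<^esub> ?u = ?T"
    unfolding m_inv_def
  proof (rule the_equality)
    show "?T \<in> carrier ?M \<and> ?u \<otimes>\<^bsub>?M\<^esub> ?T = \<one>\<^bsub>?M\<^esub> \<and> ?T \<otimes>\<^bsub>?M\<^esub> ?u = \<one>\<^bsub>?M\<^esub>"
      using uT Tu lift_carrier[OF C(2)] by blast
    fix y assume y: "y \<in> carrier ?M \<and> ?u \<otimes>\<^bsub>?M\<^esub> y = \<one>\<^bsub>?M\<^esub> \<and> y \<otimes>\<^bsub>?M\<^esub> ?u = \<one>\<^bsub>?M\<^esub>"
    then obtain F where F: "series_in_C N L F" "y = lift_series N L F" by (metis carrier_lift)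
    have inv: "lift_series N L (conv N (one_minus_S L ?c) F) = lift_series N L one_series"
      using y by (simp add: F lift_mult[OF C(1) F(1)] lift_one)
    show "y = ?T"
      unfolding F(2)
      by (intro lift_eqI ugl_cls_eqI series_in_CD[OF F(1)] series_in_CD[OF C(2)] right_inverse_unique[OF F(1) inv])
  qed
  then show ?thesis
    using assms by (simp add: Let_def denominator_lift lift_apply)
qed


section \<open>Normal ordering\<close>

definition mono_val :: "nat \<Rightarrow> complex \<Rightarrow> t_monomial \<Rightarrow> gl_index free"
  where "mono_val N c ps = foldr (*) (map (\<lambda>(i, j, w). tfree N c w i j) ps) 1"

definition comb_val :: "nat \<Rightarrow> complex \<Rightarrow> (int \<times> t_monomial) list \<Rightarrow> gl_index free"
  where "comb_val N c \<Psi> = (\<Sum>(z, ps)\<leftarrow>\<Psi>. of_int z * mono_val N c ps)"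

lemma comb_val_simps [simp]:
  "comb_val N c [] = 0"
  "comb_val N c ((z, ps) # \<Psi>) = of_int z * mono_val N c ps + comb_val N c \<Psi>"
  "comb_val N c (\<Psi> @ \<Psi>') = comb_val N c \<Psi> + comb_val N c \<Psi>'"
  by (simp_all add: comb_val_def)

definition comb_ok :: "nat \<Rightarrow> t_index rel \<Rightarrow> nat \<Rightarrow> nat \<Rightarrow> nat \<Rightarrow> nat \<Rightarrow> nat \<Rightarrow> t_monomial \<Rightarrow> bool"
  where "comb_ok L r i j k l n ps \<longleftrightarrow>
    normal_monomial L r ps \<and> monomial_degree ps \<le> n \<and> admissible_monomial L r i j k l ps"

definition normalizable :: "nat \<Rightarrow> t_index rel \<Rightarrow> nat \<Rightarrow> nat \<Rightarrow> nat \<Rightarrow> nat \<Rightarrow> nat \<Rightarrow>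
    (nat \<Rightarrow> complex \<Rightarrow> gl_index free) \<Rightarrow> bool"
  where "normalizable L r i j k l n F \<longleftrightarrow> (\<exists>\<Psi>. (\<forall>(z, ps)\<in>set \<Psi>. comb_ok L r i j k l n ps) \<and>
    (\<forall>N c. i \<le> N \<longrightarrow> j \<le> N \<longrightarrow> k \<le> N \<longrightarrow> l \<le> N \<longrightarrow> F N c - comb_val N c \<Psi> \<in> gl_I N L))"

lemma normalizableI:
  assumes "\<And>z ps. (z, ps) \<in> set \<Psi> \<Longrightarrow> comb_ok L r i j k l n ps"
    and "\<And>N c. i \<le> N \<Longrightarrow> j \<le> N \<Longrightarrow> k \<le> N \<Longrightarrow> l \<le> N \<Longrightarrow> F N c - comb_val N c \<Psi> \<in> gl_I N L"
  shows "normalizable L r i j k l n F"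
  unfolding normalizable_def using assms by (intro exI[of _ \<Psi>]) auto

lemma normalizable_0: "normalizable L r i j k l n (\<lambda>N c. 0)"
  unfolding normalizable_def by (rule exI[of _ "[]"]) (simp add: gl.I_0)

lemma normalizable_add:
  assumes "normalizable L r i j k l n F" "normalizable L r i j k l n G"
  shows "normalizable L r i j k l n (\<lambda>N c. F N c + G N c)"
proof -
  obtain \<Psi> where ok: "\<forall>(z, ps)\<in>set \<Psi>. comb_ok L r i j k l n ps"
    and F: "\<And>N c. i \<le> N \<Longrightarrow> j \<le> N \<Longrightarrow> k \<le> N \<Longrightarrow> l \<le> N \<Longrightarrow> F N c - comb_val N c \<Psi> \<in> gl_I N L"
    using assms(1) unfolding normalizable_def by metis
  obtain \<Psi>' where ok': "\<forall>(z, ps)\<in>set \<Psi>'. comb_ok L r i j k l n ps"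
    and G: "\<And>N c. i \<le> N \<Longrightarrow> j \<le> N \<Longrightarrow> k \<le> N \<Longrightarrow> l \<le> N \<Longrightarrow> G N c - comb_val N c \<Psi>' \<in> gl_I N L"
    using assms(2) unfolding normalizable_def by metis
  have "F N c + G N c - comb_val N c (\<Psi> @ \<Psi>') \<in> gl_I N L"
    if "i \<le> N" "j \<le> N" "k \<le> N" "l \<le> N" for N c
    using gl.I_add[OF F[OF that, of c] G[OF that, of c]] by (simp add: algebra_simps)
  then show ?thesis
    using ok ok' by (intro normalizableI[of "\<Psi> @ \<Psi>'"]) auto
qed

lemma normalizable_int_mult:
  assumes "normalizable L r i j k l n F"
  shows "normalizable L r i j k l n (\<lambda>N c. of_int z * F N c)"
proof -
  obtain \<Psi> where ok: "\<forall>(z, ps)\<in>set \<Psi>. comb_ok L r i j k l n ps"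
    and F: "\<And>N c. i \<le> N \<Longrightarrow> j \<le> N \<Longrightarrow> k \<le> N \<Longrightarrow> l \<le> N \<Longrightarrow> F N c - comb_val N c \<Psi> \<in> gl_I N L"
    using assms unfolding normalizable_def by metis
  let ?g = "map (\<lambda>(y, ps). (z * y, ps))"
  have g: "comb_val N c (?g \<Psi>) = of_int z * comb_val N c \<Psi>" for N c
    by (induction \<Psi>) (auto simp: distrib_left mult.assoc)
  have "of_int z * F N c - comb_val N c (?g \<Psi>) \<in> gl_I N L"
    if "i \<le> N" "j \<le> N" "k \<le> N" "l \<le> N" for N c
    using gl.I_mult_left[OF F[OF that, of c], of "of_int z"] unfolding g by (simp add: right_diff_distrib gl.C_of_int)
  then show ?thesis
    using ok by (intro normalizableI[of "?g \<Psi>"]) auto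
qed

lemma normalizable_cong_ideal:
  assumes "normalizable L r i j k l n G"
    and "\<And>N c. i \<le> N \<Longrightarrow> j \<le> N \<Longrightarrow> k \<le> N \<Longrightarrow> l \<le> N \<Longrightarrow> F N c - G N c \<in> gl_I N L"
  shows "normalizable L r i j k l n F"
proof -
  obtain \<Psi> where ok: "\<forall>(z, ps)\<in>set \<Psi>. comb_ok L r i j k l n ps"
    and G: "\<And>N c. i \<le> N \<Longrightarrow> j \<le> N \<Longrightarrow> k \<le> N \<Longrightarrow> l \<le> N \<Longrightarrow> G N c - comb_val N c \<Psi> \<in> gl_I N L"
    using assms(1) unfolding normalizable_def by metis
  have "F N c - comb_val N c \<Psi> \<in> gl_I N L" if "i \<le> N" "j \<le> N" "k \<le> N" "l \<le> N" for N c
    using gl.I_add[OF assms(2)[OF that, of c] G[OF that, of c]] by simp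
  then show ?thesis using ok by (intro normalizableI) auto
qed

lemma normalizable_mono:
  "normalizable L r i j k l n F \<Longrightarrow> n \<le> n' \<Longrightarrow> normalizable L r i j k l n' F"
  unfolding normalizable_def comb_ok_def by (elim exE conjE, intro exI conjI; fastforce)

lemma normalizable_monomial:
  assumes "comb_ok L r i j k l n ps"
  shows "normalizable L r i j k l n (\<lambda>N c. mono_val N c ps)"
  unfolding normalizable_def using assms by (intro exI[of _ "[(1, ps)]"]) (simp add: gl.I_0)

context
  fixes L :: nat and r :: "t_index rel"
  assumes r: "linear_order_on (t_indices L) r"
begin

lemma normal_pair_sym:
  assumes "p \<in> t_indices L" "q \<in> t_indices L"
  shows "normal_pair r p q = normal_pair r q p"
proof (cases "p = q")
  case False
  moreover have "antisym r" "total_on (t_indices L) r"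
    using r by (simp_all add: order_on_defs)
  ultimately have "(p, q) \<in> r \<or> (q, p) \<in> r" "\<not> ((p, q) \<in> r \<and> (q, p) \<in> r)"
    using assms False unfolding total_on_def antisym_def by blast+
  then show ?thesis by (auto simp: normal_pair_def)
qed simp

text \<open>
  Exchanging \<open>i\<close> and \<open>k\<close> permutes the admissible monomials, so a commutator of \<open>t\<^sub>k\<^sub>j\<close> and \<open>t\<^sub>i\<^sub>l\<close> contributes
  terms of the same kind as one of \<open>t\<^sub>i\<^sub>j\<close> and \<open>t\<^sub>k\<^sub>l\<close>.
\<close>

lemma admissible_swap:
  assumes "i \<ge> 1" "j \<ge> 1" "k \<ge> 1" "l \<ge> 1" "admissible_monomial L r k j i l ps"
  shows "admissible_monomial L r i j k l ps"
proof -
  have t: "(a, b, v) \<in> t_indices L" if "a \<in> {i, k}" "b \<in> {j, l}" "v \<in> words L" for a b v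
    using that assms by (auto simp: t_indices_def)
  have "normal_pair r (k, j, v) (i, l, v') = normal_pair r (i, l, v') (k, j, v)"
    "normal_pair r (k, l, v) (i, j, v') = normal_pair r (i, j, v') (k, l, v)"
    if "v \<in> words L" "v' \<in> words L" for v v'
    using that by (auto intro!: normal_pair_sym t)
  then show ?thesis
    using assms(5) unfolding admissible_monomial_def by metis
qed

lemma normalizable_swap:
  assumes "i \<ge> 1" "j \<ge> 1" "k \<ge> 1" "l \<ge> 1" "normalizable L r k j i l n F"
  shows "normalizable L r i j k l n F"
proof -
  have "comb_ok L r k j i l n ps \<Longrightarrow> comb_ok L r i j k l n ps" for ps
    using admissible_swap[OF assms(1-4)] by (simp add: comb_ok_def)
  then show ?thesis
    using assms(5) unfolding normalizable_def by (elim exE conjE, intro exI conjI) auto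
qed

lemma normal_pair_ok:
  assumes "p \<in> t_indices L" "q \<in> t_indices L"
  shows "normal_monomial L r (normal_pair r p q)"
    and "monomial_degree (normal_pair r p q) = length (snd (snd p)) + length (snd (snd q))"
proof -
  have refl: "refl_on (t_indices L) r" and total: "total_on (t_indices L) r"
    using r by (simp_all add: order_on_defs)
  have "(p, q) \<in> r \<or> (q, p) \<in> r"
  proof (cases "p = q")
    case True
    then show ?thesis using refl_onD[OF refl assms(1)] by simp
  next
    case False
    then show ?thesis using total assms unfolding total_on_def by simp
  qed
  then show "normal_monomial L r (normal_pair r p q)"
    using assms by (auto simp: normal_monomial_def normal_pair_def)
  show "monomial_degree (normal_pair r p q) = length (snd (snd p)) + length (snd (snd q))"
    by (auto simp: monomial_degree_def normal_pair_def split: prod.splits)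
qed

text \<open>
  If one of the words is empty, its entry is a Kronecker delta and the product is a single entry or
  zero.  Otherwise the two factors are already in the right order, or the commutator makes up for
  exchanging them.
\<close>

lemma normalizable_product:
  assumes ix: "i \<ge> 1" "j \<ge> 1" "k \<ge> 1" "l \<ge> 1"
    and v: "set v \<subseteq> {1..L}" "set v' \<subseteq> {1..L}" "v @ v' \<noteq> []" and n: "length v + length v' \<le> n"
    and comm: "v \<in> words L \<Longrightarrow> v' \<in> words L \<Longrightarrow>
      normalizable L r i j k l n (\<lambda>N c. comm (tfree N c v i j) (tfree N c v' k l))"
  shows "normalizable L r i j k l n (\<lambda>N c. tfree N c v i j * tfree N c v' k l)"
proof -
  have words: "u \<in> words L" if "u \<noteq> []" "set u \<subseteq> {1..L}" for u
    using that by (auto simp: words_def in_lists_conv_set)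
  have single: "normalizable L r i j k l n (\<lambda>N c. tfree N c u a b)"
    if "(a, b) = (i, j) \<or> (a, b) = (k, l)" "u \<in> words L" "length u \<le> n" for a b u
  proof -
    have "comb_ok L r i j k l n [(a, b, u)]"
      using that ix by (auto simp: comb_ok_def normal_monomial_def t_indices_def monomial_degree_def admissible_monomial_def)
    from normalizable_monomial[OF this] show ?thesis by (simp add: mono_val_def)
  qed
  consider "v = []" "v' \<in> words L" | "v' = []" "v \<in> words L" | "v \<in> words L" "v' \<in> words L"
    using v words by (cases "v = []"; cases "v' = []") auto
  then show ?thesis
  proof cases
    case 1
    then show ?thesis
      using single[of k l v'] n by (cases "i = j") (simp_all add: normalizable_0)
  next
    case 2
    then show ?thesis
      using single[of i j v] n by (cases "k = l") (simp_all add: normalizable_0)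
  next
    case 3
    let ?p = "(i, j, v)" and ?q = "(k, l, v')"
    have t: "?p \<in> t_indices L" "?q \<in> t_indices L" using 3 ix by (simp_all add: t_indices_def)
    have "comb_ok L r i j k l n (normal_pair r ?p ?q)"
      using normal_pair_ok[OF t] n 3 by (auto simp: comb_ok_def admissible_monomial_def)
    then have np: "normalizable L r i j k l n (\<lambda>N c. mono_val N c (normal_pair r ?p ?q))"
      by (rule normalizable_monomial)
    show ?thesis
    proof (cases "(?p, ?q) \<in> r")
      case True
      then show ?thesis using np by (simp add: normal_pair_def mono_val_def)
    next
      case False
      then show ?thesis
        using normalizable_add[OF np comm[OF 3]] by (simp add: normal_pair_def mono_val_def)
    qed
  qed
qed

lemma normalizable_sum_list:
  assumes "\<And>x. x \<in> set xs \<Longrightarrow> normalizable L r i j k l n (F x)"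
  shows "normalizable L r i j k l n (\<lambda>N c. \<Sum>x\<leftarrow>xs. F x N c)"
  using assms
proof (induction xs)
  case (Cons x xs)
  then show ?case
    using normalizable_add[of L r i j k l n "F x" "\<lambda>N c. \<Sum>x\<leftarrow>xs. F x N c"] by simp
qed (simp add: normalizable_0)

text \<open>
  The terms of the uniform formula are products of total length smaller than that of \<open>w\<close> and \<open>w'\<close>,
  so the commutators needed to order their factors are covered by the induction hypothesis.
\<close>

lemma normalizable_commutator:
  assumes "i \<ge> 1" "j \<ge> 1" "k \<ge> 1" "l \<ge> 1" "w \<in> words L" "w' \<in> words L"
  shows "normalizable L r i j k l (length w + length w' - 1)
    (\<lambda>N c. comm (tfree N c w i j) (tfree N c w' k l))"
  using assms
proof (induction "length w + length w'" arbitrary: w w' i j k l rule: less_induct)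
  case less
  let ?n = "length w + length w' - 1"
  have pos: "?n < length w + length w'" and sets: "set w \<union> set w' \<subseteq> {1..L}"
    using less.prems by (auto simp: words_def in_lists_conv_set)
  obtain \<Phi> where ok: "form_ok {1..L} ?n \<Phi>"
    and \<Phi>: "\<And>N c i j k l. \<lbrakk>i \<in> {1..N}; j \<in> {1..N}; k \<in> {1..N}; l \<in> {1..N}\<rbrakk> \<Longrightarrow>
      comm (tfree N c w i j) (tfree N c w' k l) - form_val (tfree N c) i j k l \<Phi> \<in> gl_I N L"
    using commutator_mod_ideal[OF sets] by blast
  have prod: "normalizable L r i j k l ?n (\<lambda>N c. tfree N c v i j * tfree N c v' k l)"
    if "v @ v' \<noteq> []" "length v + length v' \<le> ?n" "set v \<union> set v' \<subseteq> {1..L}"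
      "i \<ge> 1" "j \<ge> 1" "k \<ge> 1" "l \<ge> 1" for v v' i j k l
  proof (rule normalizable_product)
    assume "v \<in> words L" "v' \<in> words L"
    moreover have "length v + length v' < length w + length w'" using that pos by linarith
    ultimately have "normalizable L r i j k l (length v + length v' - 1)
        (\<lambda>N c. comm (tfree N c v i j) (tfree N c v' k l))"
      using less.hyps that by blast
    then show "normalizable L r i j k l ?n (\<lambda>N c. comm (tfree N c v i j) (tfree N c v' k l))"
      by (rule normalizable_mono) (use that in linarith)
  qed (use that in auto)
  have "normalizable L r i j k l ?n (\<lambda>N c. \<Sum>x\<leftarrow>\<Phi>. term_val (tfree N c) i j k l x)"
  proof (rule normalizable_sum_list)
    fix x assume "x \<in> set \<Phi>"
    obtain z b v v' where x: "x = (z, b, v, v')" by (metis surj_pair)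
    have v: "v @ v' \<noteq> []" "length v + length v' \<le> ?n" "set v \<union> set v' \<subseteq> {1..L}"
      using ok \<open>x \<in> set \<Phi>\<close> x by (auto simp: form_ok_def)
    have "normalizable L r i j k l ?n (\<lambda>N c. if b then tfree N c v k j * tfree N c v' i l
        else tfree N c v i j * tfree N c v' k l)"
    proof (cases b)
      case True
      then show ?thesis
        using normalizable_swap[OF less.prems(1-4) prod[OF v, of k j i l]] less.prems by simp
    next
      case False
      then show ?thesis using prod[OF v less.prems(1-4)] by simp
    qed
    from normalizable_int_mult[OF this, of z]
    show "normalizable L r i j k l ?n (\<lambda>N c. term_val (tfree N c) i j k l x)"
      by (simp add: x)
  qed
  then show ?case
    by (rule normalizable_cong_ideal)
      (use \<Phi> less.prems in \<open>simp add: form_val_def atLeastAtMost_iff\<close>)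
qed

end

section \<open>The limit algebra\<close>

lemma germ_eqI: "eventually (\<lambda>N. x N = y N) sequentially \<Longrightarrow> germ x = germ y"
  unfolding germ_def by (auto elim: eventually_elim2)

lemma germ_self: "x \<in> germ x"
  by (simp add: germ_def)

lemma germ_nonempty: "germ x \<noteq> {}"
  using germ_self[of x] by blast

lemma germ_binop:
  "(\<Union>u\<in>germ x. \<Union>v\<in>germ y. germ (\<lambda>N. f N (u N) (v N))) = germ (\<lambda>N. f N (x N) (y N))"
proof -
  have "germ (\<lambda>N. f N (u N) (v N)) = germ (\<lambda>N. f N (x N) (y N))" if "u \<in> germ x" "v \<in> germ y" for u v
    using that unfolding germ_def mem_Collect_eq
    by (intro germ_eqI[unfolded germ_def]) (auto elim: eventually_elim2)
  then have "(\<Union>u\<in>germ x. \<Union>v\<in>germ y. germ (\<lambda>N. f N (u N) (v N)))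
      = (\<Union>u\<in>germ x. \<Union>v\<in>germ y. germ (\<lambda>N. f N (x N) (y N)))"
    by (intro SUP_cong refl)
  then show ?thesis by (simp add: germ_nonempty)
qed

lemma germ_unop: "(\<Union>u\<in>germ x. germ (\<lambda>N. f N (u N))) = germ (\<lambda>N. f N (x N))"
  using germ_binop[where x = x and y = x and f = "\<lambda>N u v. f N u"] by (simp add: germ_nonempty)

definition free_germ :: "nat \<Rightarrow> (nat \<Rightarrow> gl_index free) \<Rightarrow> (nat \<Rightarrow> ugl_elt) set"
  where "free_germ L F = germ (\<lambda>N. ugl_cls N L (F N))"

definition eventually_in_C :: "nat \<Rightarrow> (nat \<Rightarrow> gl_index free) \<Rightarrow> bool"
  where "eventually_in_C L F \<longleftrightarrow> eventually (\<lambda>N. F N \<in> gl_C N L) sequentially"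

lemma A_inf_mult:
  assumes "eventually_in_C L F" "eventually_in_C L G"
  shows "free_germ L F \<otimes>\<^bsub>A_inf L\<^esub> free_germ L G = free_germ L (\<lambda>N. F N * G N)"
proof -
  have "free_germ L F \<otimes>\<^bsub>A_inf L\<^esub> free_germ L G
      = germ (\<lambda>N. ugl_cls N L (F N) \<otimes>\<^bsub>Ugl N L\<^esub> ugl_cls N L (G N))"
    using germ_binop[where f = "\<lambda>N u v. u \<otimes>\<^bsub>Ugl N L\<^esub> v"]
    by (simp add: free_germ_def A_inf_def germ_alg_def)
  also have "\<dots> = free_germ L (\<lambda>N. F N * G N)"
    unfolding free_germ_def
  proof (rule germ_eqI)
    show "eventually (\<lambda>N. ugl_cls N L (F N) \<otimes>\<^bsub>Ugl N L\<^esub> ugl_cls N L (G N) = ugl_cls N L (F N * G N)) sequentially"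
      using assms unfolding eventually_in_C_def by eventually_elim (rule Ugl_mult)
  qed
  finally show ?thesis .
qed

lemma A_inf_add:
  assumes "eventually_in_C L F" "eventually_in_C L G"
  shows "free_germ L F \<oplus>\<^bsub>A_inf L\<^esub> free_germ L G = free_germ L (\<lambda>N. F N + G N)"
proof -
  have "free_germ L F \<oplus>\<^bsub>A_inf L\<^esub> free_germ L G
      = germ (\<lambda>N. ugl_cls N L (F N) \<oplus>\<^bsub>Ugl N L\<^esub> ugl_cls N L (G N))"
    using germ_binop[where f = "\<lambda>N u v. u \<oplus>\<^bsub>Ugl N L\<^esub> v"]
    by (simp add: free_germ_def A_inf_def germ_alg_def)
  also have "\<dots> = free_germ L (\<lambda>N. F N + G N)"
    unfolding free_germ_def
  proof (rule germ_eqI)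
    show "eventually (\<lambda>N. ugl_cls N L (F N) \<oplus>\<^bsub>Ugl N L\<^esub> ugl_cls N L (G N) = ugl_cls N L (F N + G N)) sequentially"
      using assms unfolding eventually_in_C_def by eventually_elim (rule Ugl_add)
  qed
  finally show ?thesis .
qed

lemma A_inf_smult:
  assumes "eventually_in_C L F"
  shows "c \<odot>\<^bsub>A_inf L\<^esub> free_germ L F = free_germ L (\<lambda>N. fscal c * F N)"
proof -
  have "c \<odot>\<^bsub>A_inf L\<^esub> free_germ L F = germ (\<lambda>N. c \<odot>\<^bsub>Ugl N L\<^esub> ugl_cls N L (F N))"
    using germ_unop[where f = "\<lambda>N u. c \<odot>\<^bsub>Ugl N L\<^esub> u"]
    by (simp add: free_germ_def A_inf_def germ_alg_def)
  also have "\<dots> = free_germ L (\<lambda>N. fscal c * F N)"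
    unfolding free_germ_def
  proof (rule germ_eqI)
    show "eventually (\<lambda>N. c \<odot>\<^bsub>Ugl N L\<^esub> ugl_cls N L (F N) = ugl_cls N L (fscal c * F N)) sequentially"
      using assms unfolding eventually_in_C_def by eventually_elim (rule Ugl_smult)
  qed
  finally show ?thesis .
qed

lemma A_inf_one: "\<one>\<^bsub>A_inf L\<^esub> = free_germ L (\<lambda>N. 1)"
  by (simp add: free_germ_def A_inf_def germ_alg_def Ugl_one)

lemma A_inf_zero: "\<zero>\<^bsub>A_inf L\<^esub> = free_germ L (\<lambda>N. 0)"
  by (simp add: free_germ_def A_inf_def germ_alg_def Ugl_zero)

lemma free_germ_eqI:
  assumes "eventually_in_C L F" "eventually_in_C L G" "eventually (\<lambda>N. F N - G N \<in> gl_I N L) sequentially"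
  shows "free_germ L F = free_germ L G"
  unfolding free_germ_def
proof (rule germ_eqI)
  show "eventually (\<lambda>N. ugl_cls N L (F N) = ugl_cls N L (G N)) sequentially"
    using assms unfolding eventually_in_C_def by eventually_elim (rule ugl_cls_eqI)
qed

lemma eventually_in_C_simps:
  "eventually_in_C L F \<Longrightarrow> eventually_in_C L G \<Longrightarrow> eventually_in_C L (\<lambda>N. F N * G N)"
  "eventually_in_C L F \<Longrightarrow> eventually_in_C L G \<Longrightarrow> eventually_in_C L (\<lambda>N. F N + G N)"
  "eventually_in_C L F \<Longrightarrow> eventually_in_C L G \<Longrightarrow> eventually_in_C L (\<lambda>N. F N - G N)"
  "eventually_in_C L (\<lambda>N. fscal c)" "eventually_in_C L (\<lambda>N. of_int z)"
  "eventually_in_C L (\<lambda>N. 0)" "eventually_in_C L (\<lambda>N. 1)"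
  unfolding eventually_in_C_def
  by (auto elim: eventually_elim2 intro: gl.C_mult gl.C_add gl.C_diff gl.C_of_int)

lemma eventually_in_C_t:
  assumes "(i, j, w) \<in> t_indices L"
  shows "eventually_in_C L (\<lambda>N. tfree N (of_nat N + s) w i j)"
  unfolding eventually_in_C_def
  using eventually_ge_at_top[of "max i j"]
proof eventually_elim
  case (elim N)
  then show ?case
    using assms by (intro tfree_C) (auto simp: t_indices_def words_def atLeastAtMost_iff in_lists_conv_set)
qed

lemma t_inf_eq:
  assumes "(i, j, w) \<in> t_indices L"
  shows "t_inf L s (i, j, w) = free_germ L (\<lambda>N. tfree N (of_nat N + s) w i j)"
  unfolding t_inf_def free_germ_def
proof (rule germ_eqI)
  show "eventually (\<lambda>N. t_fin N L s (i, j, w) = ugl_cls N L (tfree N (of_nat N + s) w i j)) sequentially"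
    using eventually_ge_at_top[of "max i j"]
  proof eventually_elim
    case (elim N)
    then show ?case
      using assms by (intro t_fin_eq) (auto simp: t_indices_def words_def atLeastAtMost_iff)
  qed
qed

lemma monomial_val_eq:
  assumes "set ps \<subseteq> t_indices L"
  shows "monomial_val L s ps = free_germ L (\<lambda>N. mono_val N (of_nat N + s) ps)"
    and "eventually_in_C L (\<lambda>N. mono_val N (of_nat N + s) ps)"
proof -
  have "monomial_val L s ps = free_germ L (\<lambda>N. mono_val N (of_nat N + s) ps) \<and>
      eventually_in_C L (\<lambda>N. mono_val N (of_nat N + s) ps)"
    using assms
  proof (induction ps)
    case Nil
    then show ?case
      by (simp add: monomial_val_def mono_val_def A_inf_one eventually_in_C_simps)
  next
    case (Cons p ps)
    obtain i j w where p: "p = (i, j, w)" by (metis surj_pair)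
    have t: "(i, j, w) \<in> t_indices L" using Cons.prems p by simp
    have "monomial_val L s (p # ps) = t_inf L s p \<otimes>\<^bsub>A_inf L\<^esub> monomial_val L s ps"
      by (simp add: monomial_val_def)
    moreover have "mono_val N c (p # ps) = tfree N c w i j * mono_val N c ps" for N c
      by (simp add: mono_val_def p)
    ultimately show ?case
      using Cons t by (simp add: p t_inf_eq A_inf_mult eventually_in_C_t eventually_in_C_simps)
  qed
  then show "monomial_val L s ps = free_germ L (\<lambda>N. mono_val N (of_nat N + s) ps)"
    and "eventually_in_C L (\<lambda>N. mono_val N (of_nat N + s) ps)" by auto
qed

lemma int_lincomb_eq:
  assumes "\<And>z ps. (z, ps) \<in> set \<Psi> \<Longrightarrow> set ps \<subseteq> t_indices L"
  shows "int_lincomb (A_inf L) (map (\<lambda>(z, ps). (z, monomial_val L s ps)) \<Psi>)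
      = free_germ L (\<lambda>N. comb_val N (of_nat N + s) \<Psi>)"
    and "eventually_in_C L (\<lambda>N. comb_val N (of_nat N + s) \<Psi>)"
proof -
  have "int_lincomb (A_inf L) (map (\<lambda>(z, ps). (z, monomial_val L s ps)) \<Psi>)
      = free_germ L (\<lambda>N. comb_val N (of_nat N + s) \<Psi>) \<and> eventually_in_C L (\<lambda>N. comb_val N (of_nat N + s) \<Psi>)"
    using assms
  proof (induction \<Psi>)
    case Nil
    then show ?case by (simp add: int_lincomb_def A_inf_zero eventually_in_C_simps)
  next
    case (Cons x \<Psi>)
    obtain z ps where x: "x = (z, ps)" by (metis surj_pair)
    have ps: "set ps \<subseteq> t_indices L" using Cons.prems x by auto
    have IH: "int_lincomb (A_inf L) (map (\<lambda>(z, ps). (z, monomial_val L s ps)) \<Psi>)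
        = free_germ L (\<lambda>N. comb_val N (of_nat N + s) \<Psi>)" "eventually_in_C L (\<lambda>N. comb_val N (of_nat N + s) \<Psi>)"
      using Cons.IH Cons.prems by auto
    have fs: "fscal (of_int z) = (of_int z :: gl_index free)"
      by (cases z rule: int_diff_cases) (simp add: fscal_diff fscal_simps)
    have "int_lincomb (A_inf L) (map (\<lambda>(z, ps). (z, monomial_val L s ps)) (x # \<Psi>))
        = (of_int z \<odot>\<^bsub>A_inf L\<^esub> monomial_val L s ps) \<oplus>\<^bsub>A_inf L\<^esub>
          int_lincomb (A_inf L) (map (\<lambda>(z, ps). (z, monomial_val L s ps)) \<Psi>)"
      by (simp add: int_lincomb_def x)
    then show ?case
      using IH monomial_val_eq[OF ps, of s]
      by (simp add: x A_inf_smult A_inf_add eventually_in_C_simps fs)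
  qed
  then show "int_lincomb (A_inf L) (map (\<lambda>(z, ps). (z, monomial_val L s ps)) \<Psi>)
      = free_germ L (\<lambda>N. comb_val N (of_nat N + s) \<Psi>)"
    and "eventually_in_C L (\<lambda>N. comb_val N (of_nat N + s) \<Psi>)" by auto
qed

lemma alg_commutator_eq:
  assumes "eventually_in_C L F" "eventually_in_C L G"
  shows "alg_commutator (A_inf L) (free_germ L F) (free_germ L G) = free_germ L (\<lambda>N. comm (F N) (G N))"
proof -
  have "alg_commutator (A_inf L) (free_germ L F) (free_germ L G)
      = free_germ L (\<lambda>N. F N * G N) \<oplus>\<^bsub>A_inf L\<^esub> free_germ L (\<lambda>N. fscal (- 1) * (G N * F N))"
    using assms by (simp only: alg_commutator_def A_inf_mult A_inf_smult eventually_in_C_simps)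
  also have "\<dots> = free_germ L (\<lambda>N. F N * G N + fscal (- 1) * (G N * F N))"
    by (intro A_inf_add eventually_in_C_simps assms)
  finally show ?thesis by (simp add: fscal_simps)
qed

text \<open>Equal monomials are merged, since the theorem asks for pairwise distinct ones.\<close>

lemma collect_terms:
  "\<exists>(m :: nat) \<tau> c. inj_on \<tau> {1..m} \<and> \<tau> ` {1..m} \<subseteq> snd ` set \<Psi> \<and>
    (\<forall>N s. comb_val N s (map (\<lambda>p. (c p, \<tau> p)) [1..<Suc m]) = comb_val N s \<Psi>)"
proof -
  define S where "S = remdups (map snd \<Psi>)"
  define m where "m = length S"
  define \<tau> where "\<tau> p = S ! (p - 1)" for p
  define coeff where "coeff ps = (\<Sum>(z, qs)\<leftarrow>\<Psi>. if qs = ps then z else 0)" for ps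
  have S: "distinct S" "set S = snd ` set \<Psi>" by (simp_all add: S_def)
  have map\<tau>: "map \<tau> [1..<Suc m] = S"
    by (rule nth_equalityI) (auto simp: m_def \<tau>_def simp del: upt_Suc)
  have val: "comb_val N s (map (\<lambda>p. (coeff (\<tau> p), \<tau> p)) [1..<Suc m]) = comb_val N s \<Psi>" for N s
  proof -
    have "comb_val N s (map (\<lambda>p. (coeff (\<tau> p), \<tau> p)) [1..<Suc m]) = comb_val N s (map (\<lambda>ps. (coeff ps, ps)) (map \<tau> [1..<Suc m]))"
      by (simp only: map_map o_def)
    also have "\<dots> = (\<Sum>ps\<in>set S. of_int (coeff ps) * mono_val N s ps)"
      unfolding map\<tau> comb_val_def by (simp add: o_def sum_list_distinct_conv_sum_set[OF S(1)])
    also have "\<dots> = comb_val N s \<Psi>"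
    proof -
      have "(\<Sum>ps\<in>A. of_int (\<Sum>(z, qs)\<leftarrow>\<Psi>'. if qs = ps then z else 0) * mono_val N s ps) = comb_val N s \<Psi>'"
        if "finite A" "snd ` set \<Psi>' \<subseteq> A" for A \<Psi>'
        using that(2)
      proof (induction \<Psi>')
        case (Cons x \<Psi>')
        obtain z qs where x: "x = (z, qs)" by (metis surj_pair)
        have "(\<Sum>ps\<in>A. of_int (\<Sum>(z, qs)\<leftarrow>x # \<Psi>'. if qs = ps then z else 0) * mono_val N s ps)
           = (\<Sum>ps\<in>A. (if ps = qs then of_int z * mono_val N s qs else 0)
             + of_int (\<Sum>(z, qs)\<leftarrow>\<Psi>'. if qs = ps then z else 0) * mono_val N s ps)"
          by (intro sum.cong) (auto simp: x distrib_right)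
        then show ?case
          using Cons that(1) by (simp add: sum.distrib x)
      qed simp
      from this[of "set S" \<Psi>] show ?thesis unfolding coeff_def using S by simp
    qed
    finally show ?thesis .
  qed
  have inj: "inj_on \<tau> {1..m}"
    using S(1) by (auto simp: inj_on_def \<tau>_def m_def nth_eq_iff_index_eq atLeastAtMost_iff)
  have sub: "\<tau> ` {1..m} \<subseteq> snd ` set \<Psi>"
    unfolding S(2)[symmetric] by (auto simp: \<tau>_def m_def atLeastAtMost_iff)
  show ?thesis
    by (rule exI[of _ m], rule exI[of _ \<tau>], rule exI[of _ "\<lambda>p. coeff (\<tau> p)"]) (intro conjI allI inj sub val)
qed

theorem theorem7p7:
  fixes L i j k l :: nat and r :: "t_index rel" and w w' :: "nat list"
  assumes "L \<ge> 2"
    and "linear_order_on (t_indices L) r"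
    and "i \<ge> 1" and "j \<ge> 1" and "k \<ge> 1" and "l \<ge> 1"
    and "w \<in> words L" and "w' \<in> words L"
  shows "\<exists>(m :: nat) (\<tau> :: nat \<Rightarrow> t_monomial) (c :: nat \<Rightarrow> int).
    inj_on \<tau> {1..m} \<and>
    (\<forall>p\<in>{1..m}. normal_monomial L r (\<tau> p) \<and>
      monomial_degree (\<tau> p) \<le> length w + length w' - 1 \<and>
      admissible_monomial L r i j k l (\<tau> p)) \<and>
    (\<forall>s :: complex.
      alg_commutator (A_inf L) (t_inf L s (i, j, w)) (t_inf L s (k, l, w')) =
      int_lincomb (A_inf L) (map (\<lambda>p. (c p, monomial_val L s (\<tau> p))) [1..<Suc m]))"
proof -
  let ?n = "length w + length w' - 1"
  obtain \<Psi> where ok: "\<forall>(z, ps)\<in>set \<Psi>. comb_ok L r i j k l ?n ps"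
    and \<Psi>: "\<And>N c. i \<le> N \<Longrightarrow> j \<le> N \<Longrightarrow> k \<le> N \<Longrightarrow> l \<le> N \<Longrightarrow>
      comm (tfree N c w i j) (tfree N c w' k l) - comb_val N c \<Psi> \<in> gl_I N L"
    using normalizable_commutator[OF assms(2-8)] unfolding normalizable_def by metis
  from collect_terms[of \<Psi>] obtain m :: nat and \<tau> c where inj: "inj_on \<tau> {1..m}"
    and \<tau>: "\<tau> ` {1..m} \<subseteq> snd ` set \<Psi>"
    and val: "\<forall>N s. comb_val N s (map (\<lambda>p. (c p, \<tau> p)) [1..<Suc m]) = comb_val N s \<Psi>"
    by (elim exE conjE)
  have ok\<tau>: "comb_ok L r i j k l ?n (\<tau> p)" if "p \<in> {1..m}" for p
    using \<tau> ok that by fastforce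
  have t: "(i, j, w) \<in> t_indices L" "(k, l, w') \<in> t_indices L"
    using assms by (simp_all add: t_indices_def)
  have "alg_commutator (A_inf L) (t_inf L s (i, j, w)) (t_inf L s (k, l, w')) =
      int_lincomb (A_inf L) (map (\<lambda>p. (c p, monomial_val L s (\<tau> p))) [1..<Suc m])" for s
  proof -
    let ?\<Psi> = "map (\<lambda>p. (c p, \<tau> p)) [1..<Suc m]"
    have sub: "set ps \<subseteq> t_indices L" if mem: "(z, ps) \<in> set ?\<Psi>" for z ps
    proof -
      obtain p where "p \<in> {1..m}" "ps = \<tau> p"
        using mem by (fastforce simp: atLeastAtMost_iff less_Suc_eq_le simp del: upt_Suc)
      then show ?thesis using ok\<tau>[of p] by (simp add: comb_ok_def normal_monomial_def)
    qed
    have "alg_commutator (A_inf L) (t_inf L s (i, j, w)) (t_inf L s (k, l, w'))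
        = free_germ L (\<lambda>N. comm (tfree N (of_nat N + s) w i j) (tfree N (of_nat N + s) w' k l))"
      by (simp only: t_inf_eq[OF t(1)] t_inf_eq[OF t(2)] alg_commutator_eq eventually_in_C_t t)
    also have "\<dots> = free_germ L (\<lambda>N. comb_val N (of_nat N + s) ?\<Psi>)"
    proof (rule free_germ_eqI)
      show "eventually_in_C L (\<lambda>N. comm (tfree N (of_nat N + s) w i j) (tfree N (of_nat N + s) w' k l))"
        by (intro eventually_in_C_simps eventually_in_C_t t)
      show "eventually_in_C L (\<lambda>N. comb_val N (of_nat N + s) ?\<Psi>)"
        by (rule int_lincomb_eq(2)) (rule sub)
      show "eventually (\<lambda>N. comm (tfree N (of_nat N + s) w i j) (tfree N (of_nat N + s) w' k l)
          - comb_val N (of_nat N + s) ?\<Psi> \<in> gl_I N L) sequentially"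
        unfolding val[rule_format] using eventually_ge_at_top[of "Max {i, j, k, l}"]
        by eventually_elim (simp add: \<Psi>)
    qed
    also have "\<dots> = int_lincomb (A_inf L) (map (\<lambda>(z, ps). (z, monomial_val L s ps)) ?\<Psi>)"
      by (rule int_lincomb_eq(1)[symmetric]) (rule sub)
    also have "map (\<lambda>(z, ps). (z, monomial_val L s ps)) ?\<Psi> = map (\<lambda>p. (c p, monomial_val L s (\<tau> p))) [1..<Suc m]"
      by (simp only: map_map o_def prod.case)
    finally show ?thesis .
  qed
  then show ?thesis
    using inj ok\<tau> unfolding comb_ok_def
    by (intro exI[of _ m] exI[of _ \<tau>] exI[of _ c]) simp
qed


end
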